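(* Let $E$ be a Banach space, $F$ a variationally sequentially complete Banach space that contains no isomorphic copy of $\ell_\infty^{\mathbb{R}}$, and $\Omega$ a locally compact Hausdorff space. For every continuous linear operator $T\colon C_0(\Omega,E)\to F$ there exists a unique regular Borel i-measure $\mu\colon\mathfrak{B}(\Omega)\to\mathcal{L}(E,F)$ such that $$Tf=\int_\Omega f\,\mathrm{d}\mu\qquad(f\in C_0(\Omega,E)).$$ Moreover, $\|T\|=\|\mu\|_\Omega$.
   Context: Banach spaces are over a fixed field $\mathbb{K}$ of real or complex numbers; $\mathcal{L}(E,F)$ is the Banach space of continuous linear operators $E\to F$; $C_0(\Omega,E)$ is the space of continuous functions $\Omega\to E$ vanishing at infinity with the sup-norm; $\mathfrak{B}(\Omega)$ is the Borel $\sigma$-algebra; $\ell_\infty^{\mathbb{R}}$ is the Banach space of bounded real sequences. $F$ is variationally sequentially complete (vsc) if there is a set $\mathscr{F}\subset F^*$ such that: (vsc1) there is a constant $\lambda>0$ with $\frac1\lambda\sup\{|\psi(x)|:\psi\in\mathscr{F}\}\le\|x\|\le\lambda\sup\{|\psi(x)|:\psi\in\mathscr{F}\}$ for all $x\in F$; (vsc2) whenever $z_n\in F$ are uniformly bounded and $\psi(z_n)$ converge for each $\psi\in\mathscr{F}$, there is $z\in F$ with $\lim_n\psi(z_n)=\psi(z)$ for all $\psi\in\mathscr{F}$. For $T_n\in\mathcal{L}(E,F)$, $\sum_n T_n$ is independently convergent if $\sum_n T_nx_n$ converges in the norm of $F$ for every bounded sequence $(x_n)$ in $E$. For a $\sigma$-algebra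 $\mathfrak{M}$ on a set $Z$, $\mu\colon\mathfrak{M}\to\mathcal{L}(E,F)$ is an i-measure if for any pairwise disjoint $A_n\in\mathfrak{M}$, $\mu(\bigcup_n A_n)x=\sum_n\mu(A_n)x$ for each $x\in E$ and $\sum_n\mu(A_n)$ is independently convergent. Its total semivariation $\|\mu\|_Z$ is the supremum of $\|\sum_{n=1}^N\mu(A_n)x_n\|$ over finite $N$, pairwise disjoint $A_n\in\mathfrak{M}$, $x_n\in E$ with $\|x_n\|\le1$; it is known to be finite. $S_{\mathfrak{M}}(Z,E)$ is the set of bounded $f\colon Z\to E$ with $f(Z)$ countable and $f^{-1}(\{e\})\in\mathfrak{M}$ for all $e\in E$; for such $f$, $\int_Z f\,\mathrm{d}\mu=\sum_{e\in E}\mu(f^{-1}(\{e\}))e$ (unconditionally convergent). $M_{\mathfrak{M}}(Z,E)$ is the space of bounded $f\colon Z\to E$ with $f(Z)$ separable and $\psi\circ f$ $\mathfrak{M}$-measurable for each $\psi\in E^*$; it is the uniform closure of $S_{\mathfrak{M}}(Z,E)$. The integral is linear and sup-norm continuous on $S_{\mathfrak{M}}(Z,E)$ with norm $\|\mu\|_Z$ and is extended to $M_{\mathfrak{M}}(Z,E)$ by continuity. Note $C_0(\Omega,E)\subset M_{\mathfrak{B}(\Omega)}(\Omega,E)$. An i-measure $\mu$ on $\mathfrak{B}(\Omega)$ is regular if every $A\in\mathfrak{B}(\Omega)$ includes a $\sigma$-compact set $K$ (a countable union of compact sets) such that $\mu$ vanishes on every Borel set contained in $A\setminus K$. *)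

theory Defs
  imports "HOL-Analysis.Analysis"
begin

(* The scalar field is, up to an isometric field isomorphism, the reals or the complex numbers. *)
class real_or_complex = real_normed_field +
  assumes real_or_complex:
    "\<exists>h :: 'a \<Rightarrow> complex.
       (\<forall>x y. h (x + y) = h x + h y) \<and> (\<forall>x y. h (x * y) = h x * h y) \<and>
       (\<forall>x. norm (h x) = norm x) \<and> (range h = \<real> \<or> range h = UNIV)"

instance real :: real_or_complex
  by standard (rule exI[of _ complex_of_real], auto simp: Reals_def)

instance complex :: real_or_complex
  by standard (rule exI[of _ "\<lambda>x. x"], auto)

(* A Banach space over 'k: a real Banach space with a scalar multiplication by 'k that extends
   the real one and for which the given norm is a 'k-norm. *)
locale banach_over = vector_space scale
  for scale :: "'k::real_or_complex \<Rightarrow> 'a::banach \<Rightarrow> 'a" +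
  assumes norm_scale: "norm (scale c x) = norm c * norm x"
    and scale_of_real: "scale (of_real r) x = r *\<^sub>R x"

lemma banach_over_scaleR: "banach_over (scaleR :: real \<Rightarrow> 'a::banach \<Rightarrow> 'a)"
  by unfold_locales (simp_all add: scaleR_right_distrib scaleR_left_distrib)

lemma banach_over_complex: "banach_over ((*) :: complex \<Rightarrow> complex \<Rightarrow> complex)"
  by unfold_locales (simp_all add: algebra_simps norm_mult scaleR_conv_of_real)

(* The library type of bounded linear maps is real-linear; here they are linear over 'k.
   The norm of the type is the usual operator norm. *)
definition operators ::
  "('k::real_or_complex \<Rightarrow> 'a::banach \<Rightarrow> 'a) \<Rightarrow> ('k \<Rightarrow> 'b::real_normed_vector \<Rightarrow> 'b) \<Rightarrow> ('a \<Rightarrow>\<^sub>L 'b) set"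
  where "operators sE sF = {T. Vector_Spaces.linear sE sF (blinfun_apply T)}"

abbreviation dual :: "('k::real_or_complex \<Rightarrow> 'a::banach \<Rightarrow> 'a) \<Rightarrow> ('a \<Rightarrow>\<^sub>L 'k) set"
  where "dual sE \<equiv> operators sE (*)"

(* The suprema are taken in ennreal, so the first inequality includes their finiteness. *)
definition variationally_seq_complete :: "('k::real_or_complex \<Rightarrow> 'b::banach \<Rightarrow> 'b) \<Rightarrow> bool"
  where "variationally_seq_complete sF \<longleftrightarrow>
    (\<exists>\<F> \<subseteq> dual sF.
      (\<exists>c::real. c > 0 \<and> (\<forall>x.
         ennreal (1 / c) * (SUP \<psi>\<in>\<F>. ennreal (norm (blinfun_apply \<psi> x))) \<le> ennreal (norm x) \<and>
         ennreal (norm x) \<le> ennreal c * (SUP \<psi>\<in>\<F>. ennreal (norm (blinfun_apply \<psi> x))))) \<and>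
      (\<forall>z :: nat \<Rightarrow> 'b.
         bounded (range z) \<longrightarrow> (\<forall>\<psi>\<in>\<F>. convergent (\<lambda>n. blinfun_apply \<psi> (z n))) \<longrightarrow>
         (\<exists>w. \<forall>\<psi>\<in>\<F>. (\<lambda>n. blinfun_apply \<psi> (z n)) \<longlonglongrightarrow> blinfun_apply \<psi> w)))"

(* nat is discrete, so the bounded continuous functions from nat to real are the bounded real
   sequences with the sup-norm. For complex scalars the embedding is still only real-linear. *)
definition contains_copy_of_linfty :: "'b::banach itself \<Rightarrow> bool"
  where "contains_copy_of_linfty _ \<longleftrightarrow>
    (\<exists>(J :: (nat \<Rightarrow>\<^sub>C real) \<Rightarrow> 'b) J'. linear J \<and> homeomorphism UNIV (range J) J J')"

definition C0 :: "('w::topological_space \<Rightarrow>\<^sub>C 'a::real_normed_vector) set"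
  where "C0 = {f. \<forall>e>0. \<exists>K. compact K \<and> (\<forall>x. x \<notin> K \<longrightarrow> norm (apply_bcontfun f x) < e)}"

(* Only the values on C0 matter. Homogeneity is phrased with the pointwise multiple g of f by c. *)
definition C0_operator ::
  "('k::real_or_complex \<Rightarrow> 'a::banach \<Rightarrow> 'a) \<Rightarrow> ('k \<Rightarrow> 'b::banach \<Rightarrow> 'b) \<Rightarrow>
   (('w::topological_space \<Rightarrow>\<^sub>C 'a) \<Rightarrow> 'b) \<Rightarrow> bool"
  where "C0_operator sE sF T \<longleftrightarrow>
    (\<forall>f\<in>C0. \<forall>g\<in>C0. T (f + g) = T f + T g) \<and>
    (\<forall>c. \<forall>f\<in>C0. \<forall>g\<in>C0.
       (\<forall>x. apply_bcontfun g x = sE c (apply_bcontfun f x)) \<longrightarrow> T g = sF c (T f)) \<and>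
    continuous_on C0 T"

definition C0_norm :: "(('w::topological_space \<Rightarrow>\<^sub>C 'a::banach) \<Rightarrow> 'b::banach) \<Rightarrow> ennreal"
  where "C0_norm T = (SUP f\<in>{f \<in> C0. norm f \<le> 1}. ennreal (norm (T f)))"

definition independently_convergent ::
  "(nat \<Rightarrow> ('a::real_normed_vector \<Rightarrow>\<^sub>L 'b::real_normed_vector)) \<Rightarrow> bool"
  where "independently_convergent T \<longleftrightarrow>
    (\<forall>x. bounded (range x) \<longrightarrow> summable (\<lambda>n. blinfun_apply (T n) (x n)))"

(* A \<sigma>-algebra is given by the space and the sets of the library type measure. Functions on the
   \<sigma>-algebra are extensional, so that equality of i-measures is equality on measurable sets. *)
definition i_measure ::
  "('k::real_or_complex \<Rightarrow> 'a::banach \<Rightarrow> 'a) \<Rightarrow> ('k \<Rightarrow> 'b::banach \<Rightarrow> 'b) \<Rightarrow> 'z measure \<Rightarrow>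
   ('z set \<Rightarrow> ('a \<Rightarrow>\<^sub>L 'b)) \<Rightarrow> bool"
  where "i_measure sE sF M \<mu> \<longleftrightarrow>
    \<mu> \<in> sets M \<rightarrow>\<^sub>E operators sE sF \<and>
    (\<forall>A :: nat \<Rightarrow> 'z set. range A \<subseteq> sets M \<and> disjoint_family A \<longrightarrow>
       (\<forall>x. (\<lambda>n. blinfun_apply (\<mu> (A n)) x) sums blinfun_apply (\<mu> (\<Union>n. A n)) x) \<and>
       independently_convergent (\<lambda>n. \<mu> (A n)))"

definition total_semivariation ::
  "'z measure \<Rightarrow> ('z set \<Rightarrow> ('a::banach \<Rightarrow>\<^sub>L 'b::banach)) \<Rightarrow> ennreal"
  where "total_semivariation M \<mu> =
    (SUP (N, A, x) \<in> {(N :: nat, A :: nat \<Rightarrow> 'z set, x :: nat \<Rightarrow> 'a).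
         (\<forall>n<N. A n \<in> sets M \<and> norm (x n) \<le> 1) \<and> disjoint_family_on A {..<N}}.
       ennreal (norm (\<Sum>n<N. blinfun_apply (\<mu> (A n)) (x n))))"

definition countably_valued :: "'z measure \<Rightarrow> ('z \<Rightarrow> 'a::banach) set"
  where "countably_valued M =
    {f. bounded (f ` space M) \<and> countable (f ` space M) \<and> (\<forall>e. f -` {e} \<inter> space M \<in> sets M)}"

definition integral_countably_valued ::
  "'z measure \<Rightarrow> ('z set \<Rightarrow> ('a::banach \<Rightarrow>\<^sub>L 'b::banach)) \<Rightarrow> ('z \<Rightarrow> 'a) \<Rightarrow> 'b"
  where "integral_countably_valued M \<mu> f =
    infsum (\<lambda>e. blinfun_apply (\<mu> (f -` {e} \<inter> space M)) e) UNIV"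

(* The extension by continuity to the uniform closure of countably_valued, that is, to the bounded
   weakly measurable functions of separable range. *)
definition i_integral ::
  "'z measure \<Rightarrow> ('z set \<Rightarrow> ('a::banach \<Rightarrow>\<^sub>L 'b::banach)) \<Rightarrow> ('z \<Rightarrow> 'a) \<Rightarrow> 'b"
  where "i_integral M \<mu> f =
    (THE v. \<forall>g. (\<forall>n. g n \<in> countably_valued M) \<and> uniform_limit (space M) g f sequentially \<longrightarrow>
       (\<lambda>n. integral_countably_valued M \<mu> (g n)) \<longlonglongrightarrow> v)"

definition regular_borel_i_measure ::
  "('k::real_or_complex \<Rightarrow> 'a::banach \<Rightarrow> 'a) \<Rightarrow> ('k \<Rightarrow> 'b::banach \<Rightarrow> 'b) \<Rightarrow>
   ('w::topological_space set \<Rightarrow> ('a \<Rightarrow>\<^sub>L 'b)) \<Rightarrow> bool"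
  where "regular_borel_i_measure sE sF \<mu> \<longleftrightarrow>
    i_measure sE sF borel \<mu> \<and>
    (\<forall>A\<in>sets borel. \<exists>K :: nat \<Rightarrow> 'w set.
       (\<forall>n. compact (K n)) \<and> (\<Union>n. K n) \<subseteq> A \<and>
       (\<forall>B\<in>sets borel. B \<subseteq> A - (\<Union>n. K n) \<longrightarrow> \<mu> B = 0))"

end

theory Submission
  imports Defs
begin

text \<open>
  If a series in \<open>F\<close> has bounded finite partial sums with coefficients in the unit ball but terms that do not
  tend to \<open>0\<close>, Rosenthal's lemma yields a subsequence almost biorthogonal to functionals of the
  determining set; sequential completeness then sums it against all bounded sequences, giving a copy of
  \<open>\<ell>\<^sub>\<infinity>\<close>. Hence \<open>T f\<^sub>n \<longrightarrow> 0\<close> whenever the \<open>f\<^sub>n\<close> are bounded with disjoint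
  supports, so the submeasure \<open>U \<mapsto> sup {\<parallel>T f\<parallel> : \<parallel>f\<parallel> \<le> 1, f = 0 off U}\<close> on open sets is inner
  regular by compact sets, and every Borel set \<open>A\<close> can be squeezed between a compact \<open>K\<close> and an open
  \<open>U\<close> with \<open>U - K\<close> of small submeasure. Therefore \<open>\<mu>(A) e = lim T (\<phi> e)\<close> exists in norm along
  Urysohn functions \<open>\<phi>\<close> with \<open>1\<^sub>K \<le> \<phi> \<le> 1\<^sub>U\<close>.
  Uniqueness follows since the semivariation of any regular i-measure is finite and continuous at the empty set
  (gliding hump), so its values are limits of the same \<open>T (\<phi> e)\<close>.
\<close>

text \<open>The hypotheses on \<open>F\<close> serve only to show that \<open>T\<close> sends
  bounded sequences with disjoint supports to null sequences; afterwards only norm estimates occur,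
  so the values of the measure are norm limits in \<open>F\<close> and no bidual appears. The sum of
  a bounded sequence against the almost biorthogonal vectors need not converge in norm; it exists
  only as an element whose images under the determining functionals are the right limits. For this
  embedding to be bounded below, the off-diagonal mass of each functional must stay a fixed fraction
  under its diagonal value, which is what Rosenthal's lemma provides. The submeasure is only
  finitely subadditive on open sets. Countable unions are handled by compactness: inner regularity
  of the union leaves a compact set that finitely many members cover. Equality of norms, with no
  extra factor, comes from replacing disjoint Borel sets simultaneously by functions whose sum is at
  most one, so that combinations with vectors of the unit ball stay in the unit ball of the function
  space.\<close>

section \<open>Copies of bounded sequences\<close>

text \<open>Induction on \<open>p\<close>, where \<open>p * \<epsilon>\<close> bounds all row sums.
  The naturals are split into infinitely many infinite columns. If no column works, each one
  contains a row whose off-diagonal mass inside that column exceeds \<open>\<epsilon>\<close>;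
  keeping one such row per column discards this mass and lowers the bound to
  \<open>(p - 1) * \<epsilon>\<close>.\<close>

lemma Rosenthal:
  fixes c :: "nat \<Rightarrow> nat \<Rightarrow> real"
  assumes "\<And>n k. 0 \<le> c n k" and "\<And>n S. finite S \<Longrightarrow> sum (c n) S \<le> C" and "\<epsilon> > 0"
  shows "\<exists>r :: nat \<Rightarrow> nat. inj r \<and> (\<forall>n S. finite S \<longrightarrow> n \<notin> S \<longrightarrow> (\<Sum>k\<in>S. c (r n) (r k)) \<le> \<epsilon>)"
proof -
  have main: "\<exists>r :: nat \<Rightarrow> nat. inj r \<and> (\<forall>n S. finite S \<longrightarrow> n \<notin> S \<longrightarrow> (\<Sum>k\<in>S. c (r n) (r k)) \<le> \<epsilon>)"
    if "\<And>n k. 0 \<le> c n k" "\<And>n S. finite S \<Longrightarrow> sum (c n) S \<le> real p * \<epsilon>"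
    for c :: "nat \<Rightarrow> nat \<Rightarrow> real" and p
    using that
  proof (induction p arbitrary: c)
    case 0
    have "sum (c n) S \<le> \<epsilon>" if "finite S" for n S
      using "0.prems"(2)[OF that, of n] \<open>\<epsilon> > 0\<close> by simp
    then have "inj (\<lambda>n::nat. n) \<and> (\<forall>n S. finite S \<longrightarrow> n \<notin> S \<longrightarrow> (\<Sum>k\<in>S. c n k) \<le> \<epsilon>)"
      by (simp add: inj_on_def)
    then show ?case by (intro exI[of _ "\<lambda>n::nat. n"])
  next
    case (Suc p)
    \<comment> \<open>\<open>e q\<close> enumerates the column \<open>q\<close>; the pairing
      bijection makes the columns disjoint.\<close>
    define e where "e q j = prod_encode (q, j)" for q j
    have inj_e: "inj (e q)" for q
      by (auto simp: e_def inj_on_def)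
    show ?case
    proof (cases "\<exists>q. \<forall>n S. finite S \<longrightarrow> n \<notin> S \<longrightarrow> (\<Sum>k\<in>S. c (e q n) (e q k)) \<le> \<epsilon>")
      case True
      then show ?thesis using inj_e by blast
    next
      case False
      then have "\<forall>q. \<exists>n S. finite S \<and> n \<notin> S \<and> (\<Sum>k\<in>S. c (e q n) (e q k)) > \<epsilon>"
        by (simp add: not_le)
      then obtain n S where nS: "\<And>q. finite (S q)" "\<And>q. n q \<notin> S q"
          "\<And>q. (\<Sum>k\<in>S q. c (e q (n q)) (e q k)) > \<epsilon>"
        by metis
      define g where "g q = e q (n q)" for q
      have inj_g: "inj g"
        by (auto simp: g_def e_def inj_on_def)
      have bnd: "(\<Sum>k\<in>R. c (g q) (g k)) \<le> real p * \<epsilon>" if "finite R" for q R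
      proof -
        \<comment> \<open>The range of \<open>g\<close> meets the column \<open>q\<close> only in
          \<open>e q (n q)\<close>, and \<open>n q\<close> is not in \<open>S q\<close>.\<close>
        have disj: "g ` R \<inter> e q ` S q = {}"
          using nS(2) by (auto simp: g_def e_def)
        have "(\<Sum>k\<in>R. c (g q) (g k)) + (\<Sum>k\<in>S q. c (g q) (e q k))
            = sum (c (g q)) (g ` R) + sum (c (g q)) (e q ` S q)"
          using inj_on_subset[OF inj_g] inj_on_subset[OF inj_e] by (simp add: sum.reindex)
        also have "\<dots> = sum (c (g q)) (g ` R \<union> e q ` S q)"
          using disj nS(1) that by (subst sum.union_disjoint) auto
        also have "\<dots> \<le> real (Suc p) * \<epsilon>"
          using nS(1) that by (intro Suc.prems) auto
        finally show ?thesis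
          using nS(3)[of q] by (simp add: g_def algebra_simps)
      qed
      obtain r :: "nat \<Rightarrow> nat" where r: "inj r" "\<forall>n S. finite S \<longrightarrow> n \<notin> S \<longrightarrow> (\<Sum>k\<in>S. c (g (r n)) (g (r k))) \<le> \<epsilon>"
        using Suc.IH[of "\<lambda>n k. c (g n) (g k)"] Suc.prems(1) bnd by auto
      then show ?thesis
        using inj_compose[OF inj_g r(1), unfolded o_def] by (intro exI[of _ "\<lambda>n. g (r n)"]) simp
    qed
  qed
  obtain p :: nat where p: "C \<le> real p * \<epsilon>"
    using reals_Archimedean3[OF \<open>\<epsilon> > 0\<close>] less_imp_le by blast
  then show ?thesis
    by (intro main[of c p, OF assms(1)] order_trans[OF assms(2) p])
qed

text \<open>Completeness is not part of the class; it is transported along the isometry onto a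
  closed subset of the complex numbers.\<close>

lemma convergent_if_Cauchy_real_or_complex:
  fixes s :: "nat \<Rightarrow> 'k::real_or_complex"
  assumes "Cauchy s"
  shows "convergent s"
proof -
  obtain h :: "'k \<Rightarrow> complex" where h: "\<And>x y. h (x + y) = h x + h y" "\<And>x. norm (h x) = norm x"
      and range_h: "range h = \<real> \<or> range h = UNIV"
    using real_or_complex by blast
  have h_diff: "h (x - y) = h x - h y" for x y
    using h(1)[of "x - y" y] by simp
  have dist_h: "dist (h x) (h y) = dist x y" for x y
    by (metis dist_norm h(2) h_diff)
  have "Cauchy (h \<circ> s)"
    using assms by (simp add: Cauchy_def dist_h)
  then obtain l where l: "(h \<circ> s) \<longlonglongrightarrow> l"
    using Cauchy_convergent convergent_def by blast
  have "closed (range h)"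
    using range_h closed_complex_Reals by auto
  then have "l \<in> range h"
    using l closed_sequentially[of "range h" "h \<circ> s"] by auto
  then obtain k where "l = h k" by blast
  then have "s \<longlonglongrightarrow> k"
    using l by (simp add: tendsto_dist_iff[of _ k] tendsto_dist_iff[of _ "h k"] dist_h)
  then show ?thesis
    by (auto simp: convergent_def)
qed

text \<open>Absolute convergence implies convergence, proved by hand because the scalar type is not
  of class \<open>banach\<close>.\<close>

lemma convergent_if_norm_sums_bounded:
  fixes s :: "nat \<Rightarrow> 'k::real_or_complex"
  assumes "\<And>S. finite S \<Longrightarrow> (\<Sum>k\<in>S. norm (s k)) \<le> B"
  shows "convergent (\<lambda>N. \<Sum>k<N. s k)"
proof (rule convergent_if_Cauchy_real_or_complex, rule metric_CauchyI)
  fix e :: real assume "e > 0"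
  have "summable (\<lambda>k. norm (s k))"
    using assms by (intro bounded_imp_summable[of _ B]) auto
  then obtain M where M: "\<And>m n. m \<ge> M \<Longrightarrow> norm (\<Sum>k=m..<n. norm (s k)) < e"
    using \<open>e > 0\<close> unfolding summable_Cauchy by blast
  have *: "dist (\<Sum>k<m. s k) (\<Sum>k<n. s k) < e" if "M \<le> m" "m \<le> n" for m n
  proof -
    have "(\<Sum>k<n. s k) = (\<Sum>k<m. s k) + (\<Sum>k=m..<n. s k)"
      using sum.atLeastLessThan_concat[of 0 m n s] that by (simp add: lessThan_atLeast0)
    then have "dist (\<Sum>k<m. s k) (\<Sum>k<n. s k) = norm (\<Sum>k=m..<n. s k)"
      by (simp add: dist_norm norm_minus_commute)
    also have "\<dots> \<le> norm (\<Sum>k=m..<n. norm (s k))"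
      by (simp add: norm_sum sum_nonneg)
    finally show ?thesis
      using M[OF that(1), of n] by linarith
  qed
  show "\<exists>M. \<forall>m\<ge>M. \<forall>n\<ge>M. dist (\<Sum>k<m. s k) (\<Sum>k<n. s k) < e"
  proof (intro exI[of _ M] allI impI)
    show "dist (\<Sum>k<m. s k) (\<Sum>k<n. s k) < e" if "m \<ge> M" "n \<ge> M" for m n
      using *[of m n] *[of n m] that by (cases "m \<le> n") (auto simp: dist_commute)
  qed
qed

text \<open>The suprema in \<open>ennreal\<close> become pointwise estimates. The fourth item is how
  the norming property is used later: a uniform bound over the family bounds the norm.\<close>

lemma vsc_obtains:
  fixes sF :: "'k::real_or_complex \<Rightarrow> 'b::banach \<Rightarrow> 'b"
  assumes "variationally_seq_complete sF"
  obtains \<F> c where "\<F> \<subseteq> dual sF" "c > 0"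
    "\<And>\<psi> x. \<psi> \<in> \<F> \<Longrightarrow> norm (blinfun_apply \<psi> x) \<le> c * norm x"
    "\<And>x t. 0 \<le> t \<Longrightarrow> (\<And>\<psi>. \<psi> \<in> \<F> \<Longrightarrow> norm (blinfun_apply \<psi> x) \<le> t) \<Longrightarrow> norm x \<le> c * t"
    "\<And>z. bounded (range z) \<Longrightarrow> (\<And>\<psi>. \<psi>\<in>\<F> \<Longrightarrow> convergent (\<lambda>n. blinfun_apply \<psi> (z n))) \<Longrightarrow>
         \<exists>w. \<forall>\<psi>\<in>\<F>. (\<lambda>n. blinfun_apply \<psi> (z n)) \<longlonglongrightarrow> blinfun_apply \<psi> w"
proof -
  obtain \<F> c where F: "\<F> \<subseteq> dual sF" "c > 0"
    and 1: "\<And>x. ennreal (1 / c) * (SUP \<psi>\<in>\<F>. ennreal (norm (blinfun_apply \<psi> x))) \<le> ennreal (norm x)"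
    and 2: "\<And>x. ennreal (norm x) \<le> ennreal c * (SUP \<psi>\<in>\<F>. ennreal (norm (blinfun_apply \<psi> x)))"
    and 3: "\<forall>z :: nat \<Rightarrow> 'b. bounded (range z) \<longrightarrow> (\<forall>\<psi>\<in>\<F>. convergent (\<lambda>n. blinfun_apply \<psi> (z n))) \<longrightarrow>
         (\<exists>w. \<forall>\<psi>\<in>\<F>. (\<lambda>n. blinfun_apply \<psi> (z n)) \<longlonglongrightarrow> blinfun_apply \<psi> w)"
    using assms unfolding variationally_seq_complete_def by blast
  have up: "norm (blinfun_apply \<psi> x) \<le> c * norm x" if "\<psi> \<in> \<F>" for \<psi> x
  proof -
    have "ennreal (1 / c) * ennreal (norm (blinfun_apply \<psi> x)) \<le> ennreal (norm x)"
      by (rule order_trans[OF mult_left_mono 1]) (auto intro: SUP_upper that)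
    then show ?thesis
      using \<open>c > 0\<close> by (simp add: ennreal_mult'[symmetric] field_simps)
  qed
  have low: "norm x \<le> c * t" if "0 \<le> t" "\<And>\<psi>. \<psi> \<in> \<F> \<Longrightarrow> norm (blinfun_apply \<psi> x) \<le> t" for x t
  proof -
    have "ennreal (norm x) \<le> ennreal c * ennreal t"
      by (rule order_trans[OF 2 mult_left_mono]) (auto intro!: SUP_least ennreal_leI that)
    then show ?thesis
      using \<open>c > 0\<close> that(1) by (simp add: ennreal_mult'[symmetric])
  qed
  show thesis
    using F up low 3 by (intro that[of \<F> c]) auto
qed

lemma homeomorphism_range_if_bounded_below:
  fixes J :: "'x::real_normed_vector \<Rightarrow> 'y::real_normed_vector"
  assumes "linear J" "\<And>a. norm (J a) \<le> C * norm a" "c > 0" "\<And>a. c * norm a \<le> norm (J a)"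
  shows "homeomorphism UNIV (range J) J (inv J)"
proof -
  interpret linear J by fact
  have "bounded_linear J"
    using assms(1,2) by (intro bounded_linear_intro[of J C]) (auto simp: add scale mult.commute)
  then have cont: "continuous_on UNIV J"
    by (simp add: linear_continuous_on)
  have dist_J: "c * dist x y \<le> dist (J x) (J y)" for x y
    using assms(4)[of "x - y"] by (simp add: dist_norm diff)
  have "inj J"
  proof (rule injI)
    fix x y assume "J x = J y"
    then show "x = y"
      using dist_J[of x y] \<open>c > 0\<close> by (simp add: mult_le_0_iff)
  qed
  have "continuous_on (range J) (inv J)"
    unfolding continuous_on_iff
  proof safe
    fix x and e :: real assume "e > 0"
    have "dist (inv J x') (inv J (J x)) < e" if x': "x' \<in> range J" "dist x' (J x) < c * e" for x'
    proof -
      obtain y where y: "x' = J y"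
        using x'(1) by blast
      have "c * dist y x < c * e"
        using dist_J[of y x] x'(2) y by (simp add: dist_commute)
      then show ?thesis
        using \<open>c > 0\<close> \<open>inj J\<close> y by simp
    qed
    then show "\<exists>d>0. \<forall>x'\<in>range J. dist x' (J x) < d \<longrightarrow> dist (inv J x') (inv J (J x)) < e"
      using \<open>c > 0\<close> \<open>e > 0\<close> by (intro exI[of _ "c * e"]) auto
  qed
  then show ?thesis
    using cont \<open>inj J\<close> by (auto simp: homeomorphism_def)
qed

text \<open>\<open>J a\<close> plays the role of the sum of \<open>a k *\<^sub>R e k\<close>, taken
  against the functionals of the family. The upper bound of \<open>J\<close> comes from
  \<open>sums\<close>; for the lower bound, \<open>\<theta> n\<close> recovers the coordinate
  \<open>n\<close> of \<open>a\<close> up to an error of at most half the norm of \<open>a\<close>,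
  measured in units of \<open>d\<close>.\<close>

lemma contains_copy_of_linfty_if_almost_biorthogonal:
  fixes e :: "nat \<Rightarrow> 'b::banach"
  assumes "c > 0"
    and low: "\<And>x t. 0 \<le> t \<Longrightarrow> (\<And>\<psi>. \<psi> \<in> \<F> \<Longrightarrow> norm (blinfun_apply (\<psi> :: 'b \<Rightarrow>\<^sub>L 'k::real_or_complex) x) \<le> t) \<Longrightarrow> norm x \<le> c * t"
    and up: "\<And>\<psi> x. \<psi> \<in> \<F> \<Longrightarrow> norm (blinfun_apply \<psi> x) \<le> c * norm x"
    and complete: "\<And>z. bounded (range z) \<Longrightarrow> (\<And>\<psi>. \<psi>\<in>\<F> \<Longrightarrow> convergent (\<lambda>n. blinfun_apply \<psi> (z n))) \<Longrightarrow>
         \<exists>w. \<forall>\<psi>\<in>\<F>. (\<lambda>n. blinfun_apply \<psi> (z n)) \<longlonglongrightarrow> blinfun_apply \<psi> w"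
    and sums: "\<And>\<psi> S. \<psi> \<in> \<F> \<Longrightarrow> finite S \<Longrightarrow> (\<Sum>k\<in>S. norm (blinfun_apply \<psi> (e k))) \<le> D"
    and "d > 0" and \<theta>: "\<And>n. \<theta> n \<in> \<F>" "\<And>n. norm (blinfun_apply (\<theta> n) (e n)) \<ge> d"
    and off: "\<And>n S. finite S \<Longrightarrow> n \<notin> S \<Longrightarrow> (\<Sum>k\<in>S. norm (blinfun_apply (\<theta> n) (e k))) \<le> d / 2"
  shows "contains_copy_of_linfty TYPE('b)"
proof -
  define P where "P a N = (\<Sum>k<N. apply_bcontfun a k *\<^sub>R e k)" for a :: "nat \<Rightarrow>\<^sub>C real" and N
  have "D \<ge> 0"
    using sums[OF \<theta>(1), of "{}"] by simp
  have psiP: "blinfun_apply \<psi> (P a N) = (\<Sum>k<N. apply_bcontfun a k *\<^sub>R blinfun_apply \<psi> (e k))"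
    for a N and \<psi> :: "'b \<Rightarrow>\<^sub>L 'k"
    by (simp add: P_def blinfun.sum_right blinfun.scaleR_right)
  have nsum: "(\<Sum>k\<in>S. norm (apply_bcontfun a k *\<^sub>R blinfun_apply \<psi> (e k))) \<le> norm a * D"
    if "finite S" "\<psi> \<in> \<F>" for a S \<psi>
  proof -
    have "(\<Sum>k\<in>S. norm (apply_bcontfun a k *\<^sub>R blinfun_apply \<psi> (e k)))
        \<le> (\<Sum>k\<in>S. norm a * norm (blinfun_apply \<psi> (e k)))"
      using norm_bounded[of a] by (intro sum_mono) (auto intro!: mult_right_mono)
    also have "\<dots> \<le> norm a * D"
      using sums[OF that(2,1)] by (auto simp: sum_distrib_left[symmetric] intro!: mult_left_mono)
    finally show ?thesis .
  qed
  have npsiP: "norm (blinfun_apply \<psi> (P a N)) \<le> norm a * D" if "\<psi> \<in> \<F>" for a N \<psi>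
    unfolding psiP by (rule order_trans[OF norm_sum nsum[OF _ that]]) simp
  have "\<exists>w. \<forall>\<psi>\<in>\<F>. (\<lambda>n. blinfun_apply \<psi> (P a n)) \<longlonglongrightarrow> blinfun_apply \<psi> w" for a
  proof (rule complete)
    show "bounded (range (P a))"
      using low[of "norm a * D"] npsiP \<open>D \<ge> 0\<close>
      by (intro boundedI[of _ "c * (norm a * D)"]) auto
    show "convergent (\<lambda>n. blinfun_apply \<psi> (P a n))" if "\<psi> \<in> \<F>" for \<psi>
      unfolding psiP using nsum[OF _ that] by (intro convergent_if_norm_sums_bounded) auto
  qed
  then obtain J where J: "\<And>a \<psi>. \<psi> \<in> \<F> \<Longrightarrow> (\<lambda>n. blinfun_apply \<psi> (P a n)) \<longlonglongrightarrow> blinfun_apply \<psi> (J a)"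
    by metis
  \<comment> \<open>The family separates points, so \<open>J\<close> is determined by its defining
    limits; linearity follows from this.\<close>
  have eqI: "x = y" if "\<And>\<psi>. \<psi> \<in> \<F> \<Longrightarrow> blinfun_apply \<psi> x = blinfun_apply \<psi> y" for x y :: 'b
    using low[of 0 "x - y"] that by (simp add: blinfun.diff_right)
  have "linear J"
  proof (rule linearI)
    show "J (a + b) = J a + J b" for a b
    proof (rule eqI)
      fix \<psi> assume "\<psi> \<in> \<F>"
      have "P (a + b) N = P a N + P b N" for N
        by (simp add: P_def algebra_simps sum.distrib)
      then show "blinfun_apply \<psi> (J (a + b)) = blinfun_apply \<psi> (J a + J b)"
        using LIMSEQ_unique[OF J[OF \<open>\<psi> \<in> \<F>\<close>, of "a + b"]]
          tendsto_add[OF J[OF \<open>\<psi> \<in> \<F>\<close>, of a] J[OF \<open>\<psi> \<in> \<F>\<close>, of b]]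
        by (simp add: blinfun.add_right)
    qed
    show "J (r *\<^sub>R a) = r *\<^sub>R J a" for r a
    proof (rule eqI)
      fix \<psi> assume "\<psi> \<in> \<F>"
      have "P (r *\<^sub>R a) N = r *\<^sub>R P a N" for N
        by (simp add: P_def scaleR_sum_right)
      then show "blinfun_apply \<psi> (J (r *\<^sub>R a)) = blinfun_apply \<psi> (r *\<^sub>R J a)"
        using LIMSEQ_unique[OF J[OF \<open>\<psi> \<in> \<F>\<close>, of "r *\<^sub>R a"]]
          tendsto_scaleR[OF tendsto_const[of r] J[OF \<open>\<psi> \<in> \<F>\<close>, of a]]
        by (simp add: blinfun.scaleR_right)
    qed
  qed
  have ub: "norm (J a) \<le> (c * D) * norm a" for a
  proof -
    have "norm (blinfun_apply \<psi> (J a)) \<le> norm a * D" if "\<psi> \<in> \<F>" for \<psi>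
      using npsiP[OF that] by (intro LIMSEQ_le_const2[OF tendsto_norm[OF J[OF that]]]) blast
    then show ?thesis
      using low[of "norm a * D" "J a"] \<open>D \<ge> 0\<close> by (simp add: mult_ac)
  qed
  \<comment> \<open>The term \<open>k = n\<close> of the partial sum dominates, and
    \<open>off\<close> bounds all others together; then \<open>N\<close> tends to infinity.\<close>
  have coord: "\<bar>apply_bcontfun a n\<bar> * d \<le> c * norm (J a) + norm a * (d / 2)" for a n
  proof -
    have "\<bar>apply_bcontfun a n\<bar> * d - norm a * (d / 2) \<le> norm (blinfun_apply (\<theta> n) (P a N))" if "N > n" for N
    proof -
      define R where "R = (\<Sum>k\<in>{..<N} - {n}. apply_bcontfun a k *\<^sub>R blinfun_apply (\<theta> n) (e k))"
      have "blinfun_apply (\<theta> n) (P a N) = apply_bcontfun a n *\<^sub>R blinfun_apply (\<theta> n) (e n) + R"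
        unfolding psiP R_def using that by (subst sum.remove[of _ n]) auto
      moreover have "norm R \<le> norm a * (d / 2)"
      proof -
        have "norm R \<le> (\<Sum>k\<in>{..<N} - {n}. norm a * norm (blinfun_apply (\<theta> n) (e k)))"
          unfolding R_def using norm_bounded[of a]
          by (intro sum_norm_le) (auto intro!: mult_right_mono)
        also have "\<dots> \<le> norm a * (d / 2)"
          unfolding sum_distrib_left[symmetric] by (intro mult_left_mono off) auto
        finally show ?thesis .
      qed
      moreover have "\<bar>apply_bcontfun a n\<bar> * d \<le> norm (apply_bcontfun a n *\<^sub>R blinfun_apply (\<theta> n) (e n))"
        using \<theta>(2)[of n] by (auto intro!: mult_left_mono)
      ultimately show ?thesis
        by (smt (verit) norm_diff_ineq)
    qed
    then have "\<bar>apply_bcontfun a n\<bar> * d - norm a * (d / 2) \<le> norm (blinfun_apply (\<theta> n) (J a))"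
      by (intro LIMSEQ_le_const[OF tendsto_norm[OF J[OF \<theta>(1)]]]) (meson Suc_le_eq)
    then show ?thesis
      using up[OF \<theta>(1), of n "J a"] by linarith
  qed
  have lb: "(d / (2 * c)) * norm a \<le> norm (J a)" for a
  proof -
    \<comment> \<open>Supremum over \<open>n\<close> in \<open>coord\<close>; the summand
      \<open>norm a * (d / 2)\<close> can then be absorbed on the left.\<close>
    have "norm a \<le> (c * norm (J a) + norm a * (d / 2)) / d"
      using coord[of a] \<open>d > 0\<close> by (intro norm_bound) (simp add: field_simps)
    then show ?thesis
      using \<open>d > 0\<close> \<open>c > 0\<close> by (simp add: field_simps)
  qed
  have "homeomorphism UNIV (range J) J (inv J)"
    using \<open>linear J\<close> ub lb \<open>d > 0\<close> \<open>c > 0\<close>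
    by (intro homeomorphism_range_if_bounded_below[of J "c * D" "d / (2 * c)"]) auto
  then show ?thesis
    using \<open>linear J\<close> unfolding contains_copy_of_linfty_def by blast
qed

text \<open>A criterion in the spirit of Bessaga and Pelczynski. The bound on combinations makes
  \<open>\<psi> (y n)\<close> absolutely summable, uniformly over the determining family; terms
  bounded away from zero would then yield a copy of the bounded sequences.\<close>

lemma tendsto_0_if_combinations_bounded:
  fixes sF :: "'k::real_or_complex \<Rightarrow> 'b::banach \<Rightarrow> 'b" and y :: "nat \<Rightarrow> 'b"
  assumes "variationally_seq_complete sF" "\<not> contains_copy_of_linfty TYPE('b)"
    and bound: "\<And>S a. finite S \<Longrightarrow> (\<And>n. norm (a n) \<le> 1) \<Longrightarrow> norm (\<Sum>n\<in>S. sF (a n) (y n)) \<le> C"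
  shows "y \<longlonglongrightarrow> 0"
proof (rule ccontr)
  assume "\<not> y \<longlonglongrightarrow> 0"
  then obtain \<delta> where \<delta>: "\<delta> > 0" "\<And>N. \<exists>n\<ge>N. norm (y n) \<ge> \<delta>"
    unfolding LIMSEQ_iff by (auto simp: not_less)
  define s where "s = enumerate {n. norm (y n) \<ge> \<delta>}"
  have inf: "infinite {n. norm (y n) \<ge> \<delta>}"
    unfolding infinite_nat_iff_unbounded_le using \<delta>(2) by auto
  have s: "inj s" "\<And>n. norm (y (s n)) \<ge> \<delta>"
    using strict_mono_enumerate[OF inf] enumerate_in_set[OF inf] 
    by (auto simp: s_def intro: strict_mono_imp_inj_on)
  obtain \<F> c where F: "\<F> \<subseteq> dual sF" "c > 0"
    and up: "\<And>\<psi> x. \<psi> \<in> \<F> \<Longrightarrow> norm (blinfun_apply \<psi> x) \<le> c * norm x"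
    and low: "\<And>x t. 0 \<le> t \<Longrightarrow> (\<And>\<psi>. \<psi> \<in> \<F> \<Longrightarrow> norm (blinfun_apply \<psi> x) \<le> t) \<Longrightarrow> norm x \<le> c * t"
    and complete: "\<And>z. bounded (range z) \<Longrightarrow> (\<And>\<psi>. \<psi>\<in>\<F> \<Longrightarrow> convergent (\<lambda>n. blinfun_apply \<psi> (z n))) \<Longrightarrow>
         \<exists>w. \<forall>\<psi>\<in>\<F>. (\<lambda>n. blinfun_apply \<psi> (z n)) \<longlonglongrightarrow> blinfun_apply \<psi> w"
    using vsc_obtains[OF assms(1)] by metis
  have sums: "(\<Sum>n\<in>S. norm (blinfun_apply \<psi> (y n))) \<le> c * C" if "\<psi> \<in> \<F>" "finite S" for \<psi> S
  proof -
    interpret Vector_Spaces.linear sF "(*)" "blinfun_apply \<psi>"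
      using F(1) that(1) by (auto simp: operators_def)
    \<comment> \<open>Coefficients that turn every \<open>\<psi> (y n)\<close> into its absolute
      value; where it vanishes, division by zero gives 0, which is harmless.\<close>
    define a where "a n = of_real (norm (blinfun_apply \<psi> (y n))) / blinfun_apply \<psi> (y n)" for n
    have a: "norm (a n) \<le> 1" "a n * blinfun_apply \<psi> (y n) = of_real (norm (blinfun_apply \<psi> (y n)))" for n
      by (auto simp: a_def norm_divide)
    have "blinfun_apply \<psi> (\<Sum>n\<in>S. sF (a n) (y n)) = of_real (\<Sum>n\<in>S. norm (blinfun_apply \<psi> (y n)))"
      by (simp add: sum scale a(2))
    then have "norm (blinfun_apply \<psi> (\<Sum>n\<in>S. sF (a n) (y n))) = (\<Sum>n\<in>S. norm (blinfun_apply \<psi> (y n)))"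
      by (simp del: of_real_sum add: sum_nonneg)
    moreover have "norm (blinfun_apply \<psi> (\<Sum>n\<in>S. sF (a n) (y n))) \<le> c * C"
      using up[OF that(1)] bound[OF that(2) a(1)] \<open>c > 0\<close>
      by (meson mult_left_mono less_imp_le order_trans)
    ultimately show ?thesis by simp
  qed
  \<comment> \<open>With the factor 2, the bound \<open>c * d\<close> is
    \<open>\<delta> / 2\<close>, strictly below the norms of the chosen terms, so some functional
    must reach \<open>d\<close>.\<close>
  define d where "d = \<delta> / (2 * c)"
  have "d > 0"
    using \<delta>(1) F(2) by (simp add: d_def)
  have "\<exists>\<psi>\<in>\<F>. norm (blinfun_apply \<psi> (y (s n))) \<ge> d" for n
  proof (rule ccontr)
    assume "\<not> ?thesis"
    then have "norm (y (s n)) \<le> c * d"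
      using \<open>d > 0\<close> by (intro low) auto
    then show False
      using s(2)[of n] \<delta>(1) F(2) by (simp add: d_def)
  qed
  then obtain \<psi> where psi: "\<And>n. \<psi> n \<in> \<F>" "\<And>n. norm (blinfun_apply (\<psi> n) (y (s n))) \<ge> d"
    by metis
  have sums': "(\<Sum>k\<in>S. norm (blinfun_apply \<psi>' (y (g k)))) \<le> c * C"
    if "\<psi>' \<in> \<F>" "finite S" "inj g" for \<psi>' S g
    using sums[OF that(1), of "g ` S"] that by (simp add: sum.reindex inj_on_subset[of g UNIV])
  \<comment> \<open>The tolerance is half of the diagonal lower bound \<open>d\<close>, as the
    embedding requires.\<close>
  obtain r :: "nat \<Rightarrow> nat" where r: "inj r"
    "\<And>n S. finite S \<Longrightarrow> n \<notin> S \<Longrightarrow> (\<Sum>k\<in>S. norm (blinfun_apply (\<psi> (r n)) (y (s (r k))))) \<le> d / 2"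
    using Rosenthal[of "\<lambda>n k. norm (blinfun_apply (\<psi> n) (y (s k)))" "c * C" "d / 2"]
      sums'[OF psi(1) _ s(1)] \<open>d > 0\<close> by auto
  have "contains_copy_of_linfty TYPE('b)"
    using sums'[of _ _ "\<lambda>k. s (r k)"] inj_compose[OF s(1) r(1)] psi r(2)
    by (intro contains_copy_of_linfty_if_almost_biorthogonal[of c \<F> "\<lambda>k. y (s (r k))" "c * C" d "\<lambda>n. \<psi> (r n)"]
        F(2) low up complete \<open>d > 0\<close>) (auto simp: o_def)
  then show False
    using assms(2) by simp
qed

section \<open>Semivariation and integral of i-measures\<close>

text \<open>An upper bound for the semivariation over \<open>A\<close> rather than the supremum
  itself: finiteness is known only after \<open>ex_semivar_le_space\<close>, and real bounds keep
  the estimates within real arithmetic.\<close>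

definition semivar_le ::
  "'z measure \<Rightarrow> ('z set \<Rightarrow> ('a::real_normed_vector \<Rightarrow>\<^sub>L 'b::real_normed_vector)) \<Rightarrow> 'z set \<Rightarrow> real \<Rightarrow> bool"
  where "semivar_le M \<mu> A c \<longleftrightarrow>
    (\<forall>N B x. (\<forall>n<N::nat. B n \<in> sets M \<and> B n \<subseteq> A \<and> norm (x n) \<le> 1) \<and> disjoint_family_on B {..<N} \<longrightarrow>
       norm (\<Sum>n<N. blinfun_apply (\<mu> (B n)) (x n)) \<le> c)"

lemma semivar_leD:
  assumes "semivar_le M \<mu> A c" "finite I" "disjoint_family_on B I"
    "\<And>i. i \<in> I \<Longrightarrow> B i \<in> sets M" "\<And>i. i \<in> I \<Longrightarrow> B i \<subseteq> A" "\<And>i. i \<in> I \<Longrightarrow> norm (x i) \<le> 1"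
  shows "norm (\<Sum>i\<in>I. blinfun_apply (\<mu> (B i)) (x i)) \<le> c"
proof -
  obtain h where h: "bij_betw h {..<card I} I"
    using ex_bij_betw_nat_finite[OF assms(2)] by (auto simp: atLeast0LessThan)
  have "disjoint_family_on (B \<circ> h) {..<card I}"
    unfolding disjoint_family_on_def
  proof (intro ballI impI)
    fix m n assume "m \<in> {..<card I}" "n \<in> {..<card I}" "m \<noteq> n"
    then have "h m \<noteq> h n" "h m \<in> I" "h n \<in> I"
      using h by (auto simp: bij_betw_def dest: inj_onD)
    then show "(B \<circ> h) m \<inter> (B \<circ> h) n = {}"
      using assms(3) by (simp add: disjoint_family_on_def)
  qed
  moreover have "h n \<in> I" if "n < card I" for n
    using h that by (auto simp: bij_betw_def)
  ultimately have "norm (\<Sum>n<card I. blinfun_apply (\<mu> ((B \<circ> h) n)) ((x \<circ> h) n)) \<le> c"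
    using assms(1)[unfolded semivar_le_def, rule_format, of "card I" "B \<circ> h" "x \<circ> h"] assms(4-6)
    by simp
  then show ?thesis
    using sum.reindex_bij_betw[OF h, of "\<lambda>i. blinfun_apply (\<mu> (B i)) (x i)"] by simp
qed

lemma semivar_leD_scaled:
  assumes "semivar_le M \<mu> A c" "finite I" "disjoint_family_on B I"
    "\<And>i. i \<in> I \<Longrightarrow> B i \<in> sets M" "\<And>i. i \<in> I \<Longrightarrow> B i \<subseteq> A" "\<And>i. i \<in> I \<Longrightarrow> norm (x i) \<le> a" "0 \<le> a"
  shows "norm (\<Sum>i\<in>I. blinfun_apply (\<mu> (B i)) (x i)) \<le> a * c"
proof (cases "a = 0")
  case True
  then show ?thesis using assms(6) by (simp add: blinfun.zero_right)
next
  case False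
  then have "a > 0" using \<open>0 \<le> a\<close> by simp
  have "norm (\<Sum>i\<in>I. blinfun_apply (\<mu> (B i)) (x i /\<^sub>R a)) \<le> c"
    using assms(6) \<open>a > 0\<close> by (intro semivar_leD[OF assms(1-5)]) (auto simp: field_simps)
  then have "norm ((\<Sum>i\<in>I. blinfun_apply (\<mu> (B i)) (x i)) /\<^sub>R a) \<le> c"
    by (simp add: blinfun.scaleR_right scaleR_sum_right)
  then show ?thesis
    using \<open>a > 0\<close> by (simp add: field_simps)
qed

lemma semivar_le_nonneg: "semivar_le M \<mu> A c \<Longrightarrow> 0 \<le> c"
  using semivar_leD[of M \<mu> A c "{}" "\<lambda>_. {}" "\<lambda>_. 0"] by (simp add: disjoint_family_on_def)

lemma semivar_le_mono: "semivar_le M \<mu> A c \<Longrightarrow> B \<subseteq> A \<Longrightarrow> c \<le> d \<Longrightarrow> semivar_le M \<mu> B d"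
  unfolding semivar_le_def by (meson order_trans)

lemma ex_if_not_semivar_le:
  assumes "\<not> semivar_le M \<mu> A c"
  shows "\<exists>(N::nat) B x. (\<forall>n<N. B n \<in> sets M \<and> B n \<subseteq> A \<and> norm (x n) \<le> 1) \<and> disjoint_family_on B {..<N} \<and>
    norm (\<Sum>n<N. blinfun_apply (\<mu> (B n)) (x n)) > c"
  using assms unfolding semivar_le_def by (simp add: not_le)

lemma total_semivariation_le_iff:
  assumes "0 \<le> c"
  shows "total_semivariation M \<mu> \<le> ennreal c \<longleftrightarrow> semivar_le M \<mu> (space M) c"
proof -
  have "total_semivariation M \<mu> \<le> ennreal c \<longleftrightarrow>
    (\<forall>(N::nat) B x. (\<forall>n<N. B n \<in> sets M \<and> norm (x n) \<le> 1) \<and> disjoint_family_on B {..<N} \<longrightarrow>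
       norm (\<Sum>n<N. blinfun_apply (\<mu> (B n)) (x n)) \<le> c)"
    using assms unfolding total_semivariation_def SUP_le_iff by (simp add: split_paired_all)
  also have "\<dots> \<longleftrightarrow> semivar_le M \<mu> (space M) c"
    unfolding semivar_le_def using sets.sets_into_space by meson
  finally show ?thesis .
qed

text \<open>The part of an i-measure that does not mention the scalar field; semivariation and
  integral depend on nothing else.\<close>

locale vector_measure =
  fixes M :: "'z measure" and \<mu> :: "'z set \<Rightarrow> ('a::banach \<Rightarrow>\<^sub>L 'b::banach)"
  assumes sums_UN: "\<And>A x. range A \<subseteq> sets M \<Longrightarrow> disjoint_family A \<Longrightarrow>
      (\<lambda>n::nat. blinfun_apply (\<mu> (A n)) x) sums blinfun_apply (\<mu> (\<Union>n. A n)) x"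
    and independent: "\<And>A. range A \<subseteq> sets M \<Longrightarrow> disjoint_family A \<Longrightarrow> independently_convergent (\<lambda>n. \<mu> (A n))"
begin

lemma measure_empty [simp]: "blinfun_apply (\<mu> {}) x = 0"
proof -
  have "summable (\<lambda>n::nat. blinfun_apply (\<mu> {}) x)"
    using sums_UN[of "\<lambda>n. {}" x] by (auto simp: disjoint_family_on_def sums_iff)
  then show ?thesis
    by (simp add: summable_const_iff)
qed

lemma measure_Un:
  assumes "A \<in> sets M" "B \<in> sets M" "A \<inter> B = {}"
  shows "blinfun_apply (\<mu> (A \<union> B)) x = blinfun_apply (\<mu> A) x + blinfun_apply (\<mu> B) x"
proof -
  have "disjoint_family (binaryset A B)"
    using assms(3) by (auto simp: disjoint_family_on_def binaryset_def)
  then have "(\<lambda>n. blinfun_apply (\<mu> (binaryset A B n)) x) sums blinfun_apply (\<mu> (A \<union> B)) x"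
    using sums_UN[of "binaryset A B" x] assms by (simp add: UN_binaryset_eq range_binaryset_eq)
  moreover have "(\<lambda>n. blinfun_apply (\<mu> (binaryset A B n)) x) sums (blinfun_apply (\<mu> A) x + blinfun_apply (\<mu> B) x)"
    using sums_finite[of "{0, Suc 0}" "\<lambda>n. blinfun_apply (\<mu> (binaryset A B n)) x"]
    by (simp add: binaryset_def)
  ultimately show ?thesis
    using sums_unique2 by blast
qed

lemma measure_UN:
  assumes "finite I" "disjoint_family_on B I" "\<And>i. i \<in> I \<Longrightarrow> B i \<in> sets M"
  shows "blinfun_apply (\<mu> (\<Union>i\<in>I. B i)) x = (\<Sum>i\<in>I. blinfun_apply (\<mu> (B i)) x)"
  using assms
proof (induction I)
  case (insert i I)
  have "B i \<inter> (\<Union>i\<in>I. B i) = {}"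
    using insert by (auto simp: disjoint_family_on_def)
  then show ?case
    using insert disjoint_family_on_mono[of I "insert i I" B]
    by (simp add: measure_Un[of "B i" "\<Union>i\<in>I. B i"] sets.finite_UN subset_insertI)
qed simp

lemma measure_Diff:
  assumes "A \<in> sets M" "B \<in> sets M" "B \<subseteq> A"
  shows "blinfun_apply (\<mu> (A - B)) x = blinfun_apply (\<mu> A) x - blinfun_apply (\<mu> B) x"
  using measure_Un[of B "A - B" x] assms by (simp add: Un_absorb1 algebra_simps)

lemma measure_tendsto_0:
  assumes "range A \<subseteq> sets M" "decseq A" "(\<Inter>n. A n) = {}"
  shows "(\<lambda>n. blinfun_apply (\<mu> (A n)) x) \<longlonglongrightarrow> 0"
proof -
  define D where "D n = A n - A (Suc n)" for n
  have AD: "A m \<subseteq> A n" if "n \<le> m" for m n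
    using assms(2) that by (simp add: decseq_def)
  have disj: "disjoint_family D"
    unfolding disjoint_family_on_def
  proof safe
    fix m n x assume "m \<noteq> n" "x \<in> D m" "x \<in> D n"
    then show "x \<in> {}"
      using AD[of "Suc m" n] AD[of "Suc n" m] by (cases m n rule: linorder_cases) (auto simp: D_def)
  qed
  have "A 0 \<subseteq> (\<Union>n. D n)"
  proof
    fix y assume "y \<in> A 0"
    obtain n where n: "y \<notin> A n"
      using assms(3) by auto
    define k where "k = (LEAST n. y \<notin> A n)"
    have k: "y \<notin> A k" "\<And>j. j < k \<Longrightarrow> y \<in> A j"
      unfolding k_def by (rule LeastI[of "\<lambda>n. y \<notin> A n", OF n]) (use not_less_Least in blast)
    moreover have "k \<noteq> 0"
      using \<open>y \<in> A 0\<close> k(1) by metis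
    ultimately have "y \<in> D (k - 1)"
      by (simp add: D_def)
    then show "y \<in> (\<Union>n. D n)" by blast
  qed
  then have UD: "(\<Union>n. D n) = A 0"
    using AD[of 0] by (auto simp: D_def)
  have "(\<lambda>n. blinfun_apply (\<mu> (D n)) x) sums blinfun_apply (\<mu> (A 0)) x"
    using sums_UN[of D x] disj UD assms(1) by (force simp: D_def)
  moreover have "(\<Sum>k<n. blinfun_apply (\<mu> (D k)) x) = blinfun_apply (\<mu> (A 0)) x - blinfun_apply (\<mu> (A n)) x" for n
  proof (induction n)
    case (Suc n)
    then show ?case
      using measure_Diff[of "A n" "A (Suc n)" x] AD[of n "Suc n"] assms(1) by (auto simp: D_def)
  qed simp
  ultimately have "(\<lambda>n. blinfun_apply (\<mu> (A 0)) x - blinfun_apply (\<mu> (A n)) x) \<longlonglongrightarrow> blinfun_apply (\<mu> (A 0)) x"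
    by (simp add: sums_def)
  from tendsto_diff[OF tendsto_const[of "blinfun_apply (\<mu> (A 0)) x"] this] show ?thesis
    by simp
qed

lemma semivar_le_Un:
  assumes "semivar_le M \<mu> A c" "semivar_le M \<mu> B d" "A \<in> sets M"
  shows "semivar_le M \<mu> (A \<union> B) (c + d)"
  unfolding semivar_le_def
proof (intro allI impI, elim conjE)
  fix N :: nat and C and x :: "nat \<Rightarrow> 'a"
  assume C: "\<forall>n<N. C n \<in> sets M \<and> C n \<subseteq> A \<union> B \<and> norm (x n) \<le> 1" "disjoint_family_on C {..<N}"
  have "(\<Sum>n<N. blinfun_apply (\<mu> (C n)) (x n)) =
      (\<Sum>n<N. blinfun_apply (\<mu> (C n \<inter> A)) (x n) + blinfun_apply (\<mu> (C n - A)) (x n))"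
  proof (rule sum.cong[OF refl])
    fix n assume "n \<in> {..<N}"
    then show "blinfun_apply (\<mu> (C n)) (x n) = blinfun_apply (\<mu> (C n \<inter> A)) (x n) + blinfun_apply (\<mu> (C n - A)) (x n)"
      using measure_Un[of "C n \<inter> A" "C n - A" "x n"] C(1) assms(3) by (auto simp: Int_Diff_Un)
  qed
  also have "\<dots> = (\<Sum>n<N. blinfun_apply (\<mu> (C n \<inter> A)) (x n)) + (\<Sum>n<N. blinfun_apply (\<mu> (C n - A)) (x n))"
    by (rule sum.distrib)
  also have "norm \<dots> \<le> c + d"
  proof (rule norm_triangle_mono)
    show "norm (\<Sum>n<N. blinfun_apply (\<mu> (C n \<inter> A)) (x n)) \<le> c"
      using C(1) assms(3)
      by (intro semivar_leD[OF assms(1)] disjoint_family_on_bisimulation[OF C(2)]) auto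
    show "norm (\<Sum>n<N. blinfun_apply (\<mu> (C n - A)) (x n)) \<le> d"
      using C(1) assms(3)
      by (intro semivar_leD[OF assms(2)] disjoint_family_on_bisimulation[OF C(2)]) auto
  qed
  finally show "norm (\<Sum>n<N. blinfun_apply (\<mu> (C n)) (x n)) \<le> c + d" .
qed

lemma ex_semivar_le_UN:
  assumes "finite I" "\<And>i. i \<in> I \<Longrightarrow> B i \<in> sets M" "\<And>i. i \<in> I \<Longrightarrow> \<exists>c. semivar_le M \<mu> (B i) c"
  shows "\<exists>c. semivar_le M \<mu> (\<Union>i\<in>I. B i) c"
  using assms
proof (induction I)
  case empty
  have "semivar_le M \<mu> {} 0"
    unfolding semivar_le_def by (auto intro!: sum_norm_le[THEN order_trans])
  then show ?case by auto
next
  case (insert i I)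
  obtain c where "semivar_le M \<mu> (B i) c"
    using insert.prems(2)[of i] by auto
  moreover obtain d where "semivar_le M \<mu> (\<Union>i\<in>I. B i) d"
    using insert by auto
  ultimately show ?case
    using semivar_le_Un[of "B i" c "\<Union>i\<in>I. B i" d] insert.prems by auto
qed

text \<open>Gliding hump: blocks in the sets \<^term>\<open>D k\<close>, concatenated into one sequence, would
  contradict independent convergence.\<close>

lemma ex_semivar_le_disjoint_family:
  assumes "disjoint_family D" "\<delta> > 0"
  shows "\<exists>k::nat. semivar_le M \<mu> (D k) \<delta>"
proof (rule ccontr)
  assume "\<not> ?thesis"
  then have neg: "\<not> semivar_le M \<mu> (D k) \<delta>" for k
    by blast
  \<comment> \<open>A witness for large semivariation, stored as a list of set-vector pairs so that
    blocks of different lengths can be concatenated.\<close>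
  define block where "block k L \<longleftrightarrow> (\<forall>p\<in>set L. fst p \<in> sets M \<and> fst p \<subseteq> D k \<and> norm (snd p) \<le> 1) \<and>
      sorted_wrt (\<lambda>p q. fst p \<inter> fst q = {}) L \<and> norm (\<Sum>p\<leftarrow>L. blinfun_apply (\<mu> (fst p)) (snd p)) > \<delta>" for k L
  have "\<exists>L. block k L" for k
  proof -
    obtain N :: nat and B x where *: "\<forall>n<N. B n \<in> sets M \<and> B n \<subseteq> D k \<and> norm (x n) \<le> 1"
      and "disjoint_family_on B {..<N}" and "norm (\<Sum>n<N. blinfun_apply (\<mu> (B n)) (x n)) > \<delta>"
      using ex_if_not_semivar_le[OF neg[of k]] by blast
    then have B: "\<And>n. n < N \<Longrightarrow> B n \<in> sets M" "\<And>n. n < N \<Longrightarrow> B n \<subseteq> D k"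
      "\<And>n. n < N \<Longrightarrow> norm (x n) \<le> 1" "disjoint_family_on B {..<N}"
      "norm (\<Sum>n<N. blinfun_apply (\<mu> (B n)) (x n)) > \<delta>"
      by auto
    show ?thesis
      unfolding block_def
    proof (rule exI[of _ "map (\<lambda>n. (B n, x n)) [0..<N]"], intro conjI)
      show "sorted_wrt (\<lambda>p q. fst p \<inter> fst q = {}) (map (\<lambda>n. (B n, x n)) [0..<N])"
        using B(4) by (auto simp: sorted_wrt_iff_nth_less disjoint_family_on_def)
      show "norm (\<Sum>p\<leftarrow>map (\<lambda>n. (B n, x n)) [0..<N]. blinfun_apply (\<mu> (fst p)) (snd p)) > \<delta>"
        using B(5) by (simp add: o_def interv_sum_list_conv_sum_set_nat atLeast0LessThan)
    qed (use B in auto)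
  qed
  then obtain L where "\<And>k. block k (L k)"
    by metis
  then have L: "\<And>k p. p \<in> set (L k) \<Longrightarrow> fst p \<in> sets M \<and> fst p \<subseteq> D k \<and> norm (snd p) \<le> 1"
    "\<And>k. sorted_wrt (\<lambda>p q. fst p \<inter> fst q = {}) (L k)"
    "\<And>k. norm (\<Sum>p\<leftarrow>L k. blinfun_apply (\<mu> (fst p)) (snd p)) > \<delta>"
    unfolding block_def by blast+
  have L_ne: "L k \<noteq> []" for k
    using L(3)[of k] \<open>\<delta> > 0\<close> by auto
  define X where "X K = concat (map L [0..<K])" for K
  have X_Suc: "X (Suc K) = X K @ L K" for K
    by (simp add: X_def)
  have len: "length (X K) \<ge> K" for K
  proof (induction K)
    case (Suc K)
    then show ?case using L_ne[of K] by (cases "L K") (auto simp: X_Suc)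
  qed simp
  \<comment> \<open>The infinite concatenation of all blocks. Blocks are nonempty, so
    \<open>X (Suc n)\<close> already has an entry at position \<open>n\<close>, and longer prefixes
    agree with it.\<close>
  define s where "s n = X (Suc n) ! n" for n
  have nth_X: "X (K + j) ! n = X K ! n" if "n < length (X K)" for K j n
  proof (induction j)
    case (Suc j)
    have "length (X K) \<le> length (X (K + j))"
      by (induction j) (auto simp: X_Suc)
    then show ?case using Suc that by (simp add: X_Suc nth_append)
  qed simp
  have nth_s: "X K ! n = s n" if "n < length (X K)" for K n
  proof (cases "K \<le> Suc n")
    case True
    then show ?thesis using nth_X[OF that, of "Suc n - K"] by (simp add: s_def)
  next
    case False
    then show ?thesis
      using nth_X[of n "Suc n" "K - Suc n"] len[of "Suc n"] by (simp add: s_def)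
  qed
  have X_elems: "\<exists>k<K. p \<in> set (L k)" if "p \<in> set (X K)" for p K
    using that by (auto simp: X_def)
  have X_sorted: "sorted_wrt (\<lambda>p q. fst p \<inter> fst q = {}) (X K)" for K
  proof (induction K)
    case (Suc K)
    have "fst p \<inter> fst q = {}" if "p \<in> set (X K)" "q \<in> set (L K)" for p q
    proof -
      obtain k where "k < K" "p \<in> set (L k)"
        using X_elems[OF \<open>p \<in> set (X K)\<close>] by blast
      moreover from this have "D k \<inter> D K = {}"
        using assms(1) by (auto simp: disjoint_family_on_def)
      ultimately show ?thesis
        using L(1)[of p k] L(1)[of q K] that by blast
    qed
    then show ?case
      using Suc L(2) by (auto simp: X_Suc sorted_wrt_append)
  qed (simp add: X_def)
  have s_in: "s n \<in> set (X (Suc n))" for n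
    using len[of "Suc n"] by (auto simp: s_def)
  have s_props: "fst (s n) \<in> sets M" "norm (snd (s n)) \<le> 1" for n
    using X_elems[OF s_in[of n]] L(1) by blast+
  have disj_s: "fst (s m) \<inter> fst (s n) = {}" if "m < n" for m n
  proof -
    have "fst (X (Suc n) ! m) \<inter> fst (X (Suc n) ! n) = {}"
      using X_sorted[of "Suc n"] len[of "Suc n"] that unfolding sorted_wrt_iff_nth_less by simp
    then show ?thesis
      using nth_s[of m "Suc n"] nth_s[of n "Suc n"] len[of "Suc n"] that by simp
  qed
  have "disjoint_family (\<lambda>n. fst (s n))"
    unfolding disjoint_family_on_def by (metis disj_s Int_commute linorder_neq_iff)
  then have "independently_convergent (\<lambda>n. \<mu> (fst (s n)))"
    using s_props by (intro independent) auto
  moreover have "bounded (range (\<lambda>n. snd (s n)))"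
    using s_props(2) by (auto intro: boundedI)
  ultimately have "summable (\<lambda>n. blinfun_apply (\<mu> (fst (s n))) (snd (s n)))"
    unfolding independently_convergent_def using \<open>bounded (range (\<lambda>n. snd (s n)))\<close> by blast
  then obtain N where N: "\<And>m n. m \<ge> N \<Longrightarrow> norm (\<Sum>k=m..<n. blinfun_apply (\<mu> (fst (s k))) (snd (s k))) < \<delta>"
    unfolding summable_Cauchy using \<open>\<delta> > 0\<close> by blast
  define f where "f p = blinfun_apply (\<mu> (fst p)) (snd p)" for p
  have sum_X: "(\<Sum>n<length (X K). f (s n)) = (\<Sum>p\<leftarrow>X K. f p)" for K
    by (simp add: sum_list_sum_nth atLeast0LessThan nth_s)
  \<comment> \<open>The block \<open>N\<close> is a segment of the series beginning at position
    \<open>N\<close> or later, so its large sum violates the Cauchy criterion.\<close>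
  have "(\<Sum>k=length (X N)..<length (X (Suc N)). f (s k)) = (\<Sum>p\<leftarrow>L N. f p)"
    using sum_X[of "Suc N"] sum_X[of N]
      sum.atLeastLessThan_concat[of 0 "length (X N)" "length (X (Suc N))" "\<lambda>n. f (s n)"]
    by (simp add: X_Suc lessThan_atLeast0)
  then show False
    using N[of "length (X N)" "length (X (Suc N))"] L(3)[of N] len[of N] by (simp add: f_def)
qed

text \<open>A set of infinite semivariation contains another one such that the difference still has
  semivariation above 1. Iteration gives disjoint differences, which the gliding hump
  excludes.\<close>

lemma ex_semivar_le_space: "\<exists>c. semivar_le M \<mu> (space M) c"
proof (rule ccontr)
  assume bad_space: "\<nexists>c. semivar_le M \<mu> (space M) c"
  define bad where "bad A \<longleftrightarrow> A \<in> sets M \<and> (\<nexists>c. semivar_le M \<mu> A c)" for A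
  have step: "\<exists>A'. bad A' \<and> A' \<subseteq> A \<and> \<not> semivar_le M \<mu> (A - A') 1" if "bad A" for A
  proof -
    \<comment> \<open>The excess \<open>2 + norm (\<mu> A)\<close> pays for the case below in which
      the bad subset is one of the pieces \<open>B i\<close>: 1 for the other pieces,
      \<open>norm (\<mu> A)\<close> and 1 for \<open>B i\<close> itself.\<close>
    have A: "A \<in> sets M" "\<not> semivar_le M \<mu> A (2 + norm (\<mu> A))"
      using that by (auto simp: bad_def)
    obtain N :: nat and B x where *: "\<forall>n<N. B n \<in> sets M \<and> B n \<subseteq> A \<and> norm (x n) \<le> 1"
      and "disjoint_family_on B {..<N}" and "norm (\<Sum>n<N. blinfun_apply (\<mu> (B n)) (x n)) > 2 + norm (\<mu> A)"
      using ex_if_not_semivar_le[OF A(2)] by blast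
    then have B: "\<And>n. n < N \<Longrightarrow> B n \<in> sets M" "\<And>n. n < N \<Longrightarrow> B n \<subseteq> A"
      "\<And>n. n < N \<Longrightarrow> norm (x n) \<le> 1" "disjoint_family_on B {..<N}"
      "norm (\<Sum>n<N. blinfun_apply (\<mu> (B n)) (x n)) > 2 + norm (\<mu> A)"
      by auto
    define R where "R = A - (\<Union>n<N. B n)"
    have R: "R \<in> sets M" "A = R \<union> (\<Union>n<N. B n)"
      using A(1) B by (auto simp: R_def)
    \<comment> \<open>By finite subadditivity, one cell of the partition of \<open>A\<close> into
      \<open>R\<close> and the \<open>B n\<close> inherits infinite semivariation.\<close>
    have "bad R \<or> (\<exists>i<N. bad (B i))"
    proof (rule ccontr)
      assume "\<not> ?thesis"
      then have "\<exists>c. semivar_le M \<mu> R c" "\<exists>c. semivar_le M \<mu> (\<Union>n\<in>{..<N}. B n) c"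
        using B R by (auto simp: bad_def intro!: ex_semivar_le_UN)
      then show False
        using semivar_le_Un R that unfolding bad_def by metis
    qed
    then show ?thesis
    proof (elim disjE exE conjE)
      assume "bad R"
      have "\<not> semivar_le M \<mu> (A - R) 1"
      proof
        assume *: "semivar_le M \<mu> (A - R) 1"
        have "norm (\<Sum>n<N. blinfun_apply (\<mu> (B n)) (x n)) \<le> 1"
          using B by (intro semivar_leD[OF *]) (auto simp: R_def)
        then show False using B(5) norm_ge_zero[of "\<mu> A"] by linarith
      qed
      then show ?thesis
        using \<open>bad R\<close> by (auto simp: R_def)
    next
      fix i assume i: "i < N" "bad (B i)"
      have "\<not> semivar_le M \<mu> (A - B i) 1"
      proof
        assume *: "semivar_le M \<mu> (A - B i) 1"
        have Bi: "B n \<inter> B i = {}" if "n < N" "n \<noteq> i" for n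
          using B(4) that i(1) by (simp add: disjoint_family_on_def)
        have 1: "norm (\<Sum>n\<in>{..<N} - {i}. blinfun_apply (\<mu> (B n)) (x n)) \<le> 1"
        proof (intro semivar_leD[OF *] disjoint_family_on_mono[OF _ B(4)])
          show "B n \<subseteq> A - B i" if "n \<in> {..<N} - {i}" for n
            using Bi[of n] B(2)[of n] that by blast
        qed (use B in auto)
        have 2: "norm (\<Sum>n\<in>{i}. blinfun_apply (\<mu> (A - B n)) (x n)) \<le> 1"
          using A(1) B i(1) by (intro semivar_leD[OF *]) (auto simp: disjoint_family_on_def)
        have 3: "norm (blinfun_apply (\<mu> A) (x i)) \<le> norm (\<mu> A)"
          using norm_blinfun[of "\<mu> A" "x i"] mult_left_le[OF B(3)[OF i(1)], of "norm (\<mu> A)"] by simp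
        \<comment> \<open>The term of \<open>B i\<close> is rewritten through its complement in
          \<open>A\<close>, so that everything but \<open>\<mu> A\<close> lives on
          \<open>A - B i\<close>.\<close>
        have "(\<Sum>n<N. blinfun_apply (\<mu> (B n)) (x n)) =
            (\<Sum>n\<in>{..<N} - {i}. blinfun_apply (\<mu> (B n)) (x n)) +
            (blinfun_apply (\<mu> A) (x i) - (\<Sum>n\<in>{i}. blinfun_apply (\<mu> (A - B n)) (x n)))"
          using i(1) measure_Diff[of A "B i" "x i"] A(1) B by (simp add: sum.remove[of _ i])
        also have "norm \<dots> \<le> 1 + (norm (\<mu> A) + 1)"
          by (intro norm_triangle_mono norm_triangle_le_diff add_mono 1 2 3)
        finally show False using B(5) by linarith
      qed
      then show ?thesis
        using i B(2) by blast
    qed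
  qed
  have "bad (space M)"
    using bad_space by (simp add: bad_def)
  then obtain A where A: "\<And>n::nat. bad (A n)" "\<And>n. A (Suc n) \<subseteq> A n \<and> \<not> semivar_le M \<mu> (A n - A (Suc n)) 1"
    using dependent_nat_choice[of "\<lambda>_. bad" "\<lambda>_ A A'. A' \<subseteq> A \<and> \<not> semivar_le M \<mu> (A - A') 1"] step by metis
  have "A m \<subseteq> A n" if "n \<le> m" for m n
    using lift_Suc_antimono_le[of A n m] A(2) that by auto
  then have "disjoint_family (\<lambda>n. A n - A (Suc n))"
    unfolding disjoint_family_on_def by (clarsimp simp: set_eq_iff) (meson Suc_leI linorder_neq_iff subsetD)
  then show False
    using ex_semivar_le_disjoint_family[of "\<lambda>n. A n - A (Suc n)" 1] A(2) by auto
qed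

text \<open>Continuity at the empty set. A finite witness on \<open>A n\<close> loses almost nothing
  when restricted to \<open>A n - A m\<close> for large \<open>m\<close>, because
  \<open>measure_tendsto_0\<close> applies to each of its finitely many pieces. A failure would
  therefore produce disjoint rings of semivariation above \<open>\<delta> / 2\<close>.\<close>

lemma ex_semivar_le_decseq_empty:
  assumes "range A \<subseteq> sets M" "decseq A" "(\<Inter>n. A n) = {}" "\<delta> > 0"
  shows "\<exists>n. semivar_le M \<mu> (A n) \<delta>"
proof (rule ccontr)
  assume neg: "\<nexists>n. semivar_le M \<mu> (A n) \<delta>"
  have step: "\<exists>m>n. \<not> semivar_le M \<mu> (A n - A m) (\<delta> / 2)" for n
  proof -
    have neg_n: "\<not> semivar_le M \<mu> (A n) \<delta>" using neg by blast
    obtain N :: nat and B x where *: "\<forall>k<N. B k \<in> sets M \<and> B k \<subseteq> A n \<and> norm (x k) \<le> 1"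
      and "disjoint_family_on B {..<N}" and "norm (\<Sum>k<N. blinfun_apply (\<mu> (B k)) (x k)) > \<delta>"
      using ex_if_not_semivar_le[OF neg_n] by blast
    then have B: "\<And>k. k < N \<Longrightarrow> B k \<in> sets M" "\<And>k. k < N \<Longrightarrow> B k \<subseteq> A n"
      "\<And>k. k < N \<Longrightarrow> norm (x k) \<le> 1" "disjoint_family_on B {..<N}"
      "norm (\<Sum>k<N. blinfun_apply (\<mu> (B k)) (x k)) > \<delta>"
      by auto
    have "(\<lambda>m. \<Sum>k<N. blinfun_apply (\<mu> (B k \<inter> A m)) (x k)) \<longlonglongrightarrow> (\<Sum>k<N. 0)"
    proof (intro tendsto_sum measure_tendsto_0)
      fix k assume "k \<in> {..<N}"
      then show "range (\<lambda>m. B k \<inter> A m) \<subseteq> sets M"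
        using B(1) assms(1) by blast
      show "decseq (\<lambda>m. B k \<inter> A m)" "(\<Inter>m. B k \<inter> A m) = {}"
        using assms(2,3) by (auto simp: decseq_def)
    qed
    then have "(\<lambda>m. norm (\<Sum>k<N. blinfun_apply (\<mu> (B k \<inter> A m)) (x k))) \<longlonglongrightarrow> 0"
      by (simp add: tendsto_norm_zero)
    then have "eventually (\<lambda>m. norm (\<Sum>k<N. blinfun_apply (\<mu> (B k \<inter> A m)) (x k)) < \<delta> / 2) sequentially"
      using \<open>\<delta> > 0\<close> by (intro order_tendstoD(2)) auto
    then obtain m0 where m0: "\<And>m. m \<ge> m0 \<Longrightarrow> norm (\<Sum>k<N. blinfun_apply (\<mu> (B k \<inter> A m)) (x k)) < \<delta> / 2"
      unfolding eventually_sequentially by blast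
    obtain m where m: "m > n" "norm (\<Sum>k<N. blinfun_apply (\<mu> (B k \<inter> A m)) (x k)) < \<delta> / 2"
      using m0[of "max m0 (Suc n)"] by (metis max.cobounded1 max.cobounded2 Suc_le_eq)
    have "\<not> semivar_le M \<mu> (A n - A m) (\<delta> / 2)"
    proof
      assume *: "semivar_le M \<mu> (A n - A m) (\<delta> / 2)"
      have "norm (\<Sum>k<N. blinfun_apply (\<mu> (B k - A m)) (x k)) \<le> \<delta> / 2"
        using B(1-3) assms(1) by (intro semivar_leD[OF *] disjoint_family_on_bisimulation[OF B(4)]) auto
      moreover have eq: "(\<Sum>k<N. blinfun_apply (\<mu> (B k)) (x k)) =
          (\<Sum>k<N. blinfun_apply (\<mu> (B k \<inter> A m)) (x k)) + (\<Sum>k<N. blinfun_apply (\<mu> (B k - A m)) (x k))"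
        unfolding sum.distrib[symmetric]
      proof (rule sum.cong[OF refl])
        fix k assume "k \<in> {..<N}"
        then show "blinfun_apply (\<mu> (B k)) (x k) =
            blinfun_apply (\<mu> (B k \<inter> A m)) (x k) + blinfun_apply (\<mu> (B k - A m)) (x k)"
          using measure_Un[of "B k \<inter> A m" "B k - A m" "x k"] B(1) assms(1) by (auto simp: Int_Diff_Un)
      qed
      ultimately show False
        using B(5)[unfolded eq] m(2) norm_triangle_ineq[of "\<Sum>k<N. blinfun_apply (\<mu> (B k \<inter> A m)) (x k)"
            "\<Sum>k<N. blinfun_apply (\<mu> (B k - A m)) (x k)"] by linarith
    qed
    then show ?thesis using m(1) by blast
  qed
  then obtain r where r: "\<And>n. r n < r (Suc n)" "\<And>n. \<not> semivar_le M \<mu> (A (r n) - A (r (Suc n))) (\<delta> / 2)"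
    using dependent_nat_choice[of "\<lambda>_ _. True" "\<lambda>_ n m. n < m \<and> \<not> semivar_le M \<mu> (A n - A m) (\<delta> / 2)"]
    by metis
  have "A (r m) \<subseteq> A (r n)" if "n \<le> m" for m n
    using assms(2) lift_Suc_mono_le[of r n m] r(1) that by (auto simp: decseq_def less_imp_le)
  then have "disjoint_family (\<lambda>n. A (r n) - A (r (Suc n)))"
    unfolding disjoint_family_on_def by (clarsimp simp: set_eq_iff) (meson Suc_leI linorder_neq_iff subsetD)
  then show False
    using ex_semivar_le_disjoint_family[of "\<lambda>n. A (r n) - A (r (Suc n))" "\<delta> / 2"] r(2) \<open>\<delta> > 0\<close> by auto
qed

lemma ex_semivar_le_decseq:
  assumes "range A \<subseteq> sets M" "decseq A" "semivar_le M \<mu> (\<Inter>n. A n) 0" "\<delta> > 0"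
  shows "\<exists>n. semivar_le M \<mu> (A n) \<delta>"
proof -
  have "\<exists>n. semivar_le M \<mu> (A n - (\<Inter>n. A n)) \<delta>"
    using assms(1,2,4) by (intro ex_semivar_le_decseq_empty) (auto simp: decseq_def)
  then obtain n where "semivar_le M \<mu> (A n - (\<Inter>n. A n)) \<delta>" by blast
  then have "semivar_le M \<mu> ((A n - (\<Inter>n. A n)) \<union> (\<Inter>n. A n)) (\<delta> + 0)"
    using assms(1,3) by (intro semivar_le_Un) auto
  then show ?thesis
    by (metis Diff_partition Un_upper1 add.right_neutral semivar_le_mono Diff_subset Un_Diff_cancel2 order_refl)
qed

lemma ex_semivar_le_nonneg:
  obtains c where "0 \<le> c" "semivar_le M \<mu> (space M) c"
  using ex_semivar_le_space semivar_le_nonneg by blast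

section \<open>Integrals of simple and of countably valued functions\<close>

definition simple_integral :: "('z \<Rightarrow> 'a) \<Rightarrow> 'b"
  where "simple_integral h = (\<Sum>e\<in>h ` space M. blinfun_apply (\<mu> (h -` {e} \<inter> space M)) e)"

lemma simple_integral_partition:
  assumes "finite I" "disjoint_family_on P I" "(\<Union>i\<in>I. P i) = space M" "\<And>i. i \<in> I \<Longrightarrow> P i \<in> sets M"
    and v: "\<And>i x. i \<in> I \<Longrightarrow> x \<in> P i \<Longrightarrow> h x = v i"
  shows "simple_integral h = (\<Sum>i\<in>I. blinfun_apply (\<mu> (P i)) (v i))"
proof -
  \<comment> \<open>On an empty piece the value \<open>v i\<close> is arbitrary and may lie outside
    the range of \<open>h\<close>, so empty pieces are dropped.\<close>
  define I' where "I' = {i\<in>I. P i \<noteq> {}}"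
  have I': "finite I'" "I' \<subseteq> I"
    using assms(1) by (auto simp: I'_def)
  have v_in: "v ` I' = h ` space M"
    using assms(3) v by (auto simp: I'_def image_iff) (metis UN_iff, metis UN_iff empty_iff)
  have "simple_integral h = (\<Sum>e\<in>v ` I'. \<Sum>i\<in>{i\<in>I'. v i = e}. blinfun_apply (\<mu> (P i)) (v i))"
    unfolding simple_integral_def v_in
  proof (rule sum.cong[OF refl])
    fix e
    have "h -` {e} \<inter> space M = (\<Union>i\<in>{i\<in>I'. v i = e}. P i)"
    proof (intro equalityI subsetI)
      fix x assume x: "x \<in> h -` {e} \<inter> space M"
      then obtain i where "i \<in> I" "x \<in> P i"
        using assms(3) by blast
      then show "x \<in> (\<Union>i\<in>{i\<in>I'. v i = e}. P i)"
        using v[of i x] x by (auto simp: I'_def)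
    next
      fix x assume "x \<in> (\<Union>i\<in>{i\<in>I'. v i = e}. P i)"
      then obtain i where "i \<in> I" "v i = e" "x \<in> P i"
        using I'(2) by blast
      then show "x \<in> h -` {e} \<inter> space M"
        using v[of i x] assms(3) by auto
    qed
    then have "blinfun_apply (\<mu> (h -` {e} \<inter> space M)) e = (\<Sum>i\<in>{i\<in>I'. v i = e}. blinfun_apply (\<mu> (P i)) e)"
      using I' assms(4) measure_UN[of "{i\<in>I'. v i = e}" P e, OF _ disjoint_family_on_mono[OF _ assms(2)]]
      by fastforce
    then show "blinfun_apply (\<mu> (h -` {e} \<inter> space M)) e = (\<Sum>i\<in>{i\<in>I'. v i = e}. blinfun_apply (\<mu> (P i)) (v i))"
      by simp
  qed
  also have "\<dots> = (\<Sum>i\<in>I'. blinfun_apply (\<mu> (P i)) (v i))"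
    by (rule sum.image_gen[OF I'(1), symmetric])
  also have "\<dots> = (\<Sum>i\<in>I. blinfun_apply (\<mu> (P i)) (v i))"
    using assms(1) by (intro sum.mono_neutral_left) (auto simp: I'_def)
  finally show ?thesis .
qed

lemma simple_integral_diff:
  assumes "simple_function M g" "simple_function M h"
  shows "simple_integral (\<lambda>x. g x - h x) = simple_integral g - simple_integral h"
proof -
  define I where "I = g ` space M \<times> h ` space M"
  define P where "P = (\<lambda>(e, d). (g -` {e} \<inter> space M) \<inter> (h -` {d} \<inter> space M))"
  have "finite I"
    using assms by (auto simp: I_def simple_function_def)
  moreover have "disjoint_family_on P I"
    by (auto simp: disjoint_family_on_def P_def)
  moreover have "(\<Union>i\<in>I. P i) = space M"
    by (auto simp: P_def I_def)
  moreover have "P i \<in> sets M" if "i \<in> I" for i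
    using assms that unfolding simple_function_def I_def P_def by (auto simp del: vimage_singleton_eq)
  ultimately have part: "simple_integral f = (\<Sum>i\<in>I. blinfun_apply (\<mu> (P i)) (v i))"
    if "\<And>i x. i \<in> I \<Longrightarrow> x \<in> P i \<Longrightarrow> f x = v i" for f v
    using that by (rule simple_integral_partition)
  have "simple_integral (\<lambda>x. g x - h x) = (\<Sum>i\<in>I. blinfun_apply (\<mu> (P i)) (fst i - snd i))"
    by (rule part) (auto simp: P_def)
  also have "\<dots> = (\<Sum>i\<in>I. blinfun_apply (\<mu> (P i)) (fst i)) - (\<Sum>i\<in>I. blinfun_apply (\<mu> (P i)) (snd i))"
    by (simp add: blinfun.diff_right sum_subtractf)
  also have "(\<Sum>i\<in>I. blinfun_apply (\<mu> (P i)) (fst i)) = simple_integral g"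
    by (rule part[symmetric]) (auto simp: P_def)
  also have "(\<Sum>i\<in>I. blinfun_apply (\<mu> (P i)) (snd i)) = simple_integral h"
    by (rule part[symmetric]) (auto simp: P_def)
  finally show ?thesis .
qed

text \<open>Two regimes in one estimate: \<open>h\<close> may be tiny on \<open>G\<close>, where the
  semivariation is large, and merely bounded off \<open>G\<close>, where the semivariation is
  tiny.\<close>

lemma norm_simple_integral_le:
  assumes h: "simple_function M h" and G: "G \<in> sets M"
    and a: "\<And>x. x \<in> G \<Longrightarrow> norm (h x) \<le> a" "0 \<le> a" and b: "\<And>x. x \<in> space M - G \<Longrightarrow> norm (h x) \<le> b" "0 \<le> b"
    and c: "semivar_le M \<mu> G c" and d: "semivar_le M \<mu> (space M - G) d"
  shows "norm (simple_integral h) \<le> a * c + b * d"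
proof -
  define H where "H e = h -` {e} \<inter> space M" for e
  have H: "H e \<in> sets M" if "e \<in> h ` space M" for e
    using h that unfolding simple_function_def H_def by blast
  have part: "norm (\<Sum>e\<in>h ` space M. blinfun_apply (\<mu> (H e \<inter> S)) e) \<le> t * s"
    if S: "S \<in> sets M" "\<And>x. x \<in> S \<Longrightarrow> norm (h x) \<le> t" "0 \<le> t" "semivar_le M \<mu> S s" for S s t
  proof -
    have "(\<Sum>e\<in>h ` space M. blinfun_apply (\<mu> (H e \<inter> S)) e) = (\<Sum>e\<in>h ` S. blinfun_apply (\<mu> (H e \<inter> S)) e)"
    proof (rule sum.mono_neutral_right)
      show "\<forall>e\<in>h ` space M - h ` S. blinfun_apply (\<mu> (H e \<inter> S)) e = 0"
      proof
        fix e assume "e \<in> h ` space M - h ` S"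
        then have "h x \<noteq> e" if "x \<in> S" for x using that by blast
        then have "H e \<inter> S = {}" by (auto simp: H_def)
        then show "blinfun_apply (\<mu> (H e \<inter> S)) e = 0" by simp
      qed
    qed (use h S(1) sets.sets_into_space in \<open>auto simp: simple_function_def\<close>)
    also have "norm \<dots> \<le> t * s"
    proof (rule semivar_leD_scaled[OF S(4)])
      show "finite (h ` S)"
        using h S(1) sets.sets_into_space by (meson finite_subset image_mono simple_function_def)
      show "disjoint_family_on (\<lambda>e. H e \<inter> S) (h ` S)"
        by (auto simp: disjoint_family_on_def H_def)
      show "H e \<inter> S \<in> sets M" if "e \<in> h ` S" for e
        using H[of e] S(1) that sets.sets_into_space[OF S(1)] by blast
    qed (use S in auto)
    finally show ?thesis .
  qed
  have "simple_integral h = (\<Sum>e\<in>h ` space M. blinfun_apply (\<mu> (H e \<inter> G)) e + blinfun_apply (\<mu> (H e \<inter> (space M - G))) e)"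
    unfolding simple_integral_def H_def[symmetric]
  proof (rule sum.cong[OF refl])
    fix e assume "e \<in> h ` space M"
    moreover have "H e = (H e \<inter> G) \<union> (H e \<inter> (space M - G))"
      by (auto simp: H_def)
    ultimately show "blinfun_apply (\<mu> (H e)) e = blinfun_apply (\<mu> (H e \<inter> G)) e + blinfun_apply (\<mu> (H e \<inter> (space M - G))) e"
      using measure_Un[of "H e \<inter> G" "H e \<inter> (space M - G)" e] H[of e] G by auto
  qed
  also have "norm \<dots> \<le> a * c + b * d"
    unfolding sum.distrib using G a b c d by (intro norm_triangle_mono part) auto
  finally show ?thesis .
qed

lemma norm_simple_integral_le_total:
  assumes "simple_function M h" "\<And>x. x \<in> space M \<Longrightarrow> norm (h x) \<le> a" "0 \<le> a" "semivar_le M \<mu> (space M) c"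
  shows "norm (simple_integral h) \<le> a * c"
proof -
  have "semivar_le M \<mu> (space M - space M) c"
    using semivar_le_mono[OF assms(4)] by auto
  then show ?thesis
    using norm_simple_integral_le[OF assms(1) sets.top assms(2,3) _ order_refl assms(4), of c] by simp
qed

text \<open>The sets on which none of the first \<open>n\<close> values is taken decrease to the
  empty set.\<close>

lemma ex_semivar_le_countably_valued:
  assumes g: "g \<in> countably_valued M" and "\<delta> > 0"
  shows "\<exists>S. finite S \<and> semivar_le M \<mu> (space M - g -` S) \<delta>"
proof (cases "space M = {}")
  case True
  then have "semivar_le M \<mu> (space M - g -` {}) \<delta>"
    using \<open>\<delta> > 0\<close> unfolding semivar_le_def by (auto intro!: order_trans[OF sum_norm_le[of _ _ "\<lambda>_. 0"]])
  then show ?thesis by blast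
next
  case False
  define r where "r = from_nat_into (g ` space M)"
  have r: "range r = g ` space M"
    using g False by (auto simp: r_def countably_valued_def range_from_nat_into)
  define A where "A n = space M - g -` (r ` {..<n})" for n :: nat
  have "A n \<in> sets M" for n
  proof -
    have "A n = space M - (\<Union>k<n. g -` {r k} \<inter> space M)"
      by (auto simp: A_def)
    also have "\<dots> \<in> sets M"
      using g by (intro sets.Diff sets.top sets.finite_UN) (auto simp: countably_valued_def simp del: vimage_singleton_eq)
    finally show ?thesis .
  qed
  moreover have "decseq A"
    unfolding decseq_def A_def by (intro allI impI Diff_mono vimage_mono image_mono) auto
  moreover have "(\<Inter>n. A n) = {}"
  proof -
    have "x \<notin> (\<Inter>n. A n)" if "x \<in> space M" for x
    proof -
      have "g x \<in> range r"
        unfolding r using that by (rule imageI)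
      then obtain k where "g x = r k"
        by (rule rangeE)
      then have "x \<notin> A (Suc k)" by (auto simp: A_def)
      then show ?thesis by (rule contrapos_nn) (rule INT_D[OF _ UNIV_I])
    qed
    moreover have "(\<Inter>n. A n) \<subseteq> A 0" by (rule INF_lower) simp
    then have "(\<Inter>n. A n) \<subseteq> space M" by (auto simp: A_def)
    ultimately show ?thesis by (meson equals0I subsetD)
  qed
  ultimately obtain n where "semivar_le M \<mu> (A n) \<delta>"
    using ex_semivar_le_decseq_empty[of A \<delta>] \<open>\<delta> > 0\<close> by blast
  then show ?thesis
    unfolding A_def by (intro exI[of _ "r ` {..<n}"]) auto
qed

text \<open>Outside a finite set \<open>S\<close> of values, every finite partial sum is bounded by
  the sup-norm times a small semivariation; hence the net of finite sums is Cauchy.\<close>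

lemma summable_on_countably_valued:
  assumes g: "g \<in> countably_valued M"
  shows "(\<lambda>e. blinfun_apply (\<mu> (g -` {e} \<inter> space M)) e) summable_on UNIV"
proof -
  define f where "f e = blinfun_apply (\<mu> (g -` {e} \<inter> space M)) e" for e
  obtain b where b: "b > 0" "\<And>x. x \<in> space M \<Longrightarrow> norm (g x) \<le> b"
    using g unfolding countably_valued_def bounded_pos by blast
  have gs: "g -` {e} \<inter> space M \<in> sets M" for e
    using g by (simp add: countably_valued_def del: vimage_singleton_eq)
  have "cauchy_filter (filtermap (sum f) (finite_subsets_at_top UNIV))"
    unfolding cauchy_filter_metric_filtermap
  proof (intro allI impI)
    fix \<epsilon> :: real assume "\<epsilon> > 0"
    obtain S where S: "finite S" "semivar_le M \<mu> (space M - g -` S) (\<epsilon> / (4 * b))"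
      using ex_semivar_le_countably_valued[OF g, of "\<epsilon> / (4 * b)"] \<open>\<epsilon> > 0\<close> \<open>b > 0\<close> by auto
    have tail: "norm (sum f (X - S)) \<le> \<epsilon> / 4" if "finite X" for X
    proof -
      have "sum f (X - S) = sum f ((X - S) \<inter> g ` space M)"
      proof (rule sum.mono_neutral_right)
        show "\<forall>e\<in>(X - S) - (X - S) \<inter> g ` space M. f e = 0"
        proof
          fix e assume "e \<in> (X - S) - (X - S) \<inter> g ` space M"
          then have "g -` {e} \<inter> space M = {}" by auto
          then show "f e = 0" by (simp only: f_def measure_empty)
        qed
      qed (use that in auto)
      also have "norm \<dots> \<le> b * (\<epsilon> / (4 * b))"
        unfolding f_def
      proof (rule semivar_leD_scaled[OF S(2)])
        show "disjoint_family_on (\<lambda>e. g -` {e} \<inter> space M) ((X - S) \<inter> g ` space M)"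
          by (auto simp: disjoint_family_on_def)
      qed (use that b gs in auto)
      finally show ?thesis using \<open>b > 0\<close> by simp
    qed
    have "dist (sum f X) (sum f Y) < \<epsilon>" if "finite X \<and> S \<subseteq> X" "finite Y \<and> S \<subseteq> Y" for X Y
    proof -
      have "sum f X = sum f S + sum f (X - S)" "sum f Y = sum f S + sum f (Y - S)"
        using that S(1) sum.subset_diff[of S X f] sum.subset_diff[of S Y f] by (simp_all add: add.commute)
      then have "dist (sum f X) (sum f Y) = norm (sum f (X - S) - sum f (Y - S))"
        by (simp add: dist_norm)
      also have "\<dots> \<le> \<epsilon> / 4 + \<epsilon> / 4"
        using that by (intro norm_triangle_le_diff add_mono tail) auto
      finally show ?thesis using \<open>\<epsilon> > 0\<close> by simp
    qed
    moreover have "eventually (\<lambda>X. finite X \<and> S \<subseteq> X) (finite_subsets_at_top UNIV)"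
      using S(1) by (auto simp: eventually_finite_subsets_at_top)
    ultimately show "\<exists>P. eventually P (finite_subsets_at_top UNIV) \<and> (\<forall>X Y. P X \<and> P Y \<longrightarrow> dist (sum f X) (sum f Y) < \<epsilon>)"
      by blast
  qed
  moreover have "complete (UNIV :: 'b set)"
    by (meson Cauchy_convergent UNIV_I complete_def convergent_def)
  ultimately obtain L where "(sum f \<longlongrightarrow> L) (finite_subsets_at_top UNIV)"
    using complete_uniform[where S = UNIV] by (force simp add: filterlim_def)
  then show ?thesis
    unfolding f_def summable_on_def has_sum_def by blast
qed

text \<open>The infinite-sum integral and the finite one are compared by cutting \<open>g\<close>
  down to finitely many values. On \<open>G\<close> the cut function is within \<open>a\<close> of
  \<open>h\<close>; off \<open>G\<close> it is zero, the difference is bounded by \<open>b\<close>,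
  and the semivariation there is only \<open>\<epsilon> / (2 * b)\<close>.\<close>

lemma norm_integral_countably_valued_diff_le:
  assumes g: "g \<in> countably_valued M" and h: "simple_function M h"
    and a: "\<And>x. x \<in> space M \<Longrightarrow> norm (g x - h x) \<le> a" "0 \<le> a" and c: "semivar_le M \<mu> (space M) c"
  shows "norm (integral_countably_valued M \<mu> g - simple_integral h) \<le> a * c"
proof (rule field_le_epsilon)
  fix \<epsilon> :: real assume "\<epsilon> > 0"
  define f where "f e = blinfun_apply (\<mu> (g -` {e} \<inter> space M)) e" for e
  have "finite (h ` space M)"
    using h by (simp add: simple_function_def)
  then have "bounded (h ` space M)"
    by (rule finite_imp_bounded)
  then obtain b where b: "b > 0" "\<And>x. x \<in> space M \<Longrightarrow> norm (h x) \<le> b"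
    unfolding bounded_pos by blast
  obtain S0 where S0: "finite S0" "semivar_le M \<mu> (space M - g -` S0) (\<epsilon> / (2 * b))"
    using ex_semivar_le_countably_valued[OF g, of "\<epsilon> / (2 * b)"] \<open>\<epsilon> > 0\<close> \<open>b > 0\<close> by auto
  have "(sum f \<longlongrightarrow> integral_countably_valued M \<mu> g) (finite_subsets_at_top UNIV)"
    using infsum_tendsto[OF summable_on_countably_valued[OF g]]
    by (simp add: integral_countably_valued_def f_def[abs_def])
  then have "eventually (\<lambda>X. dist (sum f X) (integral_countably_valued M \<mu> g) < \<epsilon> / 2) (finite_subsets_at_top UNIV)"
    using \<open>\<epsilon> > 0\<close> by (intro tendstoD) auto
  then obtain S1 where S1: "finite S1"
    "\<And>X. finite X \<Longrightarrow> S1 \<subseteq> X \<Longrightarrow> dist (sum f X) (integral_countably_valued M \<mu> g) < \<epsilon> / 2"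
    by (auto simp: eventually_finite_subsets_at_top)
  define S where "S = S0 \<union> S1"
  have S: "finite S" "semivar_le M \<mu> (space M - g -` S) (\<epsilon> / (2 * b))"
    "dist (sum f S) (integral_countably_valued M \<mu> g) < \<epsilon> / 2"
    using S0 S1 semivar_le_mono[OF S0(2), of "space M - g -` S"] by (auto simp: S_def)
  have gs: "g -` {e} \<inter> space M \<in> sets M" for e
    using g by (simp add: countably_valued_def del: vimage_singleton_eq)
  define G where "G = (\<Union>e\<in>S. g -` {e} \<inter> space M)"
  have G: "G \<in> sets M" "G = g -` S \<inter> space M"
    unfolding G_def by (rule sets.finite_UN[OF S(1) gs]) auto
  define gS where "gS x = (if x \<in> G then g x else 0)" for x
  \<comment> \<open>The cells of the cut function: one for each retained value, and
    \<open>None\<close> for the remainder, which carries the value 0.\<close>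
  define P where "P i = (case i of None \<Rightarrow> space M - G | Some e \<Rightarrow> g -` {e} \<inter> space M)" for i
  have P_sets: "P i \<in> sets M" for i
    using G(1) gs by (auto simp: P_def split: option.splits simp del: vimage_singleton_eq)
  define v where "v i = (case i of None \<Rightarrow> 0 | Some e \<Rightarrow> e)" for i :: "'a option"
  have gS_int: "simple_integral gS = (\<Sum>i\<in>insert None (Some ` S). blinfun_apply (\<mu> (P i)) (v i))"
  proof (rule simple_integral_partition)
    show "disjoint_family_on P (insert None (Some ` S))"
      by (auto simp: disjoint_family_on_def P_def G(2))
    show "(\<Union>i\<in>insert None (Some ` S). P i) = space M"
      by (auto simp: P_def G(2))
    show "gS x = v i" if "i \<in> insert None (Some ` S)" "x \<in> P i" for i x
      using that by (auto simp: P_def v_def gS_def G(2))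
  qed (use S(1) P_sets in auto)
  have gS_sum: "simple_integral gS = sum f S"
    unfolding gS_int by (simp add: S(1) sum.reindex P_def v_def f_def blinfun.zero_right)
  have gS_simple: "simple_function M gS"
    unfolding simple_function_def
  proof (intro conjI ballI)
    have "gS ` space M \<subseteq> insert 0 S"
      by (auto simp: gS_def G(2))
    then show "finite (gS ` space M)"
      using S(1) finite_subset by blast
    fix e
    have "gS -` {e} \<inter> space M = (g -` {e} \<inter> space M) \<inter> G \<union> (if e = 0 then space M - G else {})"
      using G(2) by (auto simp: gS_def split: if_splits)
    also have "\<dots> \<in> sets M"
      using gs[of e] G(1) by (auto simp del: vimage_singleton_eq)
    finally show "gS -` {e} \<inter> space M \<in> sets M" .
  qed
  have rest: "semivar_le M \<mu> (space M - G) (\<epsilon> / (2 * b))"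
    using S(2) by (rule semivar_le_mono) (auto simp: G(2))
  have "norm (simple_integral (\<lambda>x. gS x - h x)) \<le> a * c + b * (\<epsilon> / (2 * b))"
  proof (rule norm_simple_integral_le[OF _ G(1) _ a(2) _ _ _ rest])
    show "simple_function M (\<lambda>x. gS x - h x)"
      using gS_simple h by (rule simple_function_diff)
    show "norm (gS x - h x) \<le> a" if "x \<in> G" for x
      using a(1)[of x] that by (simp add: gS_def G(2))
    show "norm (gS x - h x) \<le> b" if "x \<in> space M - G" for x
      using b(2)[of x] that by (simp add: gS_def)
    show "semivar_le M \<mu> G c"
      using c by (rule semivar_le_mono) (auto simp: G(2))
  qed (use b in auto)
  then have "norm (sum f S - simple_integral h) \<le> a * c + \<epsilon> / 2"
    using \<open>b > 0\<close> by (simp add: simple_integral_diff[OF gS_simple h] gS_sum)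
  moreover have "norm (integral_countably_valued M \<mu> g - simple_integral h)
      \<le> norm (integral_countably_valued M \<mu> g - sum f S) + norm (sum f S - simple_integral h)"
    by norm
  moreover have "norm (integral_countably_valued M \<mu> g - sum f S) < \<epsilon> / 2"
    using S(3) by (simp add: dist_norm norm_minus_commute)
  ultimately show "norm (integral_countably_valued M \<mu> g - simple_integral h) \<le> a * c + \<epsilon>"
    by linarith
qed

lemma simple_function_imp_countably_valued: "simple_function M h \<Longrightarrow> h \<in> countably_valued M"
proof -
  assume h: "simple_function M h"
  have "h -` {e} \<inter> space M \<in> sets M" for e
  proof (cases "e \<in> h ` space M")
    case False
    then have "h -` {e} \<inter> space M = {}" by auto
    then show ?thesis by simp
  next
    case True
    then show ?thesis
      using h unfolding simple_function_def by blast
  qed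
  moreover have "finite (h ` space M)"
    using h by (simp add: simple_function_def)
  ultimately show ?thesis
    unfolding countably_valued_def using finite_imp_bounded countable_finite by blast
qed

text \<open>This justifies the definite description in \<open>i_integral\<close>: integrals along
  any approximating sequence are asymptotic to those along \<open>h\<close>, which are Cauchy, and
  \<open>h\<close> itself is admissible, which forces uniqueness.\<close>

lemma simple_integral_tendsto_i_integral:
  assumes h: "\<And>n. simple_function M (h n)" and lim: "uniform_limit (space M) h f sequentially"
  shows "(\<lambda>n. simple_integral (h n)) \<longlonglongrightarrow> i_integral M \<mu> f"
proof -
  obtain c0 where c0: "0 \<le> c0" "semivar_le M \<mu> (space M) c0"
    by (rule ex_semivar_le_nonneg)
  \<comment> \<open>A strictly positive bound, so that it can be divided by.\<close>
  define c where "c = c0 + 1"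
  have c: "c > 0" "semivar_le M \<mu> (space M) c"
    using c0 semivar_le_mono[OF c0(2) order_refl, of c] by (auto simp: c_def)
  have diff: "(\<lambda>n. integral_countably_valued M \<mu> (g n) - simple_integral (h n)) \<longlonglongrightarrow> 0"
    if g: "\<And>n. g n \<in> countably_valued M" "uniform_limit (space M) g f sequentially" for g
  proof (rule LIMSEQ_I)
    fix \<epsilon> :: real assume "\<epsilon> > 0"
    have "uniform_limit (space M) (\<lambda>n x. g n x - h n x) (\<lambda>x. f x - f x) sequentially"
      using g(2) lim by (rule uniform_limit_minus)
    then have "eventually (\<lambda>n. \<forall>x\<in>space M. dist (g n x - h n x) (f x - f x) < \<epsilon> / (2 * c)) sequentially"
      using \<open>\<epsilon> > 0\<close> \<open>c > 0\<close> by (intro uniform_limitD) auto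
    then obtain N where N: "\<And>n x. n \<ge> N \<Longrightarrow> x \<in> space M \<Longrightarrow> norm (g n x - h n x) < \<epsilon> / (2 * c)"
      by (auto simp: eventually_sequentially)
    have "norm (integral_countably_valued M \<mu> (g n) - simple_integral (h n)) \<le> \<epsilon> / (2 * c) * c" if "n \<ge> N" for n
      using N[OF that] \<open>\<epsilon> > 0\<close> c by (intro norm_integral_countably_valued_diff_le g h) (auto simp: less_imp_le)
    then show "\<exists>N. \<forall>n\<ge>N. norm (integral_countably_valued M \<mu> (g n) - simple_integral (h n) - 0) < \<epsilon>"
      using \<open>\<epsilon> > 0\<close> \<open>c > 0\<close> by (intro exI[of _ N]) force
  qed
  have "Cauchy (\<lambda>n. simple_integral (h n))"
  proof (rule metric_CauchyI)
    fix \<epsilon> :: real assume "\<epsilon> > 0"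
    have "eventually (\<lambda>n. \<forall>x\<in>space M. dist (h n x) (f x) < \<epsilon> / (4 * c)) sequentially"
      using lim \<open>\<epsilon> > 0\<close> \<open>c > 0\<close> by (intro uniform_limitD) auto
    then obtain N where N: "\<And>n x. n \<ge> N \<Longrightarrow> x \<in> space M \<Longrightarrow> dist (h n x) (f x) < \<epsilon> / (4 * c)"
      by (auto simp: eventually_sequentially)
    have "dist (simple_integral (h m)) (simple_integral (h n)) < \<epsilon>" if "m \<ge> N" "n \<ge> N" for m n
    proof -
      have "norm (h m x - h n x) \<le> \<epsilon> / (2 * c)" if "x \<in> space M" for x
        using dist_triangle2[of "h m x" "h n x" "f x"] N[OF \<open>m \<ge> N\<close> that] N[OF \<open>n \<ge> N\<close> that]
        by (simp add: dist_norm)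
      then have "norm (simple_integral (\<lambda>x. h m x - h n x)) \<le> \<epsilon> / (2 * c) * c"
        using h \<open>\<epsilon> > 0\<close> c by (intro norm_simple_integral_le_total simple_function_diff) auto
      then show ?thesis
        using \<open>\<epsilon> > 0\<close> \<open>c > 0\<close> h by (simp add: simple_integral_diff dist_norm)
    qed
    then show "\<exists>N. \<forall>m\<ge>N. \<forall>n\<ge>N. dist (simple_integral (h m)) (simple_integral (h n)) < \<epsilon>"
      by blast
  qed
  then obtain l where l: "(\<lambda>n. simple_integral (h n)) \<longlonglongrightarrow> l"
    using Cauchy_convergent convergent_def by blast
  have conv: "(\<lambda>n. integral_countably_valued M \<mu> (g n)) \<longlonglongrightarrow> l"
    if "\<And>n. g n \<in> countably_valued M" "uniform_limit (space M) g f sequentially" for g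
    using tendsto_add[OF diff[OF that] l] by simp
  have "i_integral M \<mu> f = l"
    unfolding i_integral_def
  proof (rule the_equality)
    show "\<forall>g. (\<forall>n. g n \<in> countably_valued M) \<and> uniform_limit (space M) g f sequentially \<longrightarrow>
       (\<lambda>n. integral_countably_valued M \<mu> (g n)) \<longlonglongrightarrow> l"
      using conv by blast
    fix v assume "\<forall>g. (\<forall>n. g n \<in> countably_valued M) \<and> uniform_limit (space M) g f sequentially \<longrightarrow>
       (\<lambda>n. integral_countably_valued M \<mu> (g n)) \<longlonglongrightarrow> v"
    then have "(\<lambda>n. integral_countably_valued M \<mu> (h n)) \<longlonglongrightarrow> v"
      using simple_function_imp_countably_valued[OF h] lim by blast
    then show "v = l"
      using LIMSEQ_unique conv[OF simple_function_imp_countably_valued[OF h] lim] by blast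
  qed
  then show ?thesis using l by simp
qed

end

section \<open>Operators on continuous functions vanishing at infinity\<close>

lemma le_if_le_add_small:
  fixes x a D :: real
  assumes "\<And>\<delta>. \<delta> > 0 \<Longrightarrow> x \<le> a + \<delta> * D"
  shows "x \<le> a"
proof (rule field_le_epsilon)
  fix e :: real assume "e > 0"
  have "x \<le> a + e / (\<bar>D\<bar> + 1) * D"
    using \<open>e > 0\<close> by (intro assms) simp
  moreover have "e / (\<bar>D\<bar> + 1) * D \<le> e / (\<bar>D\<bar> + 1) * (\<bar>D\<bar> + 1)"
    using \<open>e > 0\<close> by (intro mult_left_mono) auto
  ultimately show "x \<le> a + e" by simp
qed

text \<open>Plain functions instead of \<open>bcontfun\<close>, because cut-offs and sums are
  written as lambda terms; boundedness is automatic by \<open>c0_bounded\<close>.\<close>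

definition c0_functions :: "('w::topological_space \<Rightarrow> 'a::real_normed_vector) set"
  where "c0_functions = {f. continuous_on UNIV f \<and> (\<forall>e>0. \<exists>K. compact K \<and> (\<forall>x. x \<notin> K \<longrightarrow> norm (f x) < e))}"

lemma c0_continuous: "f \<in> c0_functions \<Longrightarrow> continuous_on UNIV f"
  by (simp add: c0_functions_def)

lemma c0_if_dominated:
  assumes "f \<in> c0_functions" "continuous_on UNIV g" "\<And>x. norm (g x) \<le> c * norm (f x)"
  shows "g \<in> c0_functions"
  unfolding c0_functions_def
proof (intro CollectI conjI allI impI)
  fix e :: real assume "e > 0"
  then have "e / (\<bar>c\<bar> + 1) > 0" by simp
  then obtain K where K: "compact K" "\<And>x. x \<notin> K \<Longrightarrow> norm (f x) < e / (\<bar>c\<bar> + 1)"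
    using assms(1) unfolding c0_functions_def by blast
  have "norm (g x) < e" if "x \<notin> K" for x
  proof -
    have "norm (g x) \<le> (\<bar>c\<bar> + 1) * norm (f x)"
      by (rule order_trans[OF assms(3) mult_right_mono]) auto
    also have "\<dots> < e"
      using K(2)[OF that] by (simp add: field_simps)
    finally show ?thesis .
  qed
  then show "\<exists>K. compact K \<and> (\<forall>x. x \<notin> K \<longrightarrow> norm (g x) < e)"
    using K(1) by blast
qed (fact assms(2))

lemma c0_scaleR_fun:
  assumes "f \<in> c0_functions" "continuous_on UNIV \<phi>" "\<And>x. \<bar>\<phi> x\<bar> \<le> c"
  shows "(\<lambda>x. \<phi> x *\<^sub>R f x) \<in> c0_functions"
proof (rule c0_if_dominated[OF assms(1)])
  show "continuous_on UNIV (\<lambda>x. \<phi> x *\<^sub>R f x)"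
    by (rule continuous_on_scaleR[OF assms(2) c0_continuous[OF assms(1)]])
  show "norm (\<phi> x *\<^sub>R f x) \<le> c * norm (f x)" for x
    using mult_right_mono[OF assms(3) norm_ge_zero] by simp
qed

lemma c0_add:
  assumes "f \<in> c0_functions" "g \<in> c0_functions"
  shows "(\<lambda>x. f x + g x) \<in> c0_functions"
  unfolding c0_functions_def
proof (intro CollectI conjI allI impI)
  show "continuous_on UNIV (\<lambda>x. f x + g x)"
    by (rule continuous_on_add[OF c0_continuous[OF assms(1)] c0_continuous[OF assms(2)]])
  fix e :: real assume "e > 0"
  then have "e / 2 > 0" by simp
  obtain K where K: "compact K" "\<And>x. x \<notin> K \<Longrightarrow> norm (f x) < e / 2"
    using assms(1) \<open>e / 2 > 0\<close> unfolding c0_functions_def by blast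
  obtain L where L: "compact L" "\<And>x. x \<notin> L \<Longrightarrow> norm (g x) < e / 2"
    using assms(2) \<open>e / 2 > 0\<close> unfolding c0_functions_def by blast
  have "norm (f x + g x) < e" if "x \<notin> K \<union> L" for x
    using K(2)[of x] L(2)[of x] that norm_triangle_ineq[of "f x" "g x"] by simp
  then show "\<exists>K. compact K \<and> (\<forall>x. x \<notin> K \<longrightarrow> norm (f x + g x) < e)"
    using compact_Un[OF K(1) L(1)] by blast
qed

lemma c0_if_compact_support:
  assumes "continuous_on UNIV f" "compact K" "\<And>x. x \<notin> K \<Longrightarrow> f x = 0"
  shows "f \<in> c0_functions"
  unfolding c0_functions_def using assms by (intro CollectI conjI allI impI exI[of _ K]) auto

lemma c0_zero: "(\<lambda>x. 0) \<in> c0_functions"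
  by (rule c0_if_compact_support[of _ "{}"]) auto

lemma c0_uminus: "f \<in> c0_functions \<Longrightarrow> (\<lambda>x. - f x) \<in> c0_functions"
  by (rule c0_if_dominated[of f "\<lambda>x. - f x" 1]) (simp_all add: continuous_on_minus c0_continuous)

lemma c0_diff: "f \<in> c0_functions \<Longrightarrow> g \<in> c0_functions \<Longrightarrow> (\<lambda>x. f x - g x) \<in> c0_functions"
  using c0_add[OF _ c0_uminus, of f g] by simp

lemma c0_sum:
  assumes "\<And>i. i \<in> I \<Longrightarrow> f i \<in> c0_functions"
  shows "(\<lambda>x. \<Sum>i\<in>I. f i x) \<in> c0_functions"
proof (cases "finite I")
  case True
  then show ?thesis using assms by (induction I) (auto simp: c0_zero intro: c0_add)
qed (simp add: c0_zero)

lemma compact_c0_superlevel: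
  assumes "f \<in> c0_functions" "e > 0"
  shows "compact {x. e \<le> norm (f x)}"
proof -
  obtain K where K: "compact K" "\<And>x. x \<notin> K \<Longrightarrow> norm (f x) < e"
    using assms unfolding c0_functions_def by blast
  have "closed {x. e \<le> norm (f x)}"
    using c0_continuous[OF assms(1)] by (intro closed_Collect_le continuous_intros)
  then have "compact (K \<inter> {x. e \<le> norm (f x)})"
    using K(1) by (simp add: compact_Int_closed)
  moreover have "K \<inter> {x. e \<le> norm (f x)} = {x. e \<le> norm (f x)}"
    using K(2) by force
  ultimately show ?thesis by simp
qed

lemma c0_bounded:
  assumes "f \<in> c0_functions"
  obtains C where "C > 0" "\<And>x. norm (f x) \<le> C"
proof -
  have "compact (f ` {x. 1 \<le> norm (f x)})"
    using c0_continuous[OF assms] compact_c0_superlevel[OF assms, of 1]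
    by (intro compact_continuous_image) (auto intro: continuous_on_subset)
  then have "bounded (f ` {x. 1 \<le> norm (f x)})"
    by (rule compact_imp_bounded)
  then obtain b where b: "b > 0" "\<forall>y\<in>f ` {x. 1 \<le> norm (f x)}. norm y \<le> b"
    unfolding bounded_pos by blast
  have "norm (f x) \<le> max 1 b" for x
    using b(2) by (cases "1 \<le> norm (f x)") auto
  then show thesis
    by (intro that[of "max 1 b"]) auto
qed

text \<open>The values of norm at least \<open>\<epsilon>\<close> form a compact set, covered by
  finitely many balls; the centre 0 serves all remaining points. Finitely many values thus
  suffice.\<close>

lemma c0_simple_approx:
  assumes f: "f \<in> c0_functions" and "\<epsilon> > 0"
  shows "\<exists>h. simple_function borel h \<and> (\<forall>x. norm (f x - h x) \<le> \<epsilon>)"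
proof -
  have meas: "f \<in> borel_measurable borel"
    using c0_continuous[OF f] by (rule borel_measurable_continuous_onI)
  have "\<exists>h. simple_function borel h \<and> (\<forall>x. f x \<in> (\<Union>c\<in>Y. ball c \<epsilon>) \<longrightarrow> norm (f x - h x) \<le> \<epsilon>)"
    if "finite Y" for Y
    using that
  proof (induction Y)
    case (insert c Y)
    then obtain h where h: "simple_function borel h"
      "\<And>x. f x \<in> (\<Union>c\<in>Y. ball c \<epsilon>) \<Longrightarrow> norm (f x - h x) \<le> \<epsilon>"
      by blast
    have "{x \<in> space borel. f x \<in> ball c \<epsilon>} \<in> sets borel"
      using measurable_sets[OF meas, of "ball c \<epsilon>"] by (simp add: vimage_def Collect_conj_eq Int_commute)
    then have "simple_function borel (\<lambda>x. if f x \<in> ball c \<epsilon> then c else h x)"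
      using h(1) by (intro simple_function_If simple_function_const) auto
    then show ?case
      using h(2) by (intro exI[of _ "\<lambda>x. if f x \<in> ball c \<epsilon> then c else h x"])
        (auto simp: dist_norm norm_minus_commute less_imp_le)
  qed (auto intro!: exI[of _ "\<lambda>x. 0"] simple_function_const)
  note approx = this
  have "compact (f ` {x. \<epsilon> \<le> norm (f x)})"
    using c0_continuous[OF f] compact_c0_superlevel[OF f \<open>\<epsilon> > 0\<close>]
    by (intro compact_continuous_image) (auto intro: continuous_on_subset)
  then obtain Y where Y: "finite Y" "f ` {x. \<epsilon> \<le> norm (f x)} \<subseteq> (\<Union>c\<in>Y. ball c \<epsilon>)"
    using \<open>\<epsilon> > 0\<close> unfolding compact_eq_totally_bounded by blast
  obtain h where h: "simple_function borel h"
    "\<And>x. f x \<in> (\<Union>c\<in>insert 0 Y. ball c \<epsilon>) \<Longrightarrow> norm (f x - h x) \<le> \<epsilon>"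
    using approx[of "insert 0 Y"] Y(1) by blast
  have "f x \<in> (\<Union>c\<in>insert 0 Y. ball c \<epsilon>)" for x
  proof (cases "\<epsilon> \<le> norm (f x)")
    case True
    then show ?thesis using Y(2) by blast
  qed (simp add: dist_norm)
  then show ?thesis
    using h by blast
qed

section \<open>Urysohn functions and the abstract operator\<close>

definition bump :: "'w::topological_space set \<Rightarrow> 'w set \<Rightarrow> ('w \<Rightarrow> real) \<Rightarrow> bool"
  where "bump K U \<phi> \<longleftrightarrow> continuous_on UNIV \<phi> \<and> (\<forall>x. 0 \<le> \<phi> x \<and> \<phi> x \<le> 1) \<and> (\<forall>x\<in>K. \<phi> x = 1) \<and>
    (\<forall>x. x \<notin> U \<longrightarrow> \<phi> x = 0) \<and> (\<exists>C. compact C \<and> (\<forall>x. x \<notin> C \<longrightarrow> \<phi> x = 0))"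

lemma bumpD:
  assumes "bump K U \<phi>"
  shows "continuous_on UNIV \<phi>" "0 \<le> \<phi> x" "\<phi> x \<le> 1" "x \<in> K \<Longrightarrow> \<phi> x = 1" "x \<notin> U \<Longrightarrow> \<phi> x = 0"
  using assms unfolding bump_def by blast+

lemma bump_c0: "bump K U \<phi> \<Longrightarrow> (\<lambda>x. \<phi> x *\<^sub>R e) \<in> c0_functions"
  unfolding bump_def by (auto intro!: continuous_intros c0_if_compact_support)

text \<open>\<open>U\<close> need not be relatively compact, so Urysohn's lemma is applied to
  \<open>U \<inter> V\<close> with \<open>V\<close> a neighbourhood of \<open>K\<close> inside a
  compact set \<open>C\<close>; this yields the compact support demanded by
  \<open>bump\<close>.\<close>

lemma ex_bump:
  fixes K U :: "'w::t2_space set"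
  assumes lc: "locally_compact_space (euclidean :: 'w topology)" and "compact K" "open U" "K \<subseteq> U"
  shows "\<exists>\<phi>. bump K U \<phi>"
proof -
  have H: "Hausdorff_space (euclidean :: 'w topology)"
    unfolding Hausdorff_space_def using separation_t2 by (auto simp: disjnt_def)
  obtain V C where V: "open V" "compact C" "K \<subseteq> V" "V \<subseteq> C"
    using lc locally_compact_space_compact_closed_compact[of "euclidean :: 'w topology"] H \<open>compact K\<close>
    by (auto simp: compactin_euclidean_iff)
  have "completely_regular_space (euclidean :: 'w topology)"
    using lc H by (intro locally_compact_regular_imp_completely_regular_space) auto
  moreover have "compactin euclidean K" "closedin euclidean (- (U \<inter> V))" "disjnt K (- (U \<inter> V))"
    using assms V by (auto simp: compactin_euclidean_iff disjnt_def)
  ultimately obtain \<phi> where \<phi>: "continuous_map euclidean (top_of_set {0..1::real}) \<phi>"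
      "\<phi> ` (- (U \<inter> V)) \<subseteq> {0}" "\<phi> ` K \<subseteq> {1}"
    using Urysohn_completely_regular_compact_closed[of 0 1 "euclidean :: 'w topology" K "- (U \<inter> V)"]
    by (metis zero_le_one)
  have "continuous_on UNIV \<phi>" "\<And>x. \<phi> x \<in> {0..1}"
    using \<phi>(1) by (auto simp: continuous_map_in_subtopology)
  moreover have "\<phi> x = 0" if "x \<notin> U \<or> x \<notin> C" for x
    using \<phi>(2) V(4) that by auto
  moreover have "\<phi> x = 1" if "x \<in> K" for x
    using \<phi>(3) that by auto
  ultimately show ?thesis
    using V(2) unfolding bump_def by (intro exI[of _ \<phi>] conjI allI impI ballI exI[of _ C]) auto
qed

text \<open>\<open>exhaustive\<close> is all that is retained of variational completeness and of the
  absence of bounded sequences. \<open>B\<close> is any bound of the operator, not necessarily its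
  norm.\<close>

locale exhaustive_C0_operator = E: banach_over sE + F: banach_over sF
  for sE :: "'k::real_or_complex \<Rightarrow> 'a::banach \<Rightarrow> 'a" and sF :: "'k \<Rightarrow> 'b::banach \<Rightarrow> 'b" +
  fixes T :: "('w::t2_space \<Rightarrow> 'a) \<Rightarrow> 'b" and B :: real
  assumes lc: "locally_compact_space (euclidean :: 'w topology)"
    and T_add: "\<And>f g. f \<in> c0_functions \<Longrightarrow> g \<in> c0_functions \<Longrightarrow> T (\<lambda>x. f x + g x) = T f + T g"
    and T_scale: "\<And>c f. f \<in> c0_functions \<Longrightarrow> (\<lambda>x. sE c (f x)) \<in> c0_functions \<Longrightarrow> T (\<lambda>x. sE c (f x)) = sF c (T f)"
    and T_bound: "\<And>f C. f \<in> c0_functions \<Longrightarrow> (\<And>x. norm (f x) \<le> C) \<Longrightarrow> norm (T f) \<le> B * C"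
    and B_nonneg: "0 \<le> B"
    and exhaustive: "\<And>f. (\<And>n::nat. f n \<in> c0_functions) \<Longrightarrow> (\<And>n x. norm (f n x) \<le> 1) \<Longrightarrow>
       (\<And>m n x. m \<noteq> n \<Longrightarrow> f m x = 0 \<or> f n x = 0) \<Longrightarrow> (\<lambda>n. T (f n)) \<longlonglongrightarrow> 0"
begin

lemma T_scaleR: "f \<in> c0_functions \<Longrightarrow> T (\<lambda>x. r *\<^sub>R f x) = r *\<^sub>R T f"
  using T_scale[of f "of_real r"] c0_scaleR_fun[of f "\<lambda>_. r" "\<bar>r\<bar>"]
  by (simp add: E.scale_of_real F.scale_of_real)

lemma T_diff: "f \<in> c0_functions \<Longrightarrow> g \<in> c0_functions \<Longrightarrow> T (\<lambda>x. f x - g x) = T f - T g"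
  using T_add[of f "\<lambda>x. - g x"] T_scaleR[of g "- 1"] c0_uminus[of g] by simp

lemma T_zero: "T (\<lambda>x. 0) = 0"
  using T_diff[OF c0_zero c0_zero] by simp

lemma T_sum:
  assumes "finite I" "\<And>i. i \<in> I \<Longrightarrow> f i \<in> c0_functions"
  shows "T (\<lambda>x. \<Sum>i\<in>I. f i x) = (\<Sum>i\<in>I. T (f i))"
  using assms by (induction I) (auto simp: T_zero T_add c0_sum)

section \<open>The submeasure of an operator and its inner regularity\<close>

text \<open>An upper bound \<open>c\<close> for the submeasure of \<open>V\<close>, again avoiding
  the supremum. Functions need only vanish off \<open>V\<close>; their closed supports may leave
  it.\<close>

definition small :: "'w set \<Rightarrow> real \<Rightarrow> bool"
  where "small V c \<longleftrightarrow> (\<forall>f\<in>c0_functions. (\<forall>x. norm (f x) \<le> 1) \<longrightarrow> (\<forall>x. x \<notin> V \<longrightarrow> f x = 0) \<longrightarrow> norm (T f) \<le> c)"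

lemma small_mono: "small V c \<Longrightarrow> U \<subseteq> V \<Longrightarrow> c \<le> d \<Longrightarrow> small U d"
  unfolding small_def by (meson order_trans subsetD)

lemma small_empty: "small {} 0"
proof -
  have "T f = 0" if "\<And>x. f x = 0" for f
  proof -
    have "f = (\<lambda>x. 0)"
      using that by (rule ext)
    then show ?thesis
      using T_zero by simp
  qed
  then show ?thesis by (simp add: small_def)
qed

lemma small_scaled:
  assumes "small V c" "f \<in> c0_functions" "\<And>x. norm (f x) \<le> C" "\<And>x. x \<notin> V \<Longrightarrow> f x = 0" "0 \<le> C"
  shows "norm (T f) \<le> C * c"
proof (cases "C = 0")
  case True
  then show ?thesis using T_bound[OF assms(2,3)] by simp
next
  case False
  then have "C > 0" using assms(5) by simp
  have "norm (T (\<lambda>x. inverse C *\<^sub>R f x)) \<le> c"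
    using assms \<open>C > 0\<close> c0_scaleR_fun[OF assms(2), of "\<lambda>_. inverse C" "inverse C"]
    unfolding small_def by (simp add: field_simps)
  then show ?thesis
    using \<open>C > 0\<close> by (simp add: T_scaleR assms(2) field_simps)
qed

text \<open>Soft thresholding removes the part of \<^term>\<open>f\<close> below the level \<^term>\<open>\<epsilon>\<close> continuously.\<close>

lemma ex_threshold:
  assumes "f \<in> c0_functions" "\<epsilon> > 0"
  shows "\<exists>g\<in>c0_functions. \<forall>x. norm (g x) \<le> norm (f x) \<and> (norm (f x) \<le> \<epsilon> \<longrightarrow> g x = 0) \<and> norm (f x - g x) \<le> \<epsilon>"
proof -
  define r where "r x = \<epsilon> / max \<epsilon> (norm (f x))" for x
  have r: "0 \<le> r x" "r x \<le> 1" "r x * norm (f x) \<le> \<epsilon>" for x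
  proof -
    have m: "max \<epsilon> (norm (f x)) > 0" "\<epsilon> \<le> max \<epsilon> (norm (f x))" "norm (f x) \<le> max \<epsilon> (norm (f x))"
      using \<open>\<epsilon> > 0\<close> by auto
    then show "0 \<le> r x" "r x \<le> 1"
      using \<open>\<epsilon> > 0\<close> by (auto simp: r_def)
    show "r x * norm (f x) \<le> \<epsilon>"
      using m mult_left_mono[OF m(3), of \<epsilon>] \<open>\<epsilon> > 0\<close> by (simp add: r_def pos_divide_le_eq)
  qed
  have "continuous_on UNIV r"
    unfolding r_def using c0_continuous[OF assms(1)] \<open>\<epsilon> > 0\<close> by (intro continuous_intros) auto
  show ?thesis
  proof (intro bexI[of _ "\<lambda>x. (1 - r x) *\<^sub>R f x"] allI conjI impI)
    show "(\<lambda>x. (1 - r x) *\<^sub>R f x) \<in> c0_functions"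
      using r(1,2) \<open>continuous_on UNIV r\<close> by (intro c0_scaleR_fun[where c = 1] assms continuous_intros) auto
    show "norm ((1 - r x) *\<^sub>R f x) \<le> norm (f x)" for x
      using r(1,2)[of x] by (simp add: mult_left_le_one_le)
    show "(1 - r x) *\<^sub>R f x = 0" if "norm (f x) \<le> \<epsilon>" for x
      using that \<open>\<epsilon> > 0\<close> by (simp add: r_def)
    show "norm (f x - (1 - r x) *\<^sub>R f x) \<le> \<epsilon>" for x
      using r(1,3)[of x] by (simp add: algebra_simps)
  qed
qed

text \<open>Only the part of \<open>f\<close> above the level \<open>\<epsilon>\<close> has to live
  in \<open>V\<close>; soft thresholding removes the rest at the cost
  \<open>\<epsilon> * B\<close>.\<close>

lemma small_approx:
  assumes "small V c" "f \<in> c0_functions" "\<And>x. norm (f x) \<le> 1" "\<epsilon> > 0" "\<And>x. \<epsilon> \<le> norm (f x) \<Longrightarrow> x \<in> V"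
  shows "norm (T f) \<le> c + \<epsilon> * B"
proof -
  obtain g where g: "g \<in> c0_functions" "\<And>x. norm (g x) \<le> norm (f x)" "\<And>x. norm (f x) \<le> \<epsilon> \<Longrightarrow> g x = 0"
    "\<And>x. norm (f x - g x) \<le> \<epsilon>"
    using ex_threshold[OF assms(2,4)] by blast
  have "norm (T g) \<le> c"
    using assms(1) g(1) order_trans[OF g(2) assms(3)] g(3) assms(5) unfolding small_def by (meson linear)
  moreover have "norm (T (\<lambda>x. f x - g x)) \<le> B * \<epsilon>"
    using assms(2) g by (intro T_bound c0_diff)
  ultimately show ?thesis
    using norm_triangle_ineq[of "T g" "T f - T g"] assms(2) g(1) by (simp add: T_diff mult.commute)
qed

text \<open>The superlevel set \<open>K\<close> is compact, hence so is \<open>K - V\<close>, and a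
  bump on it inside \<open>U\<close> splits \<open>f\<close>. The first part vanishes off
  \<open>U\<close>; the second need not vanish off \<open>V\<close> but is below
  \<open>\<epsilon>\<close> there, so \<open>small_approx\<close> applies.\<close>

lemma small_Un:
  assumes "open U" "open V" "small U c" "small V d"
  shows "small (U \<union> V) (c + d)"
  unfolding small_def
proof (intro ballI impI)
  fix f :: "'w \<Rightarrow> 'a"
  assume f: "f \<in> c0_functions" "\<forall>x. norm (f x) \<le> 1" "\<forall>x. x \<notin> U \<union> V \<longrightarrow> f x = 0"
  show "norm (T f) \<le> c + d"
  proof (rule le_if_le_add_small)
    fix \<epsilon> :: real assume "\<epsilon> > 0"
    define K where "K = {x. \<epsilon> \<le> norm (f x)}"
    have "compact K" "K \<subseteq> U \<union> V"
      using compact_c0_superlevel[OF f(1) \<open>\<epsilon> > 0\<close>] f(3) \<open>\<epsilon> > 0\<close> by (force simp: K_def)+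
    then have "compact (K - V)" "K - V \<subseteq> U"
      using assms(2) by (auto intro: compact_diff)
    then obtain \<phi> where \<phi>: "bump (K - V) U \<phi>"
      using ex_bump[OF lc] assms(1) by blast
    define g where "g x = \<phi> x *\<^sub>R f x" for x
    define h where "h x = (1 - \<phi> x) *\<^sub>R f x" for x
    have g: "g \<in> c0_functions" "norm (g x) \<le> 1" for x
      using f(1,2) bumpD[OF \<phi>] unfolding g_def
      by (auto intro!: c0_scaleR_fun[where c = 1] mult_le_one)
    have h: "h \<in> c0_functions" "norm (h x) \<le> norm (f x)" for x
      using f(1) bumpD[OF \<phi>] unfolding h_def
      by (auto intro!: c0_scaleR_fun[where c = 1] continuous_intros mult_left_le_one_le)
    have "norm (T g) \<le> c"
      using assms(3) g bumpD(5)[OF \<phi>] unfolding small_def by (simp add: g_def)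
    moreover have "norm (T h) \<le> d + \<epsilon> * B"
    proof (rule small_approx[OF assms(4) h(1) order_trans[OF h(2)] \<open>\<epsilon> > 0\<close>])
      show "norm (f x) \<le> 1" for x using f(2) by blast
      show "x \<in> V" if x: "\<epsilon> \<le> norm (h x)" for x
      proof (rule ccontr)
        assume "x \<notin> V"
        then have "x \<in> K - V"
          using x h(2)[of x] by (simp add: K_def)
        then have "h x = 0"
          using bumpD(4)[OF \<phi>] by (simp add: h_def)
        then show False using x \<open>\<epsilon> > 0\<close> by simp
      qed
    qed
    moreover have "T f = T g + T h"
      using T_add[OF g(1) h(1)] by (simp add: g_def h_def scaleR_left_distrib[symmetric])
    ultimately show "norm (T f) \<le> c + d + \<epsilon> * B"
      using norm_triangle_ineq[of "T g" "T h"] by simp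
  qed
qed

lemma small_UN:
  assumes "finite I" "\<And>i. i \<in> I \<Longrightarrow> open (U i)" "\<And>i. i \<in> I \<Longrightarrow> small (U i) (c i)"
  shows "small (\<Union>i\<in>I. U i) (\<Sum>i\<in>I. c i)"
  using assms by (induction I) (auto simp: small_empty intro!: small_Un open_UN)

text \<open>If no compact set exhausts \<open>U\<close>, then beyond every compact \<open>K\<close>
  there is a function of norm at most 1, supported in a compact subset of \<open>U - K\<close>, on
  which \<open>T\<close> is at least \<open>\<epsilon> / 2\<close>. Adding these supports to
  \<open>K\<close> one after another gives disjointly supported functions that contradict
  \<open>exhaustive\<close>.\<close>

lemma ex_compact_small_diff:
  assumes "open U" "\<epsilon> > 0"
  shows "\<exists>K. compact K \<and> K \<subseteq> U \<and> small (U - K) \<epsilon>"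
proof (rule ccontr)
  assume neg: "\<not> ?thesis"
  have step: "\<exists>f K'. f \<in> c0_functions \<and> (\<forall>x. norm (f x) \<le> 1) \<and> (\<forall>x. x \<notin> K' \<longrightarrow> f x = 0) \<and>
      compact K' \<and> K' \<subseteq> U - K \<and> norm (T f) \<ge> \<epsilon> / 2" if "compact K" "K \<subseteq> U" for K
  proof -
    have "\<not> small (U - K) \<epsilon>"
      using neg that by blast
    then obtain f where f: "f \<in> c0_functions" "\<And>x. norm (f x) \<le> 1" "\<And>x. x \<notin> U - K \<Longrightarrow> f x = 0" "norm (T f) > \<epsilon>"
      unfolding small_def by (auto simp: not_le)
    \<comment> \<open>The threshold that makes the support compact must cost at most
      \<open>\<epsilon> / 2\<close>; the summand 1 guards against \<open>B = 0\<close>.\<close>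
    define \<eta> where "\<eta> = \<epsilon> / (2 * (B + 1))"
    have \<eta>: "\<eta> > 0" "B * \<eta> \<le> \<epsilon> / 2"
      using \<open>\<epsilon> > 0\<close> B_nonneg by (auto simp: \<eta>_def field_simps)
    obtain g where g: "g \<in> c0_functions" "\<And>x. norm (g x) \<le> norm (f x)" "\<And>x. norm (f x) \<le> \<eta> \<Longrightarrow> g x = 0"
      "\<And>x. norm (f x - g x) \<le> \<eta>"
      using ex_threshold[OF f(1) \<eta>(1)] by blast
    define K' where "K' = {x. \<eta> \<le> norm (f x)}"
    have "norm (T (\<lambda>x. f x - g x)) \<le> B * \<eta>"
      using f(1) g by (intro T_bound c0_diff)
    then have "norm (T g) \<ge> \<epsilon> / 2"
      using f(1,4) g(1) \<eta>(2) norm_triangle_ineq[of "T g" "T f - T g"] by (simp add: T_diff)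
    moreover have "compact K'" "K' \<subseteq> U - K"
      using compact_c0_superlevel[OF f(1) \<eta>(1)] f(3) \<eta>(1) by (force simp: K'_def)+
    moreover have "norm (g x) \<le> 1" "x \<notin> K' \<longrightarrow> g x = 0" for x
      using order_trans[OF g(2) f(2)] g(3)[of x] by (auto simp: K'_def)
    ultimately show ?thesis
      using g(1) by blast
  qed
  \<comment> \<open>A state is a function together with a compact set that contains its own support
    and all earlier ones; \<open>Q\<close> makes the next function vanish on that set.\<close>
  define P where "P = (\<lambda>p. fst p \<in> c0_functions \<and> (\<forall>x. norm (fst p x) \<le> 1) \<and>
      norm (T (fst p)) \<ge> \<epsilon> / 2 \<and> (\<forall>x. x \<notin> snd p \<longrightarrow> fst p x = 0) \<and> compact (snd p) \<and> snd p \<subseteq> U)"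
  define Q where "Q = (\<lambda>(p :: ('w \<Rightarrow> 'a) \<times> 'w set) (p' :: ('w \<Rightarrow> 'a) \<times> 'w set). snd p \<subseteq> snd p' \<and> (\<forall>x\<in>snd p. fst p' x = 0))"
  have next_ex: "\<exists>p'. P p' \<and> (\<forall>x\<in>K. fst p' x = 0) \<and> K \<subseteq> snd p'" if K: "compact K" "K \<subseteq> U" for K
  proof -
    obtain f K' where "f \<in> c0_functions" "\<forall>x. norm (f x) \<le> 1" "\<forall>x. x \<notin> K' \<longrightarrow> f x = 0"
      "compact K'" "K' \<subseteq> U - K" "norm (T f) \<ge> \<epsilon> / 2"
      using step[OF K] by blast
    then show ?thesis
      using K unfolding P_def by (intro exI[of _ "(f, K \<union> K')"]) auto
  qed
  have "\<exists>p. P p"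
    using next_ex[of "{}"] by auto
  moreover have "\<exists>p'. P p' \<and> Q p p'" if "P p" for p
    using next_ex[of "snd p"] that unfolding P_def Q_def by blast
  ultimately obtain p where p: "\<And>n::nat. P (p n)" "\<And>n. Q (p n) (p (Suc n))"
    using dependent_nat_choice[of "\<lambda>_. P" "\<lambda>_. Q"] by metis
  define f where "f n = fst (p n)" for n
  have mono: "snd (p m) \<subseteq> snd (p n)" if "m \<le> n" for m n
    using lift_Suc_mono_le[of "\<lambda>n. snd (p n)" m n] p(2) that unfolding Q_def by blast
  have disj: "f m x = 0 \<or> f n x = 0" if mn: "m < n" for m n x
  proof (cases "x \<in> snd (p m)")
    case True
    obtain k where k: "n = Suc k" "m \<le> k"
      using mn by (cases n) auto
    have "x \<in> snd (p k)"
      using mono[OF k(2)] True by blast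
    then show ?thesis
      using p(2)[of k] k(1) unfolding Q_def f_def by blast
  next
    case False
    then show ?thesis using p(1)[of m] unfolding P_def f_def by blast
  qed
  have "(\<lambda>n. T (f n)) \<longlonglongrightarrow> 0"
  proof (rule exhaustive)
    show "f n \<in> c0_functions" "norm (f n x) \<le> 1" for n x
      using p(1)[of n] unfolding P_def f_def by blast+
    show "f m x = 0 \<or> f n x = 0" if "m \<noteq> n" for m n x
      using disj[of m n x] disj[of n m x] that by (cases m n rule: linorder_cases) auto
  qed
  then have "(\<lambda>n. norm (T (f n))) \<longlonglongrightarrow> 0"
    by (rule tendsto_norm_zero)
  then have "\<epsilon> / 2 \<le> 0"
    using p(1) unfolding P_def f_def by (intro LIMSEQ_le_const) auto
  then show False using \<open>\<epsilon> > 0\<close> by simp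
qed

section \<open>Approximation of Borel sets from inside and outside\<close>

definition tight :: "'w set \<Rightarrow> bool"
  where "tight A \<longleftrightarrow> (\<forall>\<epsilon>>0. \<exists>K U. compact K \<and> open U \<and> K \<subseteq> A \<and> A \<subseteq> U \<and> small (U - K) \<epsilon>)"

lemma tight_open: "open U \<Longrightarrow> tight U"
  unfolding tight_def by (metis ex_compact_small_diff order_refl)

text \<open>The complement of an open set need not be compact, so a compact \<open>L\<close> with
  small complement is taken first: \<open>L - U\<close> and \<open>UNIV - K\<close> squeeze the
  complement of \<open>A\<close>.\<close>

lemma tight_Compl:
  assumes "tight A"
  shows "tight (UNIV - A)"
  unfolding tight_def
proof (intro allI impI)
  fix \<epsilon> :: real assume "\<epsilon> > 0"
  obtain K U where KU: "compact K" "open U" "K \<subseteq> A" "A \<subseteq> U" "small (U - K) (\<epsilon> / 2)"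
    using assms[unfolded tight_def, rule_format, of "\<epsilon> / 2"] \<open>\<epsilon> > 0\<close> by auto
  obtain L where L: "compact L" "small (UNIV - L) (\<epsilon> / 2)"
    using ex_compact_small_diff[OF open_UNIV, of "\<epsilon> / 2"] \<open>\<epsilon> > 0\<close> by auto
  have "small ((UNIV - L) \<union> (U - K)) (\<epsilon> / 2 + \<epsilon> / 2)"
    using KU L by (intro small_Un open_Diff compact_imp_closed) auto
  then have "small ((UNIV - K) - (L - U)) \<epsilon>"
    by (rule small_mono) auto
  moreover have "compact (L - U)" "open (UNIV - K)" "L - U \<subseteq> UNIV - A" "UNIV - A \<subseteq> UNIV - K"
    using KU L by (auto intro: compact_diff open_Diff compact_imp_closed)
  ultimately show "\<exists>K U. compact K \<and> open U \<and> K \<subseteq> UNIV - A \<and> UNIV - A \<subseteq> U \<and> small (U - K) \<epsilon>"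
    by blast
qed

text \<open>Countable subadditivity is replaced by compactness: a compact \<open>L\<close> nearly
  exhausts the union \<open>V\<close> of the outer sets and is covered by finitely many of them, so
  finitely many differences \<open>U n - K n\<close> and \<open>V - L\<close> account for
  everything. The inner sets are kept apart, since \<open>ex_small_tail\<close> needs each
  \<open>K n\<close> inside its own \<open>A n\<close>.\<close>

lemma tight_UN_aux:
  fixes A :: "nat \<Rightarrow> 'w set"
  assumes "\<And>n. tight (A n)" "\<epsilon> > 0"
  shows "\<exists>N K U. (\<forall>n<N. K n \<subseteq> A n) \<and> (\<forall>n. compact (K n)) \<and> open U \<and> (\<Union>n. A n) \<subseteq> U \<and> small (U - (\<Union>n<N::nat. K n)) \<epsilon>"
proof -
  \<comment> \<open>Geometric weights of total at most \<open>\<epsilon> / 2\<close>; the other half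
    is spent on \<open>V - L\<close>.\<close>
  have "\<exists>K U. compact K \<and> open U \<and> K \<subseteq> A n \<and> A n \<subseteq> U \<and> small (U - K) (\<epsilon> / 2 * (1 / 2) ^ Suc n)" for n
  proof -
    have "\<epsilon> / 2 * (1 / 2) ^ Suc n > 0" using \<open>\<epsilon> > 0\<close> by simp
    then show ?thesis using assms(1)[of n] unfolding tight_def by blast
  qed
  then obtain K U where KU: "\<And>n. compact (K n)" "\<And>n. open (U n)" "\<And>n. K n \<subseteq> A n" "\<And>n. A n \<subseteq> U n"
    "\<And>n. small (U n - K n) (\<epsilon> / 2 * (1 / 2) ^ Suc n)"
    by metis
  define V where "V = (\<Union>n. U n)"
  have "open V" using KU(2) by (auto simp: V_def)
  then obtain L where L: "compact L" "L \<subseteq> V" "small (V - L) (\<epsilon> / 2)"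
    using ex_compact_small_diff[of V "\<epsilon> / 2"] \<open>\<epsilon> > 0\<close> by auto
  obtain J where J: "finite J" "L \<subseteq> (\<Union>n\<in>J. U n)"
    using compactE_image[of L UNIV U] L(1,2) KU(2) unfolding V_def by metis
  obtain N where N: "J \<subseteq> {..<N}"
    using J(1) finite_nat_iff_bounded by blast
  have "small ((V - L) \<union> (\<Union>n<N. U n - K n)) (\<epsilon> / 2 + (\<Sum>n<N. \<epsilon> / 2 * (1 / 2) ^ Suc n))"
    using KU L(1,3) \<open>open V\<close>
    by (intro small_Un small_UN open_UN open_Diff[OF _ compact_imp_closed] ballI) auto
  moreover have "V - (\<Union>n<N. K n) \<subseteq> (V - L) \<union> (\<Union>n<N. U n - K n)"
    using J(2) N by blast
  moreover have "(\<Sum>n<N. \<epsilon> / 2 * (1 / 2) ^ Suc n) \<le> \<epsilon> / 2"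
  proof -
    have "(\<Sum>n<N. (1 / 2 :: real) ^ Suc n) = 1 - (1 / 2) ^ N"
      by (induction N) (auto simp: field_simps)
    then have "(\<Sum>n<N. \<epsilon> / 2 * (1 / 2) ^ Suc n) = \<epsilon> / 2 * (1 - (1 / 2) ^ N)"
      by (metis sum_distrib_left)
    also have "\<dots> \<le> \<epsilon> / 2"
      using \<open>\<epsilon> > 0\<close> by (intro mult_left_le) auto
    finally show ?thesis .
  qed
  ultimately have "small (V - (\<Union>n<N. K n)) \<epsilon>"
    by (auto elim: small_mono)
  moreover have "(\<Union>n. A n) \<subseteq> V"
    using KU(4) by (auto simp: V_def)
  ultimately show ?thesis
    using KU(1,3) \<open>open V\<close> by (intro exI[of _ N] exI[of _ K] exI[of _ V]) auto
qed

lemma tight_UN: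
  fixes A :: "nat \<Rightarrow> 'w set"
  assumes "\<And>n. tight (A n)"
  shows "tight (\<Union>n. A n)"
  unfolding tight_def
proof (intro allI impI)
  fix \<epsilon> :: real assume "\<epsilon> > 0"
  obtain N K U where KU: "\<forall>n<N. K n \<subseteq> A n" "\<forall>n. compact (K n)" "open U" "(\<Union>n. A n) \<subseteq> U"
    "small (U - (\<Union>n<N::nat. K n)) \<epsilon>"
    using tight_UN_aux[of A, OF assms \<open>\<epsilon> > 0\<close>] by (elim exE conjE) (rule that)
  then have "compact (\<Union>n<N. K n)" "(\<Union>n<N. K n) \<subseteq> (\<Union>n. A n)"
    by (auto intro!: compact_UN)
  then show "\<exists>K U. compact K \<and> open U \<and> K \<subseteq> (\<Union>n. A n) \<and> (\<Union>n. A n) \<subseteq> U \<and> small (U - K) \<epsilon>"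
    using KU(3-5) by blast
qed

lemma tight_borel:
  assumes "A \<in> sets borel"
  shows "tight A"
proof -
  have "A \<in> sigma_sets UNIV {S. open S}"
    using assms by (simp add: borel_def)
  then show ?thesis
  proof (induction rule: sigma_sets.induct)
    case (Basic A)
    then show ?case by (auto intro: tight_open)
  qed (auto intro: tight_open tight_Compl tight_UN)
qed

text \<open>The inner compact sets of the first \<open>N\<close> members are disjoint from all later
  members, so the tail lies in the small open set \<open>U\<close> minus those compact sets.
  Countable additivity and independent convergence both rest on this.\<close>

lemma ex_small_tail:
  fixes A :: "nat \<Rightarrow> 'w set"
  assumes "range A \<subseteq> sets borel" "disjoint_family A" "\<epsilon> > 0"
  shows "\<exists>N W. open W \<and> (\<Union>n\<in>{N..}. A n) \<subseteq> W \<and> small W \<epsilon>"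
proof -
  have tight_A: "tight (A n)" for n
    using assms(1) by (intro tight_borel) auto
  obtain N K U where KU: "\<forall>n<N. K n \<subseteq> A n" "\<forall>n. compact (K n)" "open U" "(\<Union>n. A n) \<subseteq> U"
    "small (U - (\<Union>n<N::nat. K n)) \<epsilon>"
    using tight_UN_aux[of A, OF tight_A \<open>\<epsilon> > 0\<close>] by (elim exE conjE meta_impE) (rule that)
  have "A n \<subseteq> U - (\<Union>n<N. K n)" if "n \<ge> N" for n
  proof -
    have "A n \<inter> K k = {}" if "k < N" for k
    proof -
      have "K k \<subseteq> A k" "A n \<inter> A k = {}"
        using KU(1) disjoint_family_onD[OF assms(2), of n k] \<open>n \<ge> N\<close> that by auto
      then show ?thesis by auto
    qed
    then show ?thesis using KU(4) by blast
  qed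
  moreover have "open (U - (\<Union>n<N. K n))"
    using KU(2,3) by (intro open_Diff compact_imp_closed compact_UN) auto
  ultimately show ?thesis
    using KU(5) by blast
qed

text \<open>Two bumps for the same \<open>A\<close> agree outside
  \<open>(U - K) \<union> (U' - K')\<close>: such a point is either in \<open>A\<close>, hence in
  both compact sets, or outside \<open>A\<close>, hence outside both open sets.\<close>

lemma bump_T_diff:
  assumes "compact K" "open U" "K \<subseteq> A" "A \<subseteq> U" "small (U - K) c" "bump K U \<phi>"
    and "compact K'" "open U'" "K' \<subseteq> A" "A \<subseteq> U'" "small (U' - K') c'" "bump K' U' \<phi>'"
  shows "norm (T (\<lambda>x. \<phi> x *\<^sub>R e) - T (\<lambda>x. \<phi>' x *\<^sub>R e)) \<le> (c + c') * norm e"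
proof -
  have "norm (T (\<lambda>x. \<phi> x *\<^sub>R e - \<phi>' x *\<^sub>R e)) \<le> norm e * (c + c')"
  proof (rule small_scaled)
    show "small ((U - K) \<union> (U' - K')) (c + c')"
      using assms by (intro small_Un open_Diff compact_imp_closed)
    show "norm (\<phi> x *\<^sub>R e - \<phi>' x *\<^sub>R e) \<le> norm e" for x
      using bumpD(2,3)[OF assms(6), of x] bumpD(2,3)[OF assms(12), of x]
      by (auto simp: scaleR_left_diff_distrib[symmetric] abs_le_iff intro!: mult_left_le_one_le)
    show "\<phi> x *\<^sub>R e - \<phi>' x *\<^sub>R e = 0" if x: "x \<notin> (U - K) \<union> (U' - K')" for x
    proof (cases "x \<in> A")
      case True
      then have "x \<in> K" "x \<in> K'" using x assms by blast+
      then show ?thesis using bumpD(4)[OF assms(6)] bumpD(4)[OF assms(12)] by simp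
    next
      case False
      then have "x \<notin> U" "x \<notin> U'" using x assms by blast+
      then show ?thesis using bumpD(5)[OF assms(6)] bumpD(5)[OF assms(12)] by simp
    qed
  qed (use assms in \<open>auto intro: c0_diff bump_c0\<close>)
  then show ?thesis
    using assms by (simp add: T_diff bump_c0 mult.commute)
qed

lemma ex_bump_tight:
  assumes "tight A" "\<epsilon> > 0"
  shows "\<exists>K U \<phi>. compact K \<and> open U \<and> K \<subseteq> A \<and> A \<subseteq> U \<and> small (U - K) \<epsilon> \<and> bump K U \<phi>"
proof -
  obtain K U where KU: "compact K" "open U" "K \<subseteq> A" "A \<subseteq> U" "small (U - K) \<epsilon>"
    using assms(1)[unfolded tight_def, rule_format, OF assms(2)] by (elim exE conjE) (rule that)
  moreover obtain \<phi> where "bump K U \<phi>"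
    using ex_bump[OF lc KU(1,2)] KU(3,4) by blast
  ultimately show ?thesis by blast
qed

text \<open>The limit is formed along one sequence of bumps, but the error estimate holds for every
  admissible choice and every vector at once; later arguments can pick whichever bump suits
  them.\<close>

lemma ex_limit_bump:
  assumes A: "tight A"
  shows "\<exists>v. \<forall>K U c \<phi> e. compact K \<and> open U \<and> K \<subseteq> A \<and> A \<subseteq> U \<and> small (U - K) c \<and> bump K U \<phi> \<longrightarrow>
     norm (v e - T (\<lambda>x. \<phi> x *\<^sub>R e)) \<le> c * norm e"
proof -
  define s where "s n = (1 / 2 :: real) ^ n" for n
  have "\<exists>K U \<phi>. compact K \<and> open U \<and> K \<subseteq> A \<and> A \<subseteq> U \<and> small (U - K) (s n) \<and> bump K U \<phi>" for n
    by (rule ex_bump_tight[OF A]) (simp add: s_def)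
  then obtain K U :: "nat \<Rightarrow> 'w set" and \<phi> where \<phi>: "\<And>n. compact (K n)" "\<And>n. open (U n)" "\<And>n. K n \<subseteq> A" "\<And>n. A \<subseteq> U n"
    "\<And>n. small (U n - K n) (s n)" "\<And>n. bump (K n) (U n) (\<phi> n)"
    by metis
  have s0: "s \<longlonglongrightarrow> 0"
    unfolding s_def by (rule LIMSEQ_power_zero) simp
  have conv: "convergent (\<lambda>n. T (\<lambda>x. \<phi> n x *\<^sub>R e))" for e
  proof (rule Cauchy_convergent, rule metric_CauchyI)
    fix \<epsilon> :: real assume "\<epsilon> > 0"
    have "(\<lambda>n. s n * norm e) \<longlonglongrightarrow> 0"
      using tendsto_mult_right[OF s0, of "norm e"] by simp
    then have "eventually (\<lambda>n. s n * norm e < \<epsilon> / 2) sequentially"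
      using \<open>\<epsilon> > 0\<close> by (intro order_tendstoD(2)) auto
    then obtain N where N: "\<And>n. n \<ge> N \<Longrightarrow> s n * norm e < \<epsilon> / 2"
      by (auto simp: eventually_sequentially)
    have "dist (T (\<lambda>x. \<phi> m x *\<^sub>R e)) (T (\<lambda>x. \<phi> n x *\<^sub>R e)) < \<epsilon>" if "m \<ge> N" "n \<ge> N" for m n
      using bump_T_diff[OF \<phi>(1-6) \<phi>(1-6), of m e n] N[OF that(1)] N[OF that(2)]
      by (simp add: dist_norm algebra_simps)
    then show "\<exists>N. \<forall>m\<ge>N. \<forall>n\<ge>N. dist (T (\<lambda>x. \<phi> m x *\<^sub>R e)) (T (\<lambda>x. \<phi> n x *\<^sub>R e)) < \<epsilon>"
      by blast
  qed
  define v where "v e = lim (\<lambda>n. T (\<lambda>x. \<phi> n x *\<^sub>R e))" for e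
  have v: "(\<lambda>n. T (\<lambda>x. \<phi> n x *\<^sub>R e)) \<longlonglongrightarrow> v e" for e
    using conv by (simp add: v_def convergent_LIMSEQ_iff)
  have "norm (v e - T (\<lambda>x. \<psi> x *\<^sub>R e)) \<le> c * norm e"
    if "compact L" "open V" "L \<subseteq> A" "A \<subseteq> V" "small (V - L) c" "bump L V \<psi>" for L V c \<psi> e
  proof (rule LIMSEQ_le)
    show "(\<lambda>n. norm (T (\<lambda>x. \<phi> n x *\<^sub>R e) - T (\<lambda>x. \<psi> x *\<^sub>R e))) \<longlonglongrightarrow> norm (v e - T (\<lambda>x. \<psi> x *\<^sub>R e))"
      by (intro tendsto_intros v)
    show "(\<lambda>n. (s n + c) * norm e) \<longlonglongrightarrow> c * norm e"
      using tendsto_mult_right[OF tendsto_add[OF s0 tendsto_const[of c]], of "norm e"] by simp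
    show "\<exists>N. \<forall>n\<ge>N. norm (T (\<lambda>x. \<phi> n x *\<^sub>R e) - T (\<lambda>x. \<psi> x *\<^sub>R e)) \<le> (s n + c) * norm e"
      using bump_T_diff[OF \<phi> that] by blast
  qed
  then show ?thesis by blast
qed

end

section \<open>The representing measure\<close>

context exhaustive_C0_operator
begin

lemma T_bump_add:
  assumes "bump K U \<phi>"
  shows "T (\<lambda>x. \<phi> x *\<^sub>R (e + e')) = T (\<lambda>x. \<phi> x *\<^sub>R e) + T (\<lambda>x. \<phi> x *\<^sub>R e')"
  using T_add[OF bump_c0[OF assms] bump_c0[OF assms], of e e'] by (simp add: scaleR_add_right)

lemma T_bump_scale:
  assumes "bump K U \<phi>"
  shows "T (\<lambda>x. \<phi> x *\<^sub>R sE c e) = sF c (T (\<lambda>x. \<phi> x *\<^sub>R e))"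
proof -
  have eq: "\<phi> x *\<^sub>R sE c e = sE c (\<phi> x *\<^sub>R e)" for x
    by (simp add: E.scale_of_real[symmetric] E.scale_left_commute)
  show ?thesis
    using T_scale[OF bump_c0[OF assms], of c e] bump_c0[OF assms, of "sE c e"] by (simp add: eq)
qed

lemma norm_T_bump_le:
  assumes "bump K U \<phi>"
  shows "norm (T (\<lambda>x. \<phi> x *\<^sub>R e)) \<le> B * norm e"
proof (rule T_bound[OF bump_c0[OF assms]])
  show "norm (\<phi> x *\<^sub>R e) \<le> norm e" for x
    using bumpD(2,3)[OF assms, of x] by (simp add: mult_left_le_one_le)
qed

text \<open>The choice is harmless: for Borel sets the estimate holds with arbitrarily small
  \<open>c\<close> and thus determines the value.\<close>

definition limit_bump :: "'w set \<Rightarrow> 'a \<Rightarrow> 'b"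
  where "limit_bump A = (SOME v. \<forall>K U c \<phi> e. compact K \<and> open U \<and> K \<subseteq> A \<and> A \<subseteq> U \<and> small (U - K) c \<and> bump K U \<phi> \<longrightarrow>
     norm (v e - T (\<lambda>x. \<phi> x *\<^sub>R e)) \<le> c * norm e)"

lemma norm_limit_bump_diff_le:
  assumes "A \<in> sets borel" "compact K" "open U" "K \<subseteq> A" "A \<subseteq> U" "small (U - K) c" "bump K U \<phi>"
  shows "norm (limit_bump A e - T (\<lambda>x. \<phi> x *\<^sub>R e)) \<le> c * norm e"
  using someI_ex[OF ex_limit_bump[OF tight_borel[OF assms(1)]], folded limit_bump_def] assms by simp

lemma ex_bump_limit_bump:
  assumes "A \<in> sets borel" "\<epsilon> > 0"
  shows "\<exists>K U \<phi>. bump K U \<phi> \<and> (\<forall>e. norm (limit_bump A e - T (\<lambda>x. \<phi> x *\<^sub>R e)) \<le> \<epsilon> * norm e)"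
proof -
  obtain K U \<phi> where "compact K" "open U" "K \<subseteq> A" "A \<subseteq> U" "small (U - K) \<epsilon>" "bump K U \<phi>"
    using ex_bump_tight[OF tight_borel[OF assms(1)] assms(2)] by (elim exE conjE) (rule that)
  then show ?thesis
    using norm_limit_bump_diff_le[OF assms(1)] by (intro exI[of _ K] exI[of _ U] exI[of _ \<phi>]) auto
qed

text \<open>An identity may be tested up to \<open>\<epsilon>\<close> on a single bump that
  approximates \<open>limit_bump A\<close> at all vectors simultaneously.\<close>

lemma limit_bump_eqI:
  assumes "A \<in> sets borel"
    "\<And>K U \<phi> \<epsilon>. \<epsilon> > 0 \<Longrightarrow> bump K U \<phi> \<Longrightarrow> (\<And>e. norm (limit_bump A e - T (\<lambda>x. \<phi> x *\<^sub>R e)) \<le> \<epsilon> * norm e) \<Longrightarrow>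
       norm (y - z) \<le> \<epsilon> * D"
  shows "y = z"
proof -
  have "norm (y - z) \<le> 0"
  proof (rule le_if_le_add_small)
    fix \<epsilon> :: real assume "\<epsilon> > 0"
    obtain K U \<phi> where "bump K U \<phi>" "\<And>e. norm (limit_bump A e - T (\<lambda>x. \<phi> x *\<^sub>R e)) \<le> \<epsilon> * norm e"
      using ex_bump_limit_bump[OF assms(1) \<open>\<epsilon> > 0\<close>] by auto
    then show "norm (y - z) \<le> 0 + \<epsilon> * D"
      using assms(2)[OF \<open>\<epsilon> > 0\<close>] by simp
  qed
  then show ?thesis by simp
qed

lemma limit_bump_add:
  assumes "A \<in> sets borel"
  shows "limit_bump A (e + e') = limit_bump A e + limit_bump A e'"
proof (rule limit_bump_eqI[OF assms])
  fix K U \<phi> and \<epsilon> :: real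
  assume b: "bump K U \<phi>" and le: "\<And>e. norm (limit_bump A e - T (\<lambda>x. \<phi> x *\<^sub>R e)) \<le> \<epsilon> * norm e"
  have "limit_bump A (e + e') - (limit_bump A e + limit_bump A e') =
      (limit_bump A (e + e') - T (\<lambda>x. \<phi> x *\<^sub>R (e + e'))) -
      ((limit_bump A e - T (\<lambda>x. \<phi> x *\<^sub>R e)) + (limit_bump A e' - T (\<lambda>x. \<phi> x *\<^sub>R e')))"
    by (simp add: T_bump_add[OF b])
  also have "norm \<dots> \<le> \<epsilon> * norm (e + e') + (\<epsilon> * norm e + \<epsilon> * norm e')"
    by (intro norm_triangle_le_diff add_mono norm_triangle_mono le)
  finally show "norm (limit_bump A (e + e') - (limit_bump A e + limit_bump A e'))
      \<le> \<epsilon> * (norm (e + e') + norm e + norm e')"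
    by (simp add: algebra_simps)
qed

lemma limit_bump_scale:
  assumes "A \<in> sets borel"
  shows "limit_bump A (sE c e) = sF c (limit_bump A e)"
proof (rule limit_bump_eqI[OF assms])
  fix K U \<phi> and \<epsilon> :: real
  assume b: "bump K U \<phi>" and le: "\<And>e. norm (limit_bump A e - T (\<lambda>x. \<phi> x *\<^sub>R e)) \<le> \<epsilon> * norm e"
  have "limit_bump A (sE c e) - sF c (limit_bump A e) =
      (limit_bump A (sE c e) - T (\<lambda>x. \<phi> x *\<^sub>R sE c e)) - sF c (limit_bump A e - T (\<lambda>x. \<phi> x *\<^sub>R e))"
    by (simp add: T_bump_scale[OF b] F.scale_right_diff_distrib)
  also have "norm \<dots> \<le> \<epsilon> * norm (sE c e) + norm c * (\<epsilon> * norm e)"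
    by (intro norm_triangle_le_diff add_mono le) (simp add: F.norm_scale mult_left_mono le)
  finally show "norm (limit_bump A (sE c e) - sF c (limit_bump A e)) \<le> \<epsilon> * (2 * norm c * norm e)"
    by (simp add: E.norm_scale algebra_simps)
qed

lemma limit_bump_bound:
  assumes "A \<in> sets borel"
  shows "norm (limit_bump A e) \<le> B * norm e"
proof (rule le_if_le_add_small)
  fix \<epsilon> :: real assume "\<epsilon> > 0"
  obtain K U \<phi> where "bump K U \<phi>" "norm (limit_bump A e - T (\<lambda>x. \<phi> x *\<^sub>R e)) \<le> \<epsilon> * norm e"
    using ex_bump_limit_bump[OF assms(1) \<open>\<epsilon> > 0\<close>] by auto
  then show "norm (limit_bump A e) \<le> B * norm e + \<epsilon> * norm e"
    using norm_T_bump_le[of K U \<phi> e] norm_triangle_ineq2[of "limit_bump A e" "T (\<lambda>x. \<phi> x *\<^sub>R e)"] by simp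
qed

lemma bounded_linear_limit_bump:
  assumes "A \<in> sets borel"
  shows "bounded_linear (limit_bump A)"
proof (rule bounded_linear_intro)
  show "limit_bump A (r *\<^sub>R e) = r *\<^sub>R limit_bump A e" for r e
    using limit_bump_scale[OF assms, of "of_real r" e] by (simp add: E.scale_of_real F.scale_of_real)
  show "norm (limit_bump A e) \<le> norm e * B" for e
    using limit_bump_bound[OF assms] by (simp add: mult.commute)
qed (rule limit_bump_add[OF assms])

text \<open>The value \<open>undefined\<close> off the Borel sets makes the function extensional, as
  \<open>i_measure\<close> requires.\<close>

definition representing_measure :: "'w set \<Rightarrow> ('a \<Rightarrow>\<^sub>L 'b)"
  where "representing_measure A = (if A \<in> sets borel then Blinfun (limit_bump A) else undefined)"

lemma representing_measure_apply:
  "A \<in> sets borel \<Longrightarrow> blinfun_apply (representing_measure A) = limit_bump A"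
  by (simp add: representing_measure_def bounded_linear_Blinfun_apply bounded_linear_limit_bump)

lemma representing_measure_in: "representing_measure \<in> sets borel \<rightarrow>\<^sub>E operators sE sF"
proof
  fix A :: "'w set" assume A: "A \<in> sets borel"
  show "representing_measure A \<in> operators sE sF"
    unfolding operators_def mem_Collect_eq representing_measure_apply[OF A] Vector_Spaces.linear_iff
    using limit_bump_add[OF A] limit_bump_scale[OF A] E.vector_space_axioms F.vector_space_axioms by blast
qed (simp add: representing_measure_def)

section \<open>Simultaneous approximation of disjoint sets; additivity and regularity\<close>

text \<open>The bound on the sum keeps combinations with vectors of norm at most \<open>C\<close>
  within norm \<open>C\<close>; the sets \<open>W i\<close> allow the supports to be
  localised.\<close>

definition joint_bumps :: "'i set \<Rightarrow> ('i \<Rightarrow> 'w set) \<Rightarrow> ('i \<Rightarrow> 'w set) \<Rightarrow> real \<Rightarrow>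
    ('i \<Rightarrow> 'w set) \<Rightarrow> ('i \<Rightarrow> 'w set) \<Rightarrow> ('i \<Rightarrow> 'w \<Rightarrow> real) \<Rightarrow> bool"
  where "joint_bumps I A W \<delta> K U \<phi> \<longleftrightarrow>
    (\<forall>i\<in>I. compact (K i) \<and> open (U i) \<and> K i \<subseteq> A i \<and> A i \<subseteq> U i \<and> U i \<subseteq> W i \<and> small (U i - K i) \<delta> \<and>
       bump (K i) (U i) (\<phi> i) \<and> (\<forall>e. norm (limit_bump (A i) e - T (\<lambda>x. \<phi> i x *\<^sub>R e)) \<le> \<delta> * norm e)) \<and>
    (\<forall>x. (\<Sum>i\<in>I. \<phi> i x) \<le> 1)"

lemma joint_bumpsD:
  assumes "joint_bumps I A W \<delta> K U \<phi>"
  shows "i \<in> I \<Longrightarrow> compact (K i)" "i \<in> I \<Longrightarrow> open (U i)" "i \<in> I \<Longrightarrow> K i \<subseteq> A i" "i \<in> I \<Longrightarrow> A i \<subseteq> U i"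
    "i \<in> I \<Longrightarrow> U i \<subseteq> W i" "i \<in> I \<Longrightarrow> small (U i - K i) \<delta>" "i \<in> I \<Longrightarrow> bump (K i) (U i) (\<phi> i)"
    "i \<in> I \<Longrightarrow> norm (limit_bump (A i) e - T (\<lambda>x. \<phi> i x *\<^sub>R e)) \<le> \<delta> * norm e"
    "(\<Sum>i\<in>I. \<phi> i x) \<le> 1"
  using assms unfolding joint_bumps_def by simp_all

text \<open>Normalising by \<^term>\<open>max 1\<close> of the sum turns separate bumps into a subordinate family with sum at most one;
  the bumps vanish on the other compact sets, so they remain equal to one on their own.\<close>

lemma ex_joint_bumps:
  assumes "finite I" "disjoint_family_on A I" "\<And>i. i \<in> I \<Longrightarrow> A i \<in> sets borel"
    "\<And>i. i \<in> I \<Longrightarrow> open (W i)" "\<And>i. i \<in> I \<Longrightarrow> A i \<subseteq> W i" "\<delta> > 0"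
  shows "\<exists>K U \<phi>. joint_bumps I A W \<delta> K U \<phi>"
proof -
  define P where "P i K U \<longleftrightarrow> compact K \<and> open U \<and> K \<subseteq> A i \<and> A i \<subseteq> U \<and> U \<subseteq> W i \<and> small (U - K) \<delta>" for i K U
  have "\<exists>K U. P i K U" if i: "i \<in> I" for i
  proof -
    obtain K U where KU: "compact K" "open U" "K \<subseteq> A i" "A i \<subseteq> U" "small (U - K) \<delta>"
      using tight_borel[OF assms(3)[OF i], unfolded tight_def, rule_format, OF \<open>\<delta> > 0\<close>]
      by (elim exE conjE) (rule that)
    have "small ((U \<inter> W i) - K) \<delta>"
      using KU(5) by (rule small_mono) auto
    then show ?thesis
      using KU(1-4) assms(4,5)[OF i] unfolding P_def by (intro exI[of _ K] exI[of _ "U \<inter> W i"]) (auto intro: open_Int)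
  qed
  then obtain K U where "\<And>i. i \<in> I \<Longrightarrow> P i (K i) (U i)"
    by metis
  then have KU: "\<And>i. i \<in> I \<Longrightarrow> compact (K i)" "\<And>i. i \<in> I \<Longrightarrow> open (U i)" "\<And>i. i \<in> I \<Longrightarrow> K i \<subseteq> A i"
    "\<And>i. i \<in> I \<Longrightarrow> A i \<subseteq> U i" "\<And>i. i \<in> I \<Longrightarrow> U i \<subseteq> W i" "\<And>i. i \<in> I \<Longrightarrow> small (U i - K i) \<delta>"
    unfolding P_def by blast+
  have "\<exists>\<psi>. bump (K i) (U i - (\<Union>j\<in>I - {i}. K j)) \<psi>" if i: "i \<in> I" for i
  proof (rule ex_bump[OF lc])
    have "closed (\<Union>j\<in>I - {i}. K j)"
      using KU(1) assms(1) by (intro compact_imp_closed compact_UN) auto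
    then show "open (U i - (\<Union>j\<in>I - {i}. K j))"
      using KU(2)[OF i] by (rule open_Diff[rotated])
    have "K i \<inter> K j = {}" if "j \<in> I - {i}" for j
      using KU(3)[OF i] KU(3)[of j] disjoint_family_onD[OF assms(2) i, of j] that by auto
    moreover have "K i \<subseteq> U i"
      using KU(3,4)[OF i] by (rule order_trans)
    ultimately show "K i \<subseteq> U i - (\<Union>j\<in>I - {i}. K j)"
      by auto
  qed (rule KU(1)[OF i])
  then obtain \<psi> where \<psi>: "\<And>i. i \<in> I \<Longrightarrow> bump (K i) (U i - (\<Union>j\<in>I - {i}. K j)) (\<psi> i)"
    by metis
  define s where "s x = max 1 (\<Sum>i\<in>I. \<psi> i x)" for x
  have s: "s x \<ge> 1" for x
    by (simp add: s_def)
  have "continuous_on UNIV s"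
    unfolding s_def using bumpD(1)[OF \<psi>] by (intro continuous_on_max continuous_on_sum continuous_on_const)
  define \<phi> where "\<phi> i x = \<psi> i x / s x" for i x
  have bump: "bump (K i) (U i) (\<phi> i)" if i: "i \<in> I" for i
    unfolding bump_def
  proof (intro conjI allI impI ballI)
    show "continuous_on UNIV (\<phi> i)"
      unfolding \<phi>_def using bumpD(1)[OF \<psi>[OF i]] \<open>continuous_on UNIV s\<close> s
      by (intro continuous_on_divide) (auto simp: dual_order.strict_implies_not_eq[OF less_le_trans[OF zero_less_one s]])
    show "0 \<le> \<phi> i x" for x
      using bumpD(2)[OF \<psi>[OF i], of x] s[of x] by (simp add: \<phi>_def)
    show "\<phi> i x \<le> 1" for x
      using bumpD(3)[OF \<psi>[OF i], of x] s[of x] by (simp add: \<phi>_def)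
    show "\<phi> i x = 0" if "x \<notin> U i" for x
      using bumpD(5)[OF \<psi>[OF i], of x] that by (simp add: \<phi>_def)
    show "\<phi> i x = 1" if x: "x \<in> K i" for x
    proof -
      have "\<psi> j x = 0" if "j \<in> I - {i}" for j
        using bumpD(5)[OF \<psi>, of j x] that x i by blast
      then have "(\<Sum>j\<in>I. \<psi> j x) = \<psi> i x"
        using assms(1) i by (simp add: sum.remove[of I i])
      then show ?thesis
        using bumpD(4)[OF \<psi>[OF i] x] by (simp add: \<phi>_def s_def)
    qed
    obtain C where "compact C" "\<forall>x. x \<notin> C \<longrightarrow> \<psi> i x = 0"
      using \<psi>[OF i] unfolding bump_def by blast
    then show "\<exists>C. compact C \<and> (\<forall>x. x \<notin> C \<longrightarrow> \<phi> i x = 0)"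
      by (intro exI[of _ C]) (simp add: \<phi>_def)
  qed
  have "(\<Sum>i\<in>I. \<phi> i x) \<le> 1" for x
  proof -
    have "(\<Sum>i\<in>I. \<phi> i x) = (\<Sum>i\<in>I. \<psi> i x) / s x"
      by (simp add: \<phi>_def sum_divide_distrib)
    also have "\<dots> \<le> 1"
      using s[of x] by (simp add: s_def)
    finally show ?thesis .
  qed
  moreover have "norm (limit_bump (A i) e - T (\<lambda>x. \<phi> i x *\<^sub>R e)) \<le> \<delta> * norm e" if i: "i \<in> I" for i e
    using i by (intro norm_limit_bump_diff_le[of _ "K i" "U i"] assms(3) KU bump)
  ultimately show ?thesis
    unfolding joint_bumps_def using KU bump by (intro exI[of _ K] exI[of _ U] exI[of _ \<phi>]) simp
qed

text \<open>The sum is approximated by \<open>T f\<close>, where \<open>f\<close> combines joint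
  bumps with the vectors. Since the bumps add up to at most 1 and vanish off \<open>W\<close>,
  \<open>f\<close> is an admissible test function scaled by \<open>C\<close>, so no constant is
  lost.\<close>

lemma norm_sum_limit_bump_le:
  assumes "finite I" "disjoint_family_on A I" "\<And>i. i \<in> I \<Longrightarrow> A i \<in> sets borel"
    "open W" "\<And>i. i \<in> I \<Longrightarrow> A i \<subseteq> W" "small W c" "\<And>i. i \<in> I \<Longrightarrow> norm (x i) \<le> C" "0 \<le> C"
  shows "norm (\<Sum>i\<in>I. limit_bump (A i) (x i)) \<le> C * c"
proof (rule le_if_le_add_small)
  fix \<delta> :: real assume "\<delta> > 0"
  obtain K U \<phi> where "joint_bumps I A (\<lambda>_. W) \<delta> K U \<phi>"
    using ex_joint_bumps[of I A "\<lambda>_. W", OF assms(1-3) assms(4,5) \<open>\<delta> > 0\<close>] by blast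
  note b = joint_bumpsD(5,7,8,9)[OF this]
  define f where "f y = (\<Sum>i\<in>I. \<phi> i y *\<^sub>R x i)" for y
  have f: "f \<in> c0_functions"
    unfolding f_def using bump_c0[OF b(2)] by (intro c0_sum)
  have "norm (T f) \<le> C * c"
  proof (rule small_scaled[OF assms(6) f _ _ assms(8)])
    show "norm (f y) \<le> C" for y
    proof -
      have "norm (f y) \<le> (\<Sum>i\<in>I. \<phi> i y * C)"
        unfolding f_def using bumpD(2)[OF b(2)] assms(7) by (intro sum_norm_le) (simp add: mult_left_mono)
      also have "\<dots> \<le> C"
        using b(4)[of y] assms(8) by (simp add: sum_distrib_right[symmetric] mult_left_le_one_le sum_nonneg bumpD(2)[OF b(2)])
      finally show ?thesis .
    qed
    show "f y = 0" if "y \<notin> W" for y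
      unfolding f_def using bumpD(5)[OF b(2)] b(1) that by (intro sum.neutral) auto
  qed
  moreover have "norm ((\<Sum>i\<in>I. limit_bump (A i) (x i)) - T f) \<le> \<delta> * (\<Sum>i\<in>I. norm (x i))"
  proof -
    have "T f = (\<Sum>i\<in>I. T (\<lambda>y. \<phi> i y *\<^sub>R x i))"
      unfolding f_def using bump_c0[OF b(2)] by (intro T_sum assms(1))
    then have "(\<Sum>i\<in>I. limit_bump (A i) (x i)) - T f = (\<Sum>i\<in>I. limit_bump (A i) (x i) - T (\<lambda>y. \<phi> i y *\<^sub>R x i))"
      by (simp add: sum_subtractf)
    also have "norm \<dots> \<le> (\<Sum>i\<in>I. \<delta> * norm (x i))"
      by (intro sum_norm_le b(3))
    finally show ?thesis by (simp add: sum_distrib_left)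
  qed
  ultimately show "norm (\<Sum>i\<in>I. limit_bump (A i) (x i)) \<le> C * c + \<delta> * (\<Sum>i\<in>I. norm (x i))"
    using norm_triangle_ineq2[of "\<Sum>i\<in>I. limit_bump (A i) (x i)" "T f"] by simp
qed

text \<open>The sum of two joint bumps stays below 1 and is therefore itself a bump for the union,
  where \<open>T\<close> is additive.\<close>

lemma limit_bump_Un:
  assumes "A \<in> sets borel" "A' \<in> sets borel" "A \<inter> A' = {}"
  shows "limit_bump (A \<union> A') e = limit_bump A e + limit_bump A' e"
proof -
  define S where "S b = (if b then A else A')" for b
  have "norm (limit_bump (A \<union> A') e - (limit_bump A e + limit_bump A' e)) \<le> 0"
  proof (rule le_if_le_add_small)
    fix \<delta> :: real assume "\<delta> > 0"
    have "disjoint_family S" and S_sets: "S b \<in> sets borel" for b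
      using assms by (auto simp: disjoint_family_on_def S_def)
    obtain K U \<phi> where "joint_bumps UNIV S (\<lambda>_. UNIV) \<delta> K U \<phi>"
      using ex_joint_bumps[OF finite \<open>disjoint_family S\<close> S_sets open_UNIV subset_UNIV \<open>\<delta> > 0\<close>] by blast
    note b = joint_bumpsD(1-4,6-9)[OF this, simplified]
    define \<psi> where "\<psi> x = \<phi> True x + \<phi> False x" for x
    have "bump (K True \<union> K False) (U True \<union> U False) \<psi>"
      unfolding bump_def
    proof (intro conjI allI impI ballI)
      show "continuous_on UNIV \<psi>"
        unfolding \<psi>_def using bumpD(1)[OF b(6)] by (intro continuous_on_add)
      show le: "\<psi> x \<le> 1" for x
        using b(8)[of x] by (simp add: \<psi>_def UNIV_bool add.commute)
      show "0 \<le> \<psi> x" for x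
        using bumpD(2)[OF b(6)] by (simp add: \<psi>_def)
      show "\<psi> x = 1" if "x \<in> K True \<union> K False" for x
        using bumpD(4)[OF b(6)] bumpD(2)[OF b(6)] le[of x] that
        by (metis UnE \<psi>_def add_le_same_cancel1 add_le_same_cancel2 add.right_neutral add_0 order_antisym)
      show "\<psi> x = 0" if "x \<notin> U True \<union> U False" for x
        using bumpD(5)[OF b(6)] that by (simp add: \<psi>_def)
      obtain C where "compact C" "\<forall>x. x \<notin> C \<longrightarrow> \<phi> True x = 0"
        using b(6)[of True] unfolding bump_def by blast
      moreover obtain C' where "compact C'" "\<forall>x. x \<notin> C' \<longrightarrow> \<phi> False x = 0"
        using b(6)[of False] unfolding bump_def by blast
      ultimately show "\<exists>C. compact C \<and> (\<forall>x. x \<notin> C \<longrightarrow> \<psi> x = 0)"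
        by (intro exI[of _ "C \<union> C'"]) (simp add: \<psi>_def compact_Un)
    qed
    moreover have "small ((U True \<union> U False) - (K True \<union> K False)) (\<delta> + \<delta>)"
    proof (rule small_mono[OF small_Un])
      show "small (U True - K True) \<delta>" "small (U False - K False) \<delta>"
        using b(5) by blast+
      show "open (U True - K True)" "open (U False - K False)"
        using b(1,2) by (simp_all add: open_Diff compact_imp_closed)
    qed auto
    ultimately have 1: "norm (limit_bump (A \<union> A') e - T (\<lambda>x. \<psi> x *\<^sub>R e)) \<le> (\<delta> + \<delta>) * norm e"
      using b(1-4)[of True] b(1-4)[of False] assms(1,2)
      by (intro norm_limit_bump_diff_le[of _ "K True \<union> K False" "U True \<union> U False"])
        (auto simp: S_def intro: compact_Un)
    have "T (\<lambda>x. \<psi> x *\<^sub>R e) = T (\<lambda>x. \<phi> True x *\<^sub>R e) + T (\<lambda>x. \<phi> False x *\<^sub>R e)"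
      using T_add[OF bump_c0[OF b(6)] bump_c0[OF b(6)], of True e False e] by (simp add: \<psi>_def scaleR_left_distrib)
    then have "limit_bump (A \<union> A') e - (limit_bump A e + limit_bump A' e) =
        (limit_bump (A \<union> A') e - T (\<lambda>x. \<psi> x *\<^sub>R e)) -
        ((limit_bump A e - T (\<lambda>x. \<phi> True x *\<^sub>R e)) + (limit_bump A' e - T (\<lambda>x. \<phi> False x *\<^sub>R e)))"
      by simp
    also have "norm \<dots> \<le> (\<delta> + \<delta>) * norm e + (\<delta> * norm e + \<delta> * norm e)"
      using b(7)[of True e] b(7)[of False e]
      by (intro order_trans[OF norm_triangle_ineq4 add_mono[OF 1 norm_triangle_mono]]) (simp_all add: S_def)
    finally show "norm (limit_bump (A \<union> A') e - (limit_bump A e + limit_bump A' e)) \<le> 0 + \<delta> * (4 * norm e)"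
      by (simp add: algebra_simps)
  qed
  then show ?thesis by simp
qed

lemma limit_bump_empty: "limit_bump {} e = 0"
  using limit_bump_Un[of "{}" "{}" e] by simp

lemma limit_bump_UN_lessThan:
  fixes A :: "nat \<Rightarrow> 'w set"
  assumes "range A \<subseteq> sets borel" "disjoint_family A"
  shows "limit_bump (\<Union>n<N. A n) e = (\<Sum>n<N. limit_bump (A n) e)"
proof (induction N)
  case (Suc N)
  have "(\<Union>n<N. A n) \<inter> A N = {}"
  proof -
    have "A n \<inter> A N = {}" if "n < N" for n
      using assms(2) that by (simp add: disjoint_family_on_def)
    then show ?thesis by auto
  qed
  moreover have "A n \<in> sets borel" for n
    using assms(1) by blast
  ultimately show ?case
    using Suc limit_bump_Un[of "\<Union>n<N. A n" "A N" e] by (simp add: lessThan_Suc Un_commute)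
qed (simp add: limit_bump_empty)

lemma vector_measure_representing: "vector_measure borel representing_measure"
proof
  fix A :: "nat \<Rightarrow> 'w set"
  assume A: "range A \<subseteq> sets borel" "disjoint_family A"
  have A_n: "A n \<in> sets borel" for n
    using A(1) by blast
  show "(\<lambda>n. blinfun_apply (representing_measure (A n)) e) sums blinfun_apply (representing_measure (\<Union>n. A n)) e" for e
  proof -
    have "(\<lambda>N. \<Sum>n<N. limit_bump (A n) e) \<longlonglongrightarrow> limit_bump (\<Union>n. A n) e"
    proof (rule LIMSEQ_I)
      fix \<epsilon> :: real assume "\<epsilon> > 0"
      \<comment> \<open>The summand 1 makes the divisor positive even when \<open>e\<close> is
        0.\<close>
      define k where "k = norm e + 1"
      have k: "k > 0" "norm e \<le> k"
        by (simp_all add: k_def add_nonneg_pos)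
      define \<delta> where "\<delta> = \<epsilon> / (2 * k)"
      have "\<delta> > 0" "k * \<delta> = \<epsilon> / 2"
        using \<open>\<epsilon> > 0\<close> k(1) by (simp_all add: \<delta>_def)
      moreover from this have "norm e * \<delta> \<le> k * \<delta>"
        using k(2) by (intro mult_right_mono) auto
      ultimately have \<delta>: "\<delta> > 0" "norm e * \<delta> < \<epsilon>"
        using \<open>\<epsilon> > 0\<close> by linarith+
      obtain N W where W: "open W" "(\<Union>n\<in>{N..}. A n) \<subseteq> W" "small W \<delta>"
        using ex_small_tail[OF A \<delta>(1)] by blast
      have "norm ((\<Sum>n<M. limit_bump (A n) e) - limit_bump (\<Union>n. A n) e) < \<epsilon>" if "M \<ge> N" for M
      proof -
        define R where "R = (\<Union>n\<in>{M..}. A n)"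
        have "R \<in> sets borel"
          unfolding R_def using A_n by (intro sets.countable_UN') auto
        moreover have "(\<Union>n<M. A n) \<inter> R = {}"
        proof -
          have "A m \<inter> A n = {}" if "m < M" "M \<le> n" for m n
            using A(2) that by (simp add: disjoint_family_on_def)
          then show ?thesis unfolding R_def by blast
        qed
        moreover have "(\<Union>n. A n) = (\<Union>n<M. A n) \<union> R"
        proof -
          have "{..<M} \<union> {M..} = UNIV" by auto
          then show ?thesis unfolding R_def UN_Un[symmetric] by simp
        qed
        ultimately have "limit_bump (\<Union>n. A n) e = (\<Sum>n<M. limit_bump (A n) e) + limit_bump R e"
          using limit_bump_Un[of "\<Union>n<M. A n" R e] A_n by (simp add: limit_bump_UN_lessThan[OF A])
        \<comment> \<open>A one-term sum, so that the general estimate applies to a single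
          set.\<close>
        moreover have "norm (\<Sum>i\<in>{()}. limit_bump R e) \<le> norm e * \<delta>"
        proof (rule norm_sum_limit_bump_le[OF _ _ _ W(1) _ W(3)])
          show "R \<subseteq> W"
            unfolding R_def by (rule order_trans[OF UN_mono W(2)]) (use that in auto)
        qed (use \<open>R \<in> sets borel\<close> in \<open>auto simp: disjoint_family_on_def\<close>)
        ultimately show ?thesis
          using \<delta>(2) by simp
      qed
      then show "\<exists>N. \<forall>n\<ge>N. norm ((\<Sum>n<n. limit_bump (A n) e) - limit_bump (\<Union>n. A n) e) < \<epsilon>"
        by blast
    qed
    moreover have "(\<Union>n. A n) \<in> sets borel"
      using A_n by auto
    ultimately show ?thesis
      unfolding sums_def by (simp add: representing_measure_apply A_n)
  qed
  show "independently_convergent (\<lambda>n. representing_measure (A n))"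
    unfolding independently_convergent_def
  proof (intro allI impI)
    fix x :: "nat \<Rightarrow> 'a" assume "bounded (range x)"
    then obtain C where C: "C > 0" "\<And>n. norm (x n) \<le> C"
      unfolding bounded_pos by blast
    have "summable (\<lambda>n. limit_bump (A n) (x n))"
      unfolding summable_Cauchy
    proof (intro allI impI)
      fix \<epsilon> :: real assume "\<epsilon> > 0"
      then have "\<epsilon> / (2 * C) > 0" using C(1) by simp
      obtain N W where W: "open W" "(\<Union>n\<in>{N..}. A n) \<subseteq> W" "small W (\<epsilon> / (2 * C))"
        using ex_small_tail[OF A \<open>\<epsilon> / (2 * C) > 0\<close>] by blast
      have "norm (\<Sum>k=m..<n. limit_bump (A k) (x k)) < \<epsilon>" if "m \<ge> N" for m n
      proof -
        have "norm (\<Sum>k=m..<n. limit_bump (A k) (x k)) \<le> C * (\<epsilon> / (2 * C))"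
        proof (rule norm_sum_limit_bump_le[OF _ _ _ W(1) _ W(3)])
          show "disjoint_family_on A {m..<n}"
            using A(2) by (rule disjoint_family_on_mono[rotated]) simp
          show "A k \<subseteq> W" if "k \<in> {m..<n}" for k
            using W(2) that \<open>m \<ge> N\<close> by (meson UN_subset_iff atLeastLessThan_iff atLeast_iff order_trans)
        qed (use A_n C in auto)
        then show ?thesis using C(1) \<open>\<epsilon> > 0\<close> by simp
      qed
      then show "\<exists>N. \<forall>m\<ge>N. \<forall>n. norm (\<Sum>k=m..<n. limit_bump (A k) (x k)) < \<epsilon>"
        by blast
    qed
    then show "summable (\<lambda>n. blinfun_apply (representing_measure (A n)) (x n))"
      by (simp add: representing_measure_apply A_n)
  qed
qed

lemma semivar_le_representing:
  assumes "small W c" "open W"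
  shows "semivar_le borel representing_measure W c"
  unfolding semivar_le_def
proof (intro allI impI, elim conjE)
  fix N :: nat and A and x :: "nat \<Rightarrow> 'a"
  assume A: "\<forall>n<N. A n \<in> sets borel \<and> A n \<subseteq> W \<and> norm (x n) \<le> 1" "disjoint_family_on A {..<N}"
  then have "norm (\<Sum>n<N. limit_bump (A n) (x n)) \<le> 1 * c"
    by (intro norm_sum_limit_bump_le[OF _ _ _ assms(2) _ assms(1)]) auto
  then show "norm (\<Sum>n<N. blinfun_apply (representing_measure (A n)) (x n)) \<le> c"
    using A(1) by (simp add: representing_measure_apply)
qed

text \<open>A Borel set inside \<open>A\<close> that misses all \<open>K n\<close> lies in
  \<open>U n - K n\<close> for every \<open>n\<close>, so its measure is bounded by a null
  sequence.\<close>

lemma regular_representing: "regular_borel_i_measure sE sF representing_measure"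
  unfolding regular_borel_i_measure_def
proof (intro conjI ballI)
  interpret vector_measure borel representing_measure
    by (rule vector_measure_representing)
  show "i_measure sE sF borel representing_measure"
    unfolding i_measure_def using representing_measure_in sums_UN independent by blast
  fix A :: "'w set" assume A: "A \<in> sets borel"
  have "\<exists>K U. compact K \<and> open U \<and> K \<subseteq> A \<and> A \<subseteq> U \<and> small (U - K) (1 / real (Suc n))" for n
    by (rule tight_borel[OF A, unfolded tight_def, rule_format]) simp
  then obtain K U :: "nat \<Rightarrow> 'w set" where KU: "\<And>n. compact (K n)" "\<And>n. open (U n)" "\<And>n. K n \<subseteq> A" "\<And>n. A \<subseteq> U n"
    "\<And>n. small (U n - K n) (1 / real (Suc n))"
    by metis
  show "\<exists>K :: nat \<Rightarrow> 'w set. (\<forall>n. compact (K n)) \<and> (\<Union>n. K n) \<subseteq> A \<and>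
       (\<forall>S\<in>sets borel. S \<subseteq> A - (\<Union>n. K n) \<longrightarrow> representing_measure S = 0)"
  proof (intro exI[of _ K] conjI allI ballI impI)
    fix S :: "'w set" assume S: "S \<in> sets borel" "S \<subseteq> A - (\<Union>n. K n)"
    have "limit_bump S e = 0" for e
    proof -
      have le: "norm (limit_bump S e) \<le> norm e * (1 / real (Suc n))" for n
      proof -
        have "norm (\<Sum>i\<in>{()}. limit_bump S e) \<le> norm e * (1 / real (Suc n))"
        proof (rule norm_sum_limit_bump_le[OF _ _ _ _ _ KU(5)])
          show "open (U n - K n)"
            using KU(1,2) by (simp add: open_Diff compact_imp_closed)
          show "S \<subseteq> U n - K n"
            using S(2) KU(4)[of n] by auto
        qed (use S(1) in \<open>auto simp: disjoint_family_on_def\<close>)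
        then show ?thesis by simp
      qed
      have "(\<lambda>n. norm e * (1 / real (Suc n))) \<longlonglongrightarrow> norm e * 0"
        by (intro tendsto_mult tendsto_const LIMSEQ_Suc lim_1_over_n)
      then have "norm (limit_bump S e) \<le> norm e * 0"
        by (rule LIMSEQ_le_const) (use le in blast)
      then show ?thesis by simp
    qed
    then show "representing_measure S = 0"
      by (intro blinfun_eqI) (simp add: representing_measure_apply S(1))
  qed (use KU in auto)
qed

section \<open>Representation of the operator by the integral\<close>

text \<open>With joint bumps for the level sets of \<open>h\<close>, \<open>f\<close> splits as
  \<open>g + p + q\<close>. \<open>T g\<close> is close to the integral of \<open>h\<close>;
  \<open>p\<close> is uniformly at most \<open>\<epsilon> + \<delta>\<close>, since each bump lives
  where \<open>f\<close> is near its value; \<open>q\<close> lives on the small differences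
  \<open>U e - K e\<close>.\<close>

lemma norm_T_diff_simple_integral_le:
  assumes f: "f \<in> c0_functions" and h: "simple_function borel h" and le: "\<And>x. norm (f x - h x) \<le> \<epsilon>"
  shows "norm (T f - vector_measure.simple_integral borel representing_measure h) \<le> B * \<epsilon>"
proof -
  obtain C where C: "C > 0" "\<And>x. norm (f x) \<le> C"
    using c0_bounded[OF f] by blast
  interpret vector_measure borel representing_measure
    by (rule vector_measure_representing)
  show ?thesis
  proof (rule le_if_le_add_small)
    fix \<delta> :: real assume "\<delta> > 0"
    define I where "I = range h"
    define A where "A e = h -` {e}" for e
    have I: "finite I" "\<And>e. e \<in> I \<Longrightarrow> A e \<in> sets borel"
      using h by (auto simp: simple_function_def I_def A_def simp del: vimage_singleton_eq)
    have "disjoint_family_on A I"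
      by (auto simp: disjoint_family_on_def A_def)
    \<comment> \<open>The slack \<open>\<delta>\<close> gives a strict inequality, hence an open set
      that still contains the level set \<open>A e\<close>.\<close>
    define W where "W e = {x. norm (f x - e) < \<epsilon> + \<delta>}" for e
    have W: "open (W e)" "A e \<subseteq> W e" for e
    proof -
      show "open (W e)"
        unfolding W_def using c0_continuous[OF f] by (intro open_Collect_less continuous_intros)
      show "A e \<subseteq> W e"
        using add_le_less_mono[OF le \<open>\<delta> > 0\<close>] by (auto simp: A_def W_def)
    qed
    obtain K U \<phi> where "joint_bumps I A W \<delta> K U \<phi>"
      using ex_joint_bumps[of I A W, OF I(1) \<open>disjoint_family_on A I\<close> I(2) W \<open>\<delta> > 0\<close>] by blast
    note b = joint_bumpsD[OF this]
    define g where "g x = (\<Sum>e\<in>I. \<phi> e x *\<^sub>R e)" for x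
    define p where "p x = (\<Sum>e\<in>I. \<phi> e x *\<^sub>R (f x - e))" for x
    define q where "q x = (1 - (\<Sum>e\<in>I. \<phi> e x)) *\<^sub>R f x" for x
    have sum_nonneg': "0 \<le> (\<Sum>e\<in>I. \<phi> e x)" for x
      using bumpD(2)[OF b(7)] by (intro sum_nonneg)
    have cont: "continuous_on UNIV (\<lambda>x. \<Sum>e\<in>I. \<phi> e x)"
      using bumpD(1)[OF b(7)] by (intro continuous_on_sum)
    have g: "g \<in> c0_functions"
      unfolding g_def using bump_c0[OF b(7)] by (intro c0_sum)
    have q: "q \<in> c0_functions"
      unfolding q_def using sum_nonneg' b(9) f
      by (intro c0_scaleR_fun[where c = 1] continuous_on_diff continuous_on_const cont) auto
    have "p = (\<lambda>x. (\<Sum>e\<in>I. \<phi> e x) *\<^sub>R f x - g x)"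
      by (auto simp: p_def g_def scaleR_diff_right sum_subtractf scaleR_sum_left)
    then have p: "p \<in> c0_functions"
      using sum_nonneg' b(9) f g cont by (auto intro!: c0_diff c0_scaleR_fun[where c = 1])
    have "(\<lambda>x. g x + (p x + q x)) = f"
      by (auto simp: \<open>p = _\<close> q_def algebra_simps)
    then have Tf: "T f = T g + (T p + T q)"
      using T_add[OF g c0_add[OF p q]] T_add[OF p q] by simp
    have "norm (T p) \<le> B * (\<epsilon> + \<delta>)"
    proof (rule T_bound[OF p])
      have "\<epsilon> \<ge> 0" using le[of undefined] norm_ge_zero order_trans by blast
      fix x
      have "norm (p x) \<le> (\<Sum>e\<in>I. \<phi> e x * (\<epsilon> + \<delta>))"
        unfolding p_def
      proof (rule sum_norm_le)
        fix e assume e: "e \<in> I"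
        show "norm (\<phi> e x *\<^sub>R (f x - e)) \<le> \<phi> e x * (\<epsilon> + \<delta>)"
        proof (cases "x \<in> U e")
          case True
          then have "norm (f x - e) \<le> \<epsilon> + \<delta>"
            using b(5)[OF e] by (auto simp: W_def)
          then show ?thesis
            using bumpD(2)[OF b(7)[OF e], of x] by (simp add: mult_left_mono)
        next
          case False
          then show ?thesis
            using bumpD(5)[OF b(7)[OF e]] by simp
        qed
      qed
      also have "\<dots> \<le> \<epsilon> + \<delta>"
        using b(9)[of x] sum_nonneg'[of x] \<open>\<epsilon> \<ge> 0\<close> \<open>\<delta> > 0\<close>
        by (simp add: sum_distrib_right[symmetric] mult_left_le_one_le)
      finally show "norm (p x) \<le> \<epsilon> + \<delta>" .
    qed
    moreover have "norm (T q) \<le> C * (\<Sum>e\<in>I. \<delta>)"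
    proof (rule small_scaled[OF small_UN[OF I(1)] q])
      show "open (U e - K e)" if "e \<in> I" for e
        using b(1,2)[OF that] by (simp add: open_Diff compact_imp_closed)
      show "small (U e - K e) \<delta>" if "e \<in> I" for e
        by (rule b(6)[OF that])
      show "norm (q x) \<le> C" for x
      proof -
        have "norm (q x) \<le> norm (f x)"
          using b(9)[of x] sum_nonneg'[of x] by (simp add: q_def mult_left_le_one_le)
        then show ?thesis using C(2)[of x] by simp
      qed
      show "q x = 0" if x: "x \<notin> (\<Union>e\<in>I. U e - K e)" for x
      proof -
        \<comment> \<open>The level sets cover the space: outside the differences, \<open>x\<close>
          lies in the compact set of its own level, where one bump is 1 and the sum is exactly
          1.\<close>
        have e: "h x \<in> I" "x \<in> A (h x)"
          by (auto simp: I_def A_def)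
        then have "x \<in> K (h x)"
          using x b(4) by blast
        then have "\<phi> (h x) x = 1"
          using bumpD(4)[OF b(7)[OF e(1)]] by blast
        moreover have "\<phi> (h x) x \<le> (\<Sum>e\<in>I. \<phi> e x)"
          using bumpD(2)[OF b(7)] e(1) I(1) by (intro member_le_sum) auto
        ultimately show ?thesis
          using b(9)[of x] by (simp add: q_def)
      qed
    qed (use C in simp)
    moreover have "norm (T g - simple_integral h) \<le> \<delta> * (\<Sum>e\<in>I. norm e)"
    proof -
      have "T g = (\<Sum>e\<in>I. T (\<lambda>x. \<phi> e x *\<^sub>R e))"
        unfolding g_def using bump_c0[OF b(7)] by (intro T_sum I(1))
      moreover have "simple_integral h = (\<Sum>e\<in>I. limit_bump (A e) e)"
        unfolding simple_integral_def I_def[symmetric] using I(2)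
        by (simp add: I_def A_def representing_measure_apply)
      ultimately have "norm (T g - simple_integral h) = norm (\<Sum>e\<in>I. T (\<lambda>x. \<phi> e x *\<^sub>R e) - limit_bump (A e) e)"
        by (simp add: sum_subtractf)
      also have "\<dots> \<le> (\<Sum>e\<in>I. \<delta> * norm e)"
        using b(8) by (intro sum_norm_le) (simp add: norm_minus_commute)
      finally show ?thesis by (simp add: sum_distrib_left)
    qed
    moreover have "norm (T f - simple_integral h) \<le> norm (T g - simple_integral h) + (norm (T p) + norm (T q))"
      unfolding Tf by norm
    ultimately show "norm (T f - simple_integral h) \<le> B * \<epsilon> + \<delta> * (B + C * real (card I) + (\<Sum>e\<in>I. norm e))"
      by (simp add: algebra_simps)
  qed
qed

lemma ex_simple_approximants:
  assumes f: "f \<in> c0_functions"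
  shows "\<exists>h. (\<forall>n. simple_function borel (h n)) \<and> (\<forall>n x. norm (f x - h n x) \<le> 1 / real (Suc n)) \<and>
    uniform_limit UNIV h f sequentially"
proof -
  have "\<exists>h. simple_function borel h \<and> (\<forall>x. norm (f x - h x) \<le> 1 / real (Suc n))" for n
    by (rule c0_simple_approx[OF f]) simp
  then obtain h where h: "\<And>n. simple_function borel (h n)" "\<And>n x. norm (f x - h n x) \<le> 1 / real (Suc n)"
    by metis
  have "uniform_limit UNIV h f sequentially"
  proof (rule uniform_limitI)
    fix e :: real assume "e > 0"
    have "(\<lambda>n. 1 / real (Suc n)) \<longlonglongrightarrow> 0"
      by (intro LIMSEQ_Suc lim_1_over_n)
    then have "eventually (\<lambda>n. 1 / real (Suc n) < e) sequentially"
      using \<open>e > 0\<close> by (rule order_tendstoD(2))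
    then show "\<forall>\<^sub>F n in sequentially. \<forall>x\<in>UNIV. dist (h n x) (f x) < e"
      by (rule eventually_mono) (use h(2) in \<open>auto simp: dist_norm norm_minus_commute intro: le_less_trans\<close>)
  qed
  then show ?thesis using h by blast
qed

lemma i_integral_representing:
  assumes f: "f \<in> c0_functions"
  shows "i_integral borel representing_measure f = T f"
proof -
  interpret vector_measure borel representing_measure
    by (rule vector_measure_representing)
  obtain h where h: "\<And>n. simple_function borel (h n)" "\<And>n x. norm (f x - h n x) \<le> 1 / real (Suc n)"
    "uniform_limit UNIV h f sequentially"
    using ex_simple_approximants[OF f] by blast
  have "(\<lambda>n. simple_integral (h n)) \<longlonglongrightarrow> i_integral borel representing_measure f"
    using h(1,3) by (intro simple_integral_tendsto_i_integral) auto
  moreover have "(\<lambda>n. simple_integral (h n)) \<longlonglongrightarrow> T f"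
  proof (rule LIM_zero_cancel, rule Lim_null_comparison)
    have "norm (simple_integral (h n) - T f) \<le> B * (1 / real (Suc n))" for n
      using norm_T_diff_simple_integral_le[OF f h(1,2)] by (simp add: norm_minus_commute)
    then show "\<forall>\<^sub>F n in sequentially. norm (simple_integral (h n) - T f) \<le> B * (1 / real (Suc n))"
      by simp
    have "(\<lambda>n. B * (1 / real (Suc n))) \<longlonglongrightarrow> B * 0"
      by (intro tendsto_mult tendsto_const LIMSEQ_Suc lim_1_over_n)
    then show "(\<lambda>n. B * (1 / real (Suc n))) \<longlonglongrightarrow> 0"
      by simp
  qed
  ultimately show ?thesis
    by (rule LIMSEQ_unique)
qed

text \<open>The source of the equality of norms. For the forward direction, \<open>T f\<close> is a
  limit of integrals of simple functions whose norms exceed 1 by a null sequence.\<close>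

lemma semivar_le_representing_iff: "semivar_le borel representing_measure UNIV c \<longleftrightarrow> small UNIV c"
proof
  interpret vector_measure borel representing_measure
    by (rule vector_measure_representing)
  assume c: "semivar_le borel representing_measure UNIV c"
  show "small UNIV c"
    unfolding small_def
  proof (intro ballI impI)
    fix f :: "'w \<Rightarrow> 'a" assume f: "f \<in> c0_functions" "\<forall>x. norm (f x) \<le> 1"
    obtain h where h: "\<And>n. simple_function borel (h n)" "\<And>n x. norm (f x - h n x) \<le> 1 / real (Suc n)"
      "uniform_limit UNIV h f sequentially"
      using ex_simple_approximants[OF f(1)] by blast
    have "norm (simple_integral (h n)) \<le> (1 + 1 / real (Suc n)) * c" for n
    proof (rule norm_simple_integral_le_total[OF h(1)])
      show "norm (h n x) \<le> 1 + 1 / real (Suc n)" for x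
        using f(2) h(2)[of x n] norm_triangle_ineq2[of "h n x" "f x"] by (smt (verit) norm_minus_commute)
    qed (use c in auto)
    moreover have "(\<lambda>n. simple_integral (h n)) \<longlonglongrightarrow> T f"
      unfolding i_integral_representing[OF f(1), symmetric]
      using h(1,3) by (intro simple_integral_tendsto_i_integral) auto
    moreover have "(\<lambda>n. (1 + 1 / real (Suc n)) * c) \<longlonglongrightarrow> (1 + 0) * c"
      by (intro tendsto_mult tendsto_add tendsto_const LIMSEQ_Suc lim_1_over_n)
    ultimately show "norm (T f) \<le> c"
      by (intro LIMSEQ_le[of "\<lambda>n. norm (simple_integral (h n))" _ "\<lambda>n. (1 + 1 / real (Suc n)) * c"] tendsto_norm) auto
  qed
qed (simp add: semivar_le_representing)

end

section \<open>Uniqueness of the regular measure\<close>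

lemma vector_measure_if_i_measure: "i_measure sE sF M \<mu> \<Longrightarrow> vector_measure M \<mu>"
  unfolding i_measure_def vector_measure_def by blast

text \<open>Removing finite unions of the sets \<open>K n\<close> from \<open>A\<close> leaves a
  decreasing sequence with null intersection; continuity of the semivariation finishes.\<close>

lemma ex_compact_semivar_le:
  fixes \<nu> :: "'w::t2_space set \<Rightarrow> ('a::banach \<Rightarrow>\<^sub>L 'b::banach)"
  assumes \<nu>: "regular_borel_i_measure sE sF \<nu>" and A: "A \<in> sets borel" and "\<delta> > 0"
  shows "\<exists>K. compact K \<and> K \<subseteq> A \<and> semivar_le borel \<nu> (A - K) \<delta>"
proof -
  have "i_measure sE sF borel \<nu>"
    using \<nu> by (simp add: regular_borel_i_measure_def)
  then interpret vector_measure borel \<nu>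
    by (rule vector_measure_if_i_measure)
  obtain K :: "nat \<Rightarrow> 'w set" where K: "\<And>n. compact (K n)" "(\<Union>n. K n) \<subseteq> A"
    "\<And>S. S \<in> sets borel \<Longrightarrow> S \<subseteq> A - (\<Union>n. K n) \<Longrightarrow> \<nu> S = 0"
    using \<nu> A unfolding regular_borel_i_measure_def by metis
  define D where "D n = A - (\<Union>k<n. K k)" for n
  have UN: "compact (\<Union>k<n. K k)" for n
    using K(1) by (intro compact_UN) auto
  have "\<exists>n. semivar_le borel \<nu> (D n) \<delta>"
  proof (rule ex_semivar_le_decseq[OF _ _ _ \<open>\<delta> > 0\<close>])
    show "range D \<subseteq> sets borel"
      using A borel_compact[OF UN] by (auto simp: D_def)
    show "decseq D"
      unfolding D_def decseq_def by (intro allI impI Diff_mono UN_mono) auto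
    have "(\<Inter>n. D n) = A - (\<Union>n. K n)"
      by (auto simp: D_def)
    then show "semivar_le borel \<nu> (\<Inter>n. D n) 0"
      using K(3) by (simp add: semivar_le_def)
  qed
  then obtain n where "semivar_le borel \<nu> (D n) \<delta>" by blast
  then show ?thesis
    unfolding D_def using UN[of n] K(2) by (intro exI[of _ "\<Union>k<n. K k"]) auto
qed

context exhaustive_C0_operator
begin

text \<open>One bump serves both measures: it lies between inner compact sets chosen for
  \<open>\<nu>\<close> and for \<open>T\<close>, and below an open set that also avoids a compact
  part \<open>L\<close> of the complement. It equals the indicator of \<open>A\<close> on
  \<open>G = K1 \<union> L\<close>, and off \<open>G\<close> the semivariation of
  \<open>\<nu>\<close> is at most \<open>2 * \<delta>\<close>.\<close>

lemma representing_measure_unique: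
  assumes \<nu>: "regular_borel_i_measure sE sF \<nu>"
    and T_eq: "\<And>f. f \<in> c0_functions \<Longrightarrow> T f = i_integral borel \<nu> f"
  shows "\<nu> = representing_measure"
proof -
  have im: "i_measure sE sF borel \<nu>"
    using \<nu> by (simp add: regular_borel_i_measure_def)
  then interpret vector_measure borel \<nu>
    by (rule vector_measure_if_i_measure)
  have eq: "blinfun_apply (\<nu> A) e = limit_bump A e" if A: "A \<in> sets borel" for A e
  proof -
    have "norm (blinfun_apply (\<nu> A) e - limit_bump A e) \<le> 0"
    proof (rule le_if_le_add_small)
      fix \<delta> :: real assume "\<delta> > 0"
      obtain K1 where K1: "compact K1" "K1 \<subseteq> A" "semivar_le borel \<nu> (A - K1) \<delta>"
        using ex_compact_semivar_le[OF \<nu> A \<open>\<delta> > 0\<close>] by blast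
      obtain L where L: "compact L" "L \<subseteq> - A" "semivar_le borel \<nu> (- A - L) \<delta>"
        using ex_compact_semivar_le[OF \<nu> _ \<open>\<delta> > 0\<close>, of "- A"] A by auto
      obtain K2 U where KU: "compact K2" "open U" "K2 \<subseteq> A" "A \<subseteq> U" "small (U - K2) \<delta>"
        using tight_borel[OF A, unfolded tight_def, rule_format, OF \<open>\<delta> > 0\<close>] by (elim exE conjE) (rule that)
      have cK: "compact (K1 \<union> K2)" and oU: "open (U - L)"
        using K1(1) KU(1,2) L(1) by (auto intro: compact_Un open_Diff compact_imp_closed)
      have sub: "K1 \<union> K2 \<subseteq> A" "A \<subseteq> U - L"
        using K1(2) KU(3,4) L(2) by auto
      obtain \<phi> where \<phi>: "bump (K1 \<union> K2) (U - L) \<phi>"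
        using ex_bump[OF lc cK oU order_trans[OF sub]] by blast
      have "small ((U - L) - (K1 \<union> K2)) \<delta>"
        using KU(5) by (rule small_mono) auto
      then have 1: "norm (limit_bump A e - T (\<lambda>x. \<phi> x *\<^sub>R e)) \<le> \<delta> * norm e"
        by (rule norm_limit_bump_diff_le[OF A cK oU sub _ \<phi>])
      define f where "f x = \<phi> x *\<^sub>R e" for x
      have f: "f \<in> c0_functions"
        unfolding f_def by (rule bump_c0[OF \<phi>])
      \<comment> \<open>The indicator of \<open>A\<close> times \<open>e\<close>, whose integral is
        \<open>\<nu> A\<close> at \<open>e\<close>; the approximants of \<open>f\<close> are
        compared with it.\<close>
      define h0 where "h0 x = (if x \<in> A then e else 0)" for x
      have h0: "simple_function borel h0"
        unfolding h0_def using A by (intro simple_function_If simple_function_const) auto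
      have int_h0: "simple_integral h0 = blinfun_apply (\<nu> A) e"
      proof -
        have "simple_integral h0 = (\<Sum>b\<in>UNIV. blinfun_apply (\<nu> (if b then A else - A)) (if b then e else 0))"
          using A by (intro simple_integral_partition) (auto simp: disjoint_family_on_def h0_def split: if_splits)
        then show ?thesis
          by (simp add: UNIV_bool blinfun.zero_right)
      qed
      obtain h where h: "\<And>n. simple_function borel (h n)" "\<And>n x. norm (f x - h n x) \<le> 1 / real (Suc n)"
        "uniform_limit UNIV h f sequentially"
        using ex_simple_approximants[OF f] by blast
      obtain c where c: "0 \<le> c" "semivar_le borel \<nu> (space borel) c"
        by (rule ex_semivar_le_nonneg)
      define G where "G = K1 \<union> L"
      have G: "G \<in> sets borel"
        unfolding G_def using K1(1) L(1) by (intro sets.Un borel_compact)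
      have rest: "semivar_le borel \<nu> (space borel - G) (\<delta> + \<delta>)"
        using semivar_le_Un[OF K1(3) L(3)] borel_compact[OF K1(1)] A L(2) K1(2)
        by (auto elim!: semivar_le_mono simp: G_def)
      have f_le: "norm (f x) \<le> norm e" for x
        using bumpD(2,3)[OF \<phi>, of x] by (simp add: f_def mult_left_le_one_le)
      have "norm (simple_integral (h n) - blinfun_apply (\<nu> A) e)
          \<le> 1 / real (Suc n) * c + (1 / real (Suc n) + norm e) * (\<delta> + \<delta>)" for n
      proof -
        have "norm (simple_integral (\<lambda>x. h n x - h0 x))
            \<le> 1 / real (Suc n) * c + (1 / real (Suc n) + norm e) * (\<delta> + \<delta>)"
        proof (rule norm_simple_integral_le[OF simple_function_diff[OF h(1) h0] G _ _ _ _ _ rest])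
          show "norm (h n x - h0 x) \<le> 1 / real (Suc n)" if "x \<in> G" for x
          proof -
            have "h0 x = f x"
              using that K1(2) L(2) bumpD(4)[OF \<phi>, of x] bumpD(5)[OF \<phi>, of x]
              by (auto simp: h0_def f_def G_def)
            then show ?thesis
              using h(2)[of x n] by (simp add: norm_minus_commute)
          qed
          show "norm (h n x - h0 x) \<le> 1 / real (Suc n) + norm e" if "x \<in> space borel - G" for x
          proof -
            have "norm (f x - h0 x) \<le> norm e"
            proof (cases "x \<in> A")
              case True
              then have "f x - h0 x = (\<phi> x - 1) *\<^sub>R e"
                by (simp add: f_def h0_def scaleR_left_diff_distrib)
              then show ?thesis
                using bumpD(2,3)[OF \<phi>, of x] by (simp add: mult_left_le_one_le)
            next
              case False
              then show ?thesis using f_le by (simp add: h0_def)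
            qed
            then show ?thesis
              using h(2)[of x n] norm_triangle_ineq[of "h n x - f x" "f x - h0 x"]
              by (simp add: norm_minus_commute)
          qed
          show "semivar_le borel \<nu> G c"
            using c(2) by (rule semivar_le_mono) auto
        qed auto
        then show ?thesis
          by (simp add: simple_integral_diff[OF h(1) h0] int_h0)
      qed
      moreover have "(\<lambda>n. simple_integral (h n)) \<longlonglongrightarrow> T f"
        unfolding T_eq[OF f] using h(1,3) by (intro simple_integral_tendsto_i_integral) auto
      moreover have "(\<lambda>n. 1 / real (Suc n) * c + (1 / real (Suc n) + norm e) * (\<delta> + \<delta>))
          \<longlonglongrightarrow> 0 * c + (0 + norm e) * (\<delta> + \<delta>)"
        by (intro tendsto_mult tendsto_add tendsto_const LIMSEQ_Suc lim_1_over_n)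
      ultimately have "norm (T f - blinfun_apply (\<nu> A) e) \<le> 0 * c + (0 + norm e) * (\<delta> + \<delta>)"
        by (intro LIMSEQ_le[of "\<lambda>n. norm (simple_integral (h n) - blinfun_apply (\<nu> A) e)"] tendsto_norm tendsto_diff
            tendsto_const) auto
      \<comment> \<open>The factor 3: \<open>2 * \<delta>\<close> from \<open>\<nu>\<close> off
        \<open>G\<close> and \<open>\<delta>\<close> from the bump estimate for
        \<open>limit_bump\<close>.\<close>
      then show "norm (blinfun_apply (\<nu> A) e - limit_bump A e) \<le> 0 + \<delta> * (3 * norm e)"
        using 1 norm_triangle_ineq4[of "T f - blinfun_apply (\<nu> A) e" "T f - limit_bump A e"]
        by (simp add: f_def[symmetric] norm_minus_commute algebra_simps)
    qed
    then show ?thesis by simp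
  qed
  show ?thesis
  proof (rule PiE_ext)
    show "\<nu> \<in> sets borel \<rightarrow>\<^sub>E operators sE sF"
      using im by (simp add: i_measure_def)
    show "representing_measure \<in> sets borel \<rightarrow>\<^sub>E operators sE sF"
      by (rule representing_measure_in)
    show "\<nu> A = representing_measure A" if "A \<in> sets borel" for A
      using eq[OF that] by (intro blinfun_eqI) (simp add: representing_measure_apply[OF that])
  qed
qed

end

section \<open>Transfer to bounded continuous functions and conclusion\<close>

lemma apply_Bcontfun_c0:
  assumes "f \<in> c0_functions"
  shows "apply_bcontfun (Bcontfun f) = f"
proof -
  obtain C where "\<And>x. norm (f x) \<le> C"
    using c0_bounded[OF assms] by blast
  then show ?thesis
    using c0_continuous[OF assms] by (intro Bcontfun_inverse bcontfun_normI)
qed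

lemma C0_iff: "f \<in> C0 \<longleftrightarrow> apply_bcontfun f \<in> c0_functions"
  by (simp add: C0_def c0_functions_def)

lemma Bcontfun_in_C0: "f \<in> c0_functions \<Longrightarrow> Bcontfun f \<in> C0"
  by (simp add: C0_iff apply_Bcontfun_c0)

text \<open>\<open>T\<close> is linear and continuous on \<open>C0\<close> only, while its type
  covers all bounded continuous functions; hence the usual scaling argument is repeated on
  \<open>C0\<close>.\<close>

lemma C0_operator_bounded:
  fixes sE :: "'k::real_or_complex \<Rightarrow> 'a::banach \<Rightarrow> 'a" and sF :: "'k \<Rightarrow> 'b::banach \<Rightarrow> 'b"
    and T :: "('w::t2_space \<Rightarrow>\<^sub>C 'a) \<Rightarrow> 'b"
  assumes "banach_over sE" "banach_over sF" "C0_operator sE sF T"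
  obtains B where "0 \<le> B" "\<And>f. f \<in> C0 \<Longrightarrow> norm (T f) \<le> B * norm f"
proof -
  interpret E: banach_over sE by fact
  interpret F: banach_over sF by fact
  have T_scaleR: "T (r *\<^sub>R f) = r *\<^sub>R T f" and C0_scaleR: "r *\<^sub>R f \<in> C0" if "f \<in> C0" for r and f :: "'w \<Rightarrow>\<^sub>C 'a"
  proof -
    show "r *\<^sub>R f \<in> C0"
      using that c0_scaleR_fun[of "apply_bcontfun f" "\<lambda>_. r" "\<bar>r\<bar>"] by (simp add: C0_iff)
    then have "T (r *\<^sub>R f) = sF (of_real r) (T f)"
      using assms(3) that unfolding C0_operator_def by (simp add: E.scale_of_real)
    then show "T (r *\<^sub>R f) = r *\<^sub>R T f"
      by (simp add: F.scale_of_real)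
  qed
  have 0: "(0 :: 'w \<Rightarrow>\<^sub>C 'a) \<in> C0"
    by (simp add: C0_iff c0_zero)
  have "T 0 = 0"
    using T_scaleR[OF 0, of 0] by simp
  moreover have "continuous_on C0 T"
    using assms(3) by (simp add: C0_operator_def)
  ultimately obtain d where d: "d > 0" "\<And>f. f \<in> C0 \<Longrightarrow> norm f < d \<Longrightarrow> norm (T f) < 1"
    using 0 unfolding continuous_on_iff by (metis dist_0_norm dist_commute zero_less_one)
  have "norm (T f) \<le> 2 / d * norm f" if f: "f \<in> C0" for f
  proof (cases "f = 0")
    case False
    define r where "r = d / (2 * norm f)"
    have "r > 0" "norm (r *\<^sub>R f) < d"
      using False \<open>d > 0\<close> by (auto simp: r_def)
    then have "r * norm (T f) < 1"
      using d(2)[OF C0_scaleR[OF f], of r] T_scaleR[OF f, of r] by simp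
    then show ?thesis
      using False \<open>d > 0\<close> by (simp add: r_def field_simps)
  qed (simp add: \<open>T 0 = 0\<close>)
  then show thesis
    using \<open>d > 0\<close> by (intro that[of "2 / d"]) auto
qed

lemma (in banach_over) continuous_on_scale: "continuous_on UNIV f \<Longrightarrow> continuous_on UNIV (\<lambda>x. scale c (f x))"
proof -
  have "bounded_linear (scale c)"
  proof (rule bounded_linear_intro)
    show "scale c (r *\<^sub>R x) = r *\<^sub>R scale c x" for r x
      by (simp add: scale_of_real[symmetric] scale_left_commute)
    show "norm (scale c x) \<le> norm x * norm c" for x
      by (simp add: norm_scale)
  qed (rule scale_right_distrib)
  then show "continuous_on UNIV f \<Longrightarrow> ?thesis"
    by (rule bounded_linear.continuous_on)
qed

lemma (in banach_over) c0_scale: "f \<in> c0_functions \<Longrightarrow> (\<lambda>x. scale c (f x)) \<in> c0_functions"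
  by (rule c0_if_dominated[of f _ "norm c"]) (simp_all add: continuous_on_scale c0_continuous norm_scale)

text \<open>For disjointly supported functions at most one term of a combination is nonzero at each
  point, so combinations with coefficients in the unit ball keep norm at most 1. Their images are
  bounded by \<open>B\<close>, which is the hypothesis of
  \<open>tendsto_0_if_combinations_bounded\<close>.\<close>

lemma exhaustive_C0_operator_Bcontfun:
  fixes sE :: "'k::real_or_complex \<Rightarrow> 'a::banach \<Rightarrow> 'a" and sF :: "'k \<Rightarrow> 'b::banach \<Rightarrow> 'b"
    and T :: "('w::t2_space \<Rightarrow>\<^sub>C 'a) \<Rightarrow> 'b"
  assumes E: "banach_over sE" and F: "banach_over sF"
    and vsc: "variationally_seq_complete sF" and no_linfty: "\<not> contains_copy_of_linfty TYPE('b)"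
    and lc: "locally_compact_space (euclidean :: 'w topology)" and T: "C0_operator sE sF T"
  obtains B where "exhaustive_C0_operator sE sF (\<lambda>f. T (Bcontfun f)) B"
proof -
  interpret E: banach_over sE by fact
  interpret F: banach_over sF by fact
  obtain B where B: "0 \<le> B" "\<And>f. f \<in> C0 \<Longrightarrow> norm (T f) \<le> B * norm f"
    using C0_operator_bounded[OF E F T] by blast
  define T' where "T' f = T (Bcontfun f)" for f
  have add: "T' (\<lambda>x. f x + g x) = T' f + T' g" if "f \<in> c0_functions" "g \<in> c0_functions" for f g
  proof -
    have "Bcontfun (\<lambda>x. f x + g x) = Bcontfun f + Bcontfun g"
      using that by (intro bcontfun_eqI) (simp add: apply_Bcontfun_c0 c0_add)
    then show ?thesis
      using T Bcontfun_in_C0 that unfolding C0_operator_def T'_def by metis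
  qed
  have scale: "T' (\<lambda>x. sE c (f x)) = sF c (T' f)" if "f \<in> c0_functions" for c f
    using T Bcontfun_in_C0[OF that] Bcontfun_in_C0[OF E.c0_scale[OF that, of c]]
    unfolding C0_operator_def T'_def by (simp add: apply_Bcontfun_c0 E.c0_scale that)
  have bound: "norm (T' f) \<le> B * C" if f: "f \<in> c0_functions" "\<And>x. norm (f x) \<le> C" for f C
  proof -
    have "norm (Bcontfun f) \<le> C"
      using f by (intro norm_bound) (simp add: apply_Bcontfun_c0)
    then show ?thesis
      unfolding T'_def using B(2)[OF Bcontfun_in_C0[OF f(1)]] B(1) by (meson mult_left_mono order_trans)
  qed
  have zero: "T' (\<lambda>x. 0) = 0"
    using add[OF c0_zero c0_zero] by simp
  have sum: "T' (\<lambda>x. \<Sum>i\<in>I. f i x) = (\<Sum>i\<in>I. T' (f i))" if "finite I" "\<And>i. i \<in> I \<Longrightarrow> f i \<in> c0_functions"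
    for I :: "nat set" and f
    using that by (induction I) (auto simp: zero add c0_sum)
  have exh: "(\<lambda>n. T' (f n)) \<longlonglongrightarrow> 0"
    if f: "\<And>n::nat. f n \<in> c0_functions" "\<And>n x. norm (f n x) \<le> 1" "\<And>m n x. m \<noteq> n \<Longrightarrow> f m x = 0 \<or> f n x = 0" for f
  proof (rule tendsto_0_if_combinations_bounded[OF vsc no_linfty])
    fix S :: "nat set" and a :: "nat \<Rightarrow> 'k"
    assume S: "finite S" and a: "\<And>n. norm (a n) \<le> 1"
    have "norm (\<Sum>n\<in>S. sE (a n) (f n x)) \<le> 1" for x
    proof (cases "\<exists>n\<in>S. f n x \<noteq> 0")
      case True
      then obtain n where n: "n \<in> S" "f n x \<noteq> 0" by blast
      have "f m x = 0" if "m \<noteq> n" for m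
        using f(3)[OF that, of x] n(2) by simp
      then have "(\<Sum>n\<in>S. sE (a n) (f n x)) = sE (a n) (f n x)"
        using S n(1) by (simp add: sum.remove[of S n])
      then show ?thesis
        using a[of n] f(2)[of n x] by (simp add: E.norm_scale mult_le_one)
    next
      case False
      then show ?thesis by simp
    qed
    then have "norm (T' (\<lambda>x. \<Sum>n\<in>S. sE (a n) (f n x))) \<le> B * 1"
      by (intro bound c0_sum E.c0_scale f)
    then show "norm (\<Sum>n\<in>S. sF (a n) (T' (f n))) \<le> B * 1"
      using S f(1) by (simp add: sum scale E.c0_scale)
  qed
  show thesis
  proof (rule that[of B])
    show "exhaustive_C0_operator sE sF (\<lambda>f. T (Bcontfun f)) B"
      unfolding T'_def[symmetric] using lc add scale bound B(1) exh by unfold_locales blast+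
  qed
qed

theorem theorem6p6:
  fixes sE :: "'k::real_or_complex \<Rightarrow> 'a::banach \<Rightarrow> 'a"
    and sF :: "'k \<Rightarrow> 'b::banach \<Rightarrow> 'b"
    and T :: "('w::t2_space \<Rightarrow>\<^sub>C 'a) \<Rightarrow> 'b"
  assumes "banach_over sE"
    and "banach_over sF"
    and "variationally_seq_complete sF"
    and "\<not> contains_copy_of_linfty TYPE('b)"
    and "locally_compact_space (euclidean :: 'w topology)"
    and "C0_operator sE sF T"
  shows "(\<exists>!\<mu>. regular_borel_i_measure sE sF \<mu> \<and>
            (\<forall>f\<in>C0. T f = i_integral borel \<mu> (apply_bcontfun f))) \<and>
         (\<forall>\<mu>. regular_borel_i_measure sE sF \<mu> \<and>
            (\<forall>f\<in>C0. T f = i_integral borel \<mu> (apply_bcontfun f)) \<longrightarrow>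
            C0_norm T = total_semivariation borel \<mu>)"
proof -
  obtain B where "exhaustive_C0_operator sE sF (\<lambda>f. T (Bcontfun f)) B"
    using exhaustive_C0_operator_Bcontfun[OF assms] .
  then interpret exhaustive_C0_operator sE sF "\<lambda>f. T (Bcontfun f)" B .
  have rep: "T f = i_integral borel representing_measure (apply_bcontfun f)" if "f \<in> C0" for f
    using i_integral_representing[of "apply_bcontfun f"] that by (simp add: C0_iff apply_bcontfun_inverse)
  have unique: "\<mu> = representing_measure"
    if "regular_borel_i_measure sE sF \<mu>" "\<forall>f\<in>C0. T f = i_integral borel \<mu> (apply_bcontfun f)" for \<mu>
  proof (rule representing_measure_unique[OF that(1)])
    show "T (Bcontfun f) = i_integral borel \<mu> f" if "f \<in> c0_functions" for f
      using \<open>\<forall>f\<in>C0. T f = i_integral borel \<mu> (apply_bcontfun f)\<close> Bcontfun_in_C0[OF that] apply_Bcontfun_c0[OF that]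
      by metis
  qed
  have small_iff: "small UNIV c \<longleftrightarrow> C0_norm T \<le> ennreal c" if "0 \<le> c" for c
  proof -
    have unit: "f \<in> C0 \<and> norm f \<le> 1 \<longleftrightarrow> apply_bcontfun f \<in> c0_functions \<and> (\<forall>x. norm (apply_bcontfun f x) \<le> 1)"
      for f :: "'w \<Rightarrow>\<^sub>C 'a"
      by (metis C0_iff norm_bound norm_bounded order_trans)
    have "C0_norm T \<le> ennreal c \<longleftrightarrow> (\<forall>f. f \<in> C0 \<and> norm f \<le> 1 \<longrightarrow> norm (T f) \<le> c)"
      using that by (simp add: C0_norm_def SUP_le_iff)
    also have "\<dots> \<longleftrightarrow> small UNIV c"
      unfolding small_def unit by (metis UNIV_I apply_Bcontfun_c0 apply_bcontfun_inverse)
    finally show ?thesis by simp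
  qed
  \<comment> \<open>Both extended reals have the same finite upper bounds, and \<open>B\<close> is
    one of them, so both are finite and equal.\<close>
  have "C0_norm T = total_semivariation borel representing_measure"
  proof (rule antisym)
    have iff: "total_semivariation borel representing_measure \<le> ennreal c \<longleftrightarrow> C0_norm T \<le> ennreal c" if "0 \<le> c" for c
      using that by (simp add: total_semivariation_le_iff semivar_le_representing_iff small_iff)
    have "small UNIV B"
      unfolding small_def using T_bound[where C = 1] by simp
    then have B: "C0_norm T \<le> ennreal B"
      using small_iff[OF B_nonneg] by simp
    then have "C0_norm T < top" "total_semivariation borel representing_measure < top"
      using iff[OF B_nonneg] by (auto intro: le_less_trans)
    then show "C0_norm T \<le> total_semivariation borel representing_measure"
      and "total_semivariation borel representing_measure \<le> C0_norm T"
      using iff by (metis ennreal_cases order_refl less_irrefl)+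
  qed
  then show ?thesis
    using regular_representing rep unique by blast
qed

end
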